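(* Let $(W,S)$ be a Coxeter system with $S$ finite and with set of reflections $T$. (i) If $W$ is a finite Coxeter group, or an irreducible affine Weyl group which is not of type $\widetilde{A}_n$ with $n\geq 3$, then all realized root systems $\Phi$ of $(W,S)$ give the same reduced oriented matroid structure on $T\times\{\pm 1\}$; that is, the closure operator $c_\Phi$ on $T\times\{\pm1\}$ does not depend on $\Phi$. (ii) If $W$ is of type $\widetilde{A}_n$ with $n\geq 3$, then there are exactly three reduced oriented matroid structures on $T\times\{\pm1\}$ arising from realized root systems of $(W,S)$; that is, the set of closure operators $c_\Phi$, as $\Phi$ ranges over all realized root systems of $(W,S)$, has exactly three elements.
   Context: For a subset $\Gamma$ of a real vector space, $\mathrm{cone}(\Gamma)$ is the set of finite nonnegative real linear combinations of elements of $\Gamma\cup\{0\}$. $\Gamma$ is positively independent if there are no $n\ge 1$, pairwise distinct $\gamma_1,\dots,\gamma_n\in\Gamma$ and $c_1,\dots,c_n>0$ with $\sum c_i\gamma_i=0$. A realized root system datum is $D=(V,V^\vee,(-,-),\Pi,\Pi^\vee,\iota)$ where: $V,V^\vee$ are real vector spaces with positively independent subsets $\Pi\subseteq V$, $\Pi^\vee\subseteq V^\vee$; $\iota:\Pi\to\Pi^\vee$, $\alpha\mapsto\alpha^\vee$, is a bijection; $(-,-):V\times V^\vee\to\mathbb{R}$ is bilinear with $(\alpha,\alpha^\vee)=2$ for $\alpha\in\Pi$; and for all $\alpha\ne\beta$ in $\Pi$: $(\alpha,\beta^\vee)\le 0$, $(\alpha,\beta^\vee)=0$ iff $(\beta,\alpha^\vee)=0$,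 and $(\alpha,\beta^\vee)(\beta,\alpha^\vee)\in\{4\cos^2\frac{\pi}{m}\mid m\in\mathbb{N},m\ge 2\}\cup[4,\infty)$. It is assumed that $\Pi$ spans $V$ and $\Pi^\vee$ spans $V^\vee$. For $\alpha\in\Pi$ let $s_\alpha:V\to V$, $v\mapsto v-(v,\alpha^\vee)\alpha$. Then $\widehat S=\{s_\alpha\mid\alpha\in\Pi\}$ and the group $\widehat W$ it generates form a Coxeter system ($\alpha\mapsto s_\alpha$ being injective), in which $s_\alpha s_\beta$ ($\alpha\neq\beta$) has order $m$ if $(\alpha,\beta^\vee)(\beta,\alpha^\vee)=4\cos^2\frac{\pi}{m}$ and infinite order if this product is $\ge4$. A realized root system datum of a Coxeter system $(W,S)$ is such a $D$ together with an isomorphism of Coxeter systems $(W,S)\cong(\widehat W,\widehat S)$ (a group isomorphism restricting to a bijection $S\to\widehat S$), regarded as an identification. The corresponding realized root system is $\Phi=W\Pi$; $\Phi^+=\Phi\cap\mathrm{cone}(\Pi)$ and $\Phi=\Phi^+\,\dot\cup\,(-\Phi^+)$. For $\alpha=w(\beta)$ with $w\in W,\beta\in\Pi$, the reflection $s_\alpha=ws_\beta w^{-1}\in T$ is well defined, where $T=\bigcup_{w\in W}wSw^{-1}$. Define $\mathrm{cone}_\Phi(\Gamma)=\mathrm{cone}(\Gamma)\cap\Phi$ for $\Gamma\subseteq\Phi$ and the surjection $\pi:\Phi\to T\times\{\pm1\}$, $\epsilon\alpha\mapsto(s_\alpha,\epsilon)$ for $\alpha\in\Phi^+$, $\epsilon\in\{\pm1\}$.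 The (reduced) oriented matroid structure on $T\times\{\pm1\}$ given by $\Phi$ is $(T\times\{\pm1\},-,c_\Phi)$, where $-(t,\epsilon)=(t,-\epsilon)$ and $c_\Phi(A)=\pi(\mathrm{cone}_\Phi(\pi^{-1}(A)))$ for $A\subseteq T\times\{\pm1\}$; here an oriented matroid is a set with a fixed-point-free involution and a suitable closure operator. *)

theory Defs
  imports
    "HOL-Analysis.Finite_Function_Topology"
    "HOL-Analysis.Euclidean_Space"
    "HOL-Algebra.Bij"
    "HOL-Algebra.Generated_Groups"
    "HOL-Algebra.Multiplicative_Group"
begin

unbundle inner_syntax

section \<open>Coxeter systems\<close>

text \<open>
  A Coxeter system is a group \<open>W\<close> with a set \<open>S\<close> of involutions such that \<open>W\<close> has the presentation
  with generators \<open>S\<close> and relators \<open>(s t)\<^sup>m\<close> for those \<open>s, t\<close> whose product has finite order \<open>m\<close>.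
  The case \<open>s = t\<close> (where \<open>m = 1\<close>) gives the relators \<open>s s\<close>, so every generator is its own inverse
  in the presented group, and the presentation can be expressed with words in \<open>S\<close> alone.
  Recall that \<open>group.ord W x = 0\<close> if \<open>x\<close> has infinite order; the relator is then the empty word.
\<close>

inductive cox_step :: "('g, 'b) monoid_scheme \<Rightarrow> 'g set \<Rightarrow> 'g list \<Rightarrow> 'g list \<Rightarrow> bool"
  for W S where
  "\<lbrakk>u \<in> lists S; v \<in> lists S; s \<in> S; t \<in> S\<rbrakk> \<Longrightarrow>
    cox_step W S (u @ concat (replicate (group.ord W (s \<otimes>\<^bsub>W\<^esub> t)) [s, t]) @ v) (u @ v)"

definition word_prod :: "('g, 'b) monoid_scheme \<Rightarrow> 'g list \<Rightarrow> 'g" where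
  "word_prod W xs = foldr (\<otimes>\<^bsub>W\<^esub>) xs \<one>\<^bsub>W\<^esub>"

definition coxeter_system :: "('g, 'b) monoid_scheme \<Rightarrow> 'g set \<Rightarrow> bool" where
  "coxeter_system W S \<longleftrightarrow>
     group W \<and> S \<subseteq> carrier W \<and> (\<forall>s\<in>S. group.ord W s = 2) \<and> generate W S = carrier W \<and>
     (\<forall>u\<in>lists S. \<forall>v\<in>lists S. word_prod W u = word_prod W v \<longrightarrow> equivclp (cox_step W S) u v)"

definition reflections :: "('g, 'b) monoid_scheme \<Rightarrow> 'g set \<Rightarrow> 'g set" where
  "reflections W S = {w \<otimes>\<^bsub>W\<^esub> s \<otimes>\<^bsub>W\<^esub> inv\<^bsub>W\<^esub> w | w s. w \<in> carrier W \<and> s \<in> S}"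

definition coxeter_iso ::
  "('g \<Rightarrow> 'h) \<Rightarrow> ('g, 'b) monoid_scheme \<Rightarrow> 'g set \<Rightarrow> ('h, 'c) monoid_scheme \<Rightarrow> 'h set \<Rightarrow> bool" where
  "coxeter_iso f W S W' S' \<longleftrightarrow> f \<in> iso W W' \<and> f ` S = S'"

text \<open>The Coxeter graph is a cycle on \<open>n + 1\<close> vertices with all edges of weight 3.
  The exceptional graph of type \<open>A\<^sub>1\<close> tilde (an edge of infinite weight) is not covered.\<close>

definition type_A_tilde :: "nat \<Rightarrow> ('g, 'b) monoid_scheme \<Rightarrow> 'g set \<Rightarrow> bool" where
  "type_A_tilde n W S \<longleftrightarrow> n \<ge> 2 \<and>
     (\<exists>\<sigma>. bij_betw \<sigma> {..n} S \<and>
       (\<forall>i\<le>n. \<forall>j\<le>n. i \<noteq> j \<longrightarrow>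
          group.ord W (\<sigma> i \<otimes>\<^bsub>W\<^esub> \<sigma> j) =
            (if j = (i + 1) mod (n + 1) \<or> i = (j + 1) mod (n + 1) then 3 else 2)))"

section \<open>Cones and positive independence\<close>

definition cone_of :: "'v::real_vector set \<Rightarrow> 'v set" where
  "cone_of \<Gamma> = {\<Sum>x\<in>F. c x *\<^sub>R x | F c. finite F \<and> F \<subseteq> \<Gamma> \<union> {0} \<and> (\<forall>x\<in>F. c x \<ge> (0::real))}"

definition positively_independent :: "'v::real_vector set \<Rightarrow> bool" where
  "positively_independent \<Gamma> \<longleftrightarrow>
     \<not> (\<exists>F c. finite F \<and> F \<noteq> {} \<and> F \<subseteq> \<Gamma> \<and> (\<forall>x\<in>F. c x > (0::real)) \<and> (\<Sum>x\<in>F. c x *\<^sub>R x) = 0)"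

section \<open>Irreducible affine Weyl groups\<close>

text \<open>Reduced crystallographic root systems spanning a Euclidean space.\<close>

definition weyl_root_system :: "'e::euclidean_space set \<Rightarrow> bool" where
  "weyl_root_system R \<longleftrightarrow>
     finite R \<and> 0 \<notin> R \<and> span R = UNIV \<and>
     (\<forall>a\<in>R. \<forall>c. c *\<^sub>R a \<in> R \<longleftrightarrow> c = 1 \<or> c = -1) \<and>
     (\<forall>a\<in>R. \<forall>b\<in>R. b - (2 * (b \<bullet> a) / (a \<bullet> a)) *\<^sub>R a \<in> R) \<and>
     (\<forall>a\<in>R. \<forall>b\<in>R. 2 * (b \<bullet> a) / (a \<bullet> a) \<in> \<int>)"

definition irreducible_roots :: "'e::euclidean_space set \<Rightarrow> bool" where
  "irreducible_roots R \<longleftrightarrow> R \<noteq> {} \<and>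
     \<not> (\<exists>R1 R2. R1 \<noteq> {} \<and> R2 \<noteq> {} \<and> R1 \<union> R2 = R \<and> R1 \<inter> R2 = {} \<and> (\<forall>a\<in>R1. \<forall>b\<in>R2. a \<bullet> b = 0))"

definition simple_system :: "'e::euclidean_space set \<Rightarrow> 'e set \<Rightarrow> bool" where
  "simple_system R \<Delta> \<longleftrightarrow>
     \<Delta> \<subseteq> R \<and> independent \<Delta> \<and> (\<forall>a\<in>R. a \<in> cone_of \<Delta> \<or> - a \<in> cone_of \<Delta>)"

definition highest_root :: "'e::euclidean_space set \<Rightarrow> 'e set \<Rightarrow> 'e \<Rightarrow> bool" where
  "highest_root R \<Delta> \<theta> \<longleftrightarrow> \<theta> \<in> R \<and> (\<forall>a\<in>R. \<theta> - a \<in> cone_of \<Delta>)"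

text \<open>The orthogonal reflection in the hyperplane \<open>{x. x \<bullet> a = k}\<close>.\<close>

definition affine_reflection :: "'e::euclidean_space \<Rightarrow> int \<Rightarrow> 'e \<Rightarrow> 'e" where
  "affine_reflection a k = (\<lambda>x. x - ((x \<bullet> a - of_int k) * (2 / (a \<bullet> a))) *\<^sub>R a)"

definition affine_weyl_group :: "'e::euclidean_space set \<Rightarrow> ('e \<Rightarrow> 'e) monoid" where
  "affine_weyl_group R =
     BijGroup UNIV \<lparr>carrier := generate (BijGroup UNIV) {affine_reflection a k | a k. a \<in> R}\<rparr>"

definition affine_simple_reflections :: "'e::euclidean_space set \<Rightarrow> 'e \<Rightarrow> ('e \<Rightarrow> 'e) set" where
  "affine_simple_reflections \<Delta> \<theta> = {affine_reflection a 0 | a. a \<in> \<Delta>} \<union> {affine_reflection \<theta> 1}"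

text \<open>The type argument is the Euclidean space on which the group acts by affine isometries.\<close>

definition irreducible_affine_weyl_group ::
  "'e::euclidean_space itself \<Rightarrow> ('g, 'b) monoid_scheme \<Rightarrow> 'g set \<Rightarrow> bool" where
  "irreducible_affine_weyl_group _ W S \<longleftrightarrow>
     (\<exists>(R::'e set) \<Delta> \<theta> f.
        weyl_root_system R \<and> irreducible_roots R \<and> simple_system R \<Delta> \<and> highest_root R \<Delta> \<theta> \<and>
        coxeter_iso f W S (affine_weyl_group R) (affine_simple_reflections \<Delta> \<theta>))"

section \<open>Realized root system data\<close>

text \<open>
  The vector spaces \<open>V\<close> and \<open>V\<^sup>\<or>\<close> are subspaces (given as sets) of ambient types \<open>'v\<close> and \<open>'d\<close>; the
  pairing and the bijection \<open>\<iota>\<close> only matter on these subspaces and on \<open>\<Pi>\<close>, respectively.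
\<close>

record ('v, 'd) root_datum =
  space_V :: "'v set"
  space_Vd :: "'d set"
  pairing :: "'v \<Rightarrow> 'd \<Rightarrow> real"
  simple :: "'v set"
  cosimple :: "'d set"
  iota :: "'v \<Rightarrow> 'd"

definition bilinear_between ::
  "'v::real_vector set \<Rightarrow> 'd::real_vector set \<Rightarrow> ('v \<Rightarrow> 'd \<Rightarrow> real) \<Rightarrow> bool" where
  "bilinear_between V V' B \<longleftrightarrow>
     (\<forall>x\<in>V. \<forall>x'\<in>V. \<forall>y\<in>V'. \<forall>a b. B (a *\<^sub>R x + b *\<^sub>R x') y = a * B x y + b * B x' y) \<and>
     (\<forall>x\<in>V. \<forall>y\<in>V'. \<forall>y'\<in>V'. \<forall>a b. B x (a *\<^sub>R y + b *\<^sub>R y') = a * B x y + b * B x y')"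

definition realized_root_datum :: "('v::real_vector, 'd::real_vector) root_datum \<Rightarrow> bool" where
  "realized_root_datum D \<longleftrightarrow>
     span (simple D) = space_V D \<and> span (cosimple D) = space_Vd D \<and>
     positively_independent (simple D) \<and> positively_independent (cosimple D) \<and>
     bij_betw (iota D) (simple D) (cosimple D) \<and>
     bilinear_between (space_V D) (space_Vd D) (pairing D) \<and>
     (\<forall>\<alpha>\<in>simple D. pairing D \<alpha> (iota D \<alpha>) = 2) \<and>
     (\<forall>\<alpha>\<in>simple D. \<forall>\<beta>\<in>simple D. \<alpha> \<noteq> \<beta> \<longrightarrow>
        pairing D \<alpha> (iota D \<beta>) \<le> 0 \<and>
        (pairing D \<alpha> (iota D \<beta>) = 0 \<longleftrightarrow> pairing D \<beta> (iota D \<alpha>) = 0) \<and>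
        pairing D \<alpha> (iota D \<beta>) * pairing D \<beta> (iota D \<alpha>)
          \<in> {4 * (cos (pi / real m))\<^sup>2 | m::nat. m \<ge> 2} \<union> {4..})"

text \<open>Functions are restricted to \<open>V\<close> so as to be elements of the library's permutation group of \<open>V\<close>.\<close>

definition simple_refl :: "('v::real_vector, 'd) root_datum \<Rightarrow> 'v \<Rightarrow> 'v \<Rightarrow> 'v" where
  "simple_refl D \<alpha> = (\<lambda>v\<in>space_V D. v - pairing D v (iota D \<alpha>) *\<^sub>R \<alpha>)"

definition datum_group :: "('v::real_vector, 'd) root_datum \<Rightarrow> ('v \<Rightarrow> 'v) monoid" where
  "datum_group D =
     BijGroup (space_V D) \<lparr>carrier := generate (BijGroup (space_V D)) (simple_refl D ` simple D)\<rparr>"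

text \<open>A realized root system datum of \<open>(W, S)\<close> is a pair \<open>D, \<phi>\<close> with \<open>\<phi>\<close> the identifying isomorphism.\<close>

definition realized_datum_of ::
  "('g, 'b) monoid_scheme \<Rightarrow> 'g set \<Rightarrow> ('v::real_vector, 'd::real_vector) root_datum \<Rightarrow>
   ('g \<Rightarrow> 'v \<Rightarrow> 'v) \<Rightarrow> bool" where
  "realized_datum_of W S D \<phi> \<longleftrightarrow>
     realized_root_datum D \<and> coxeter_iso \<phi> W S (datum_group D) (simple_refl D ` simple D)"

definition roots ::
  "('g, 'b) monoid_scheme \<Rightarrow> ('v, 'd) root_datum \<Rightarrow> ('g \<Rightarrow> 'v \<Rightarrow> 'v) \<Rightarrow> 'v set" where
  "roots W D \<phi> = {\<phi> w \<beta> | w \<beta>. w \<in> carrier W \<and> \<beta> \<in> simple D}"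

definition pos_roots ::
  "('g, 'b) monoid_scheme \<Rightarrow> ('v::real_vector, 'd) root_datum \<Rightarrow> ('g \<Rightarrow> 'v \<Rightarrow> 'v) \<Rightarrow> 'v set" where
  "pos_roots W D \<phi> = roots W D \<phi> \<inter> cone_of (simple D)"

definition root_refl ::
  "('g, 'b) monoid_scheme \<Rightarrow> 'g set \<Rightarrow> ('v::real_vector, 'd) root_datum \<Rightarrow> ('g \<Rightarrow> 'v \<Rightarrow> 'v) \<Rightarrow>
   'v \<Rightarrow> 'g" where
  "root_refl W S D \<phi> \<alpha> =
     (THE t. \<exists>w\<in>carrier W. \<exists>\<beta>\<in>simple D. \<exists>s\<in>S.
        \<phi> w \<beta> = \<alpha> \<and> \<phi> s = simple_refl D \<beta> \<and> t = w \<otimes>\<^bsub>W\<^esub> s \<otimes>\<^bsub>W\<^esub> inv\<^bsub>W\<^esub> w)"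

section \<open>The reduced oriented matroid structure\<close>

definition cone_in :: "'v::real_vector set \<Rightarrow> 'v set \<Rightarrow> 'v set" where
  "cone_in \<Phi> \<Gamma> = cone_of \<Gamma> \<inter> \<Phi>"

text \<open>The sign group is \<open>{1, -1} \<subseteq> \<int>\<close>. A root outside \<open>\<Phi>\<^sup>+\<close> is \<open>(-1) \<cdot> (- \<alpha>)\<close> with \<open>- \<alpha> \<in> \<Phi>\<^sup>+\<close>.\<close>

definition signed_refl ::
  "('g, 'b) monoid_scheme \<Rightarrow> 'g set \<Rightarrow> ('v::real_vector, 'd) root_datum \<Rightarrow> ('g \<Rightarrow> 'v \<Rightarrow> 'v) \<Rightarrow>
   'v \<Rightarrow> 'g \<times> int" where
  "signed_refl W S D \<phi> \<alpha> =
     (if \<alpha> \<in> pos_roots W D \<phi> then (root_refl W S D \<phi> \<alpha>, 1) else (root_refl W S D \<phi> (- \<alpha>), -1))"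

text \<open>The operator is restricted to subsets of \<open>T \<times> {1, -1}\<close>, so that equality of two such
  HOL functions is equality of the operators on that set. The ground set and the involution
  \<open>(t, \<epsilon>) \<mapsto> (t, - \<epsilon>)\<close> do not depend on the datum, so it determines the oriented matroid structure.\<close>

definition closure_op ::
  "('g, 'b) monoid_scheme \<Rightarrow> 'g set \<Rightarrow> ('v::real_vector, 'd) root_datum \<Rightarrow> ('g \<Rightarrow> 'v \<Rightarrow> 'v) \<Rightarrow>
   ('g \<times> int) set \<Rightarrow> ('g \<times> int) set" where
  "closure_op W S D \<phi> =
     (\<lambda>A \<in> Pow (reflections W S \<times> {1, -1}).
        signed_refl W S D \<phi> `
          cone_in (roots W D \<phi>) {\<alpha> \<in> roots W D \<phi>. signed_refl W S D \<phi> \<alpha> \<in> A})"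

text \<open>The set of operators arising from data whose vector spaces lie in the types \<open>'v\<close> and \<open>'d\<close>.\<close>

definition closure_ops ::
  "'v::real_vector itself \<Rightarrow> 'd::real_vector itself \<Rightarrow> ('g, 'b) monoid_scheme \<Rightarrow> 'g set \<Rightarrow>
   (('g \<times> int) set \<Rightarrow> ('g \<times> int) set) set" where
  "closure_ops _ _ W S =
     {closure_op W S D \<phi> | (D :: ('v, 'd) root_datum) \<phi>. realized_datum_of W S D \<phi>}"

text \<open>If \<open>S\<close> is finite, the spaces of a realized root system datum are finite-dimensional, hence
  isomorphic to subspaces of the following real vector space of countable dimension.\<close>

type_synonym real_inf = "nat \<Rightarrow>\<^sub>0 real"

end

theory Submission
  imports Defs
begin

text \<open>
  A realized datum of \<open>(W, S)\<close> enters only through the matrix \<open>a s t = (\<alpha>\<^sub>s, \<alpha>\<^sub>t\<^sup>\<or>)\<close>: in all cases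
  considered the kernel of this matrix contains no vector with coefficients of both signs, so positive
  independence of the simple roots amounts to linear independence, and by Tits' argument the sign of a
  root \<open>w \<alpha>\<^sub>s\<close> and its reflection \<open>w s w\<^sup>-\<^sup>1\<close> can be read off from \<open>(w, s)\<close>. By Farkas' lemma the closure
  operator is then determined by the sign patterns of linear functionals on finite sets of roots.
  Rescaling the simple roots does not change these.

  If \<open>W\<close> is finite, averaging provides an invariant inner product and makes all matrices rescalings of
  each other. If \<open>W\<close> is affine of rank at least three, the extended simple roots satisfy a single linear
  relation, which has positive coefficients. If the Coxeter graph contains a cycle, then the sum of the
  corresponding unit vectors has norm at most zero, so it is this relation and the graph is the cycle;
  otherwise the graph is a forest, and all matrices are rescalings of each other.

  For a cycle of length \<open>N\<close>, a matrix is up to rescaling given by one number \<open>q > 0\<close>: the roots are the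
  multiples of \<open>e\<^sub>i - e\<^sub>j\<close> with \<open>i\<close>, \<open>j\<close> incongruent modulo \<open>N\<close>, where \<open>e\<^bsub>i+N\<^esub> = q e\<^sub>i\<close>, functionals are
  functions \<open>z\<close> on the integers with \<open>z (i + N) = q z i\<close> (or \<open>z (i + N) = z i + \<tau>\<close>, if \<open>q = 1\<close>), and only
  the order relations between values of \<open>z\<close> matter. The increasing maps \<open>x \<mapsto> sgn x \<bar>x\<bar>\<^sup>p\<close> identify all
  \<open>q > 1\<close> and all \<open>q < 1\<close>. For \<open>N \<le> 3\<close> logarithms identify these with \<open>q = 1\<close>, since at most one sign is
  taken by \<open>z\<close> on two residue classes; the infinite dihedral group is the case \<open>N = 2\<close>. For \<open>N \<ge> 4\<close>, the
  roots \<open>e\<^sub>0 - e\<^sub>1\<close>, \<open>e\<^sub>1 - q e\<^sub>0\<close> span \<open>(1 - q) e\<^sub>0\<close> and \<open>e\<^sub>3 - e\<^sub>2\<close>, \<open>q e\<^sub>2 - e\<^sub>3\<close> span \<open>(q - 1) e\<^sub>2\<close>, so whether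
  \<open>e\<^sub>0 - e\<^sub>2\<close> or its negative is in their cone depends on the sign of \<open>q - 1\<close>.
\<close>

section \<open>Words and lengths\<close>

text \<open>A datum may live in any two real vector spaces, and its matrix need not be
  symmetrizable; for pairs of infinite order even the product \<open>a s t * a t s\<close> is free.
  No invariant inner product is therefore at hand in general, and Tits' argument is carried out in
  coordinates over \<open>S\<close> for arbitrary matrices. Cones consist of finite combinations, so
  two operators agree as soon as every functional for one matrix has, on each finite set of roots,
  the signs of some functional for the other. For affine groups of rank at least three, integrality
  makes all orders finite and fixes all products, so that only a cycle leaves a continuous
  parameter. Four residue classes are what makes this parameter visible. Under the shift by N all
  values of z drift by the same amount if q = 1, whereas for q > 1 positive values rise and negative
  ones fall. Roots never compare congruent indices, so a class that is alone on its side of 0 shows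
  no drift of its own; opposite drifts become visible when both sides carry two classes.\<close>

locale coxeter =
  fixes W :: "('g, 'b) monoid_scheme" (structure) and S :: "'g set"
  assumes cox: "coxeter_system W S" and finS: "finite S"
begin

sublocale group W
  using cox by (simp add: coxeter_system_def)

lemma S_carrier: "s \<in> S \<Longrightarrow> s \<in> carrier W"
  using cox by (auto simp: coxeter_system_def)

lemma S_invol: "s \<in> S \<Longrightarrow> s \<otimes> s = \<one>"
proof -
  assume s: "s \<in> S"
  then have "ord s = 2" using cox by (auto simp: coxeter_system_def)
  then have "s [^] (2::nat) = \<one>" using pow_ord_eq_1[of s] S_carrier[OF s] by simp
  then show ?thesis using S_carrier[OF s] by (simp add: numeral_2_eq_2)
qed

lemma S_inv: "s \<in> S \<Longrightarrow> inv s = s"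
  using S_invol S_carrier by (simp add: inv_equality)

lemma word_prod_Nil [simp]: "word_prod W [] = \<one>"
  by (simp add: word_prod_def)

lemma word_prod_Cons [simp]: "word_prod W (s # u) = s \<otimes> word_prod W u"
  by (simp add: word_prod_def)

lemma word_prod_closed [simp]: "u \<in> lists S \<Longrightarrow> word_prod W u \<in> carrier W"
  by (induction u) (auto simp: S_carrier)

lemma word_prod_append: "u \<in> lists S \<Longrightarrow> v \<in> lists S \<Longrightarrow> word_prod W (u @ v) = word_prod W u \<otimes> word_prod W v"
  by (induction u) (auto simp: S_carrier m_assoc)

lemma word_prod_rev: "u \<in> lists S \<Longrightarrow> word_prod W (rev u) = inv (word_prod W u)"
proof (induction u)
  case (Cons s u)
  then have "rev u \<in> lists S" "[s] \<in> lists S" "s \<in> S" "u \<in> lists S" by auto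
  from word_prod_append[OF this(1,2)] this(3,4) Cons.IH show ?case
    by (simp add: S_carrier inv_mult_group S_inv del: in_lists_conv_set)
qed simp

lemma word_ex:
  assumes "w \<in> carrier W" shows "\<exists>u\<in>lists S. word_prod W u = w"
proof -
  have "w \<in> generate W S" using cox assms by (simp add: coxeter_system_def)
  then show ?thesis
  proof induction
    case one show ?case by (rule bexI[of _ "[]"]) auto
  next
    case (incl h) then show ?case by (intro bexI[of _ "[h]"]) (auto simp: S_carrier)
  next
    case (inv h) then show ?case by (intro bexI[of _ "[h]"]) (auto simp: S_carrier S_inv)
  next
    case (eng h1 h2)
    then obtain u v where "u \<in> lists S" "v \<in> lists S" "word_prod W u = h1" "word_prod W v = h2" by blast
    then show ?case by (intro bexI[of _ "u @ v"]) (auto simp: word_prod_append)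
  qed
qed

text \<open>The presentation is used only in this form: a function of words that is unchanged when a
  relator is deleted depends on the group element alone. It yields the parity of lengths and the
  representation \<open>rho\<close>.\<close>

lemma presentation_invariant:
  assumes rel: "\<And>u v s t. u \<in> lists S \<Longrightarrow> v \<in> lists S \<Longrightarrow> s \<in> S \<Longrightarrow> t \<in> S \<Longrightarrow>
      F (u @ concat (replicate (ord (s \<otimes> t)) [s, t]) @ v) = F (u @ v)"
    and "u \<in> lists S" "v \<in> lists S" "word_prod W u = word_prod W v"
  shows "F u = F v"
proof -
  have "equivclp (cox_step W S) u v" using cox assms(2-4) by (auto simp: coxeter_system_def)
  moreover have "F y = F z" if "cox_step W S y z" for y z using that
  proof cases
    case (1 u v s t)
    then show ?thesis using rel[of u v s t] by simp
  qed
  ultimately show ?thesis by (induction rule: equivclp_induct) auto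
qed

section \<open>The length function\<close>

definition len :: "'g \<Rightarrow> nat" where
  "len w = (LEAST n. \<exists>u\<in>lists S. length u = n \<and> word_prod W u = w)"

lemma reduced_ex:
  assumes "w \<in> carrier W" shows "\<exists>u\<in>lists S. length u = len w \<and> word_prod W u = w"
proof -
  obtain u where "u \<in> lists S" "word_prod W u = w" using word_ex[OF assms] by blast
  then have "\<exists>n. \<exists>u\<in>lists S. length u = n \<and> word_prod W u = w" by blast
  from LeastI_ex[OF this] show ?thesis unfolding len_def .
qed

lemma len_le: "u \<in> lists S \<Longrightarrow> len (word_prod W u) \<le> length u"
  unfolding len_def by (rule Least_le) auto

text \<open>All relators have even length.\<close>

lemma parity:
  assumes "u \<in> lists S" "v \<in> lists S" "word_prod W u = word_prod W v"
  shows "even (length u) = even (length v)"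
  by (rule presentation_invariant[where F="\<lambda>u. even (length u)"])
    (use assms in \<open>auto simp: length_concat sum_list_replicate\<close>)

lemma len_mult:
  assumes "x \<in> carrier W" "y \<in> carrier W" shows "len (x \<otimes> y) \<le> len x + len y"
proof -
  obtain u v where "u \<in> lists S" "length u = len x" "word_prod W u = x"
    "v \<in> lists S" "length v = len y" "word_prod W v = y" using reduced_ex assms by metis
  then show ?thesis using len_le[of "u @ v"] by (auto simp: word_prod_append)
qed

lemma len_S: "s \<in> S \<Longrightarrow> len s \<le> 1"
  using len_le[of "[s]"] by (auto simp: S_carrier)

lemma mult_S_S: "w \<in> carrier W \<Longrightarrow> s \<in> S \<Longrightarrow> w \<otimes> s \<otimes> s = w"
  by (simp add: m_assoc S_carrier S_invol)

text \<open>Subadditivity bounds the change by one, and parity excludes equality.\<close>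

lemma len_step:
  assumes "w \<in> carrier W" "s \<in> S"
  shows "len (w \<otimes> s) = Suc (len w) \<or> Suc (len (w \<otimes> s)) = len w"
proof -
  have sc: "s \<in> carrier W" using assms S_carrier by auto
  have 1: "len (w \<otimes> s) \<le> Suc (len w)" using len_mult[OF assms(1) sc] len_S[OF assms(2)] by simp
  have 2: "len w \<le> Suc (len (w \<otimes> s))"
    using len_mult[OF m_closed[OF assms(1) sc] sc] len_S[OF assms(2)] mult_S_S[OF assms] by simp
  obtain u where u: "u \<in> lists S" "length u = len w" "word_prod W u = w" using reduced_ex assms by metis
  obtain v where v: "v \<in> lists S" "length v = len (w \<otimes> s)" "word_prod W v = w \<otimes> s"
    using reduced_ex[of "w \<otimes> s"] assms sc by auto
  have "even (length v) = even (length (u @ [s]))"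
    using parity[of v "u @ [s]"] u v assms sc by (auto simp: word_prod_append)
  then have "len (w \<otimes> s) \<noteq> len w" using u v by auto
  then show ?thesis using 1 2 by linarith
qed

lemma len_one [simp]: "len \<one> = 0"
  using len_le[of "[]"] by simp

lemma ord_S_S: "s \<in> S \<Longrightarrow> t \<in> S \<Longrightarrow> s \<noteq> t \<Longrightarrow> ord (s \<otimes> t) \<noteq> 1"
  by (metis S_carrier S_inv inv_equality m_closed ord_eq_1)

lemma ord_commute: "s \<in> S \<Longrightarrow> t \<in> S \<Longrightarrow> ord (t \<otimes> s) = ord (s \<otimes> t)"
  by (metis S_carrier S_inv inv_mult_group m_closed ord_inv)

end

section \<open>Products of two reflections\<close>

text \<open>Chebyshev polynomials of the second kind in p / 2 - 1: for p = 4 cos^2 \<theta> the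
  value at k is sin (2 k \<theta>) / sin (2 \<theta>). They describe the powers of a product of two
  reflections, whose matrix on the plane of the two roots has trace p - 2 and determinant 1.\<close>

fun cheb :: "real \<Rightarrow> nat \<Rightarrow> real" where
  "cheb p 0 = 0"
| "cheb p (Suc 0) = 1"
| "cheb p (Suc (Suc k)) = (p - 2) * cheb p (Suc k) - cheb p k"

lemma cheb_sin:
  assumes "p = 4 * (cos \<theta>)\<^sup>2"
  shows "sin (2 * \<theta>) * cheb p k = sin (2 * real k * \<theta>)"
proof (induction k rule: induct_nat_012)
  case (ge2 k)
  have p: "p - 2 = 2 * cos (2 * \<theta>)" using assms by (simp add: cos_double_cos)
  have "sin (2 * \<theta>) * cheb p (Suc (Suc k))
      = (p - 2) * (sin (2 * \<theta>) * cheb p (Suc k)) - sin (2 * \<theta>) * cheb p k" by (simp add: algebra_simps)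
  also have "\<dots> = 2 * cos (2 * \<theta>) * sin (2 * real (Suc k) * \<theta>) - sin (2 * real k * \<theta>)"
    using ge2 p by (simp add: mult.assoc)
  also have "\<dots> = sin (2 * real (Suc (Suc k)) * \<theta>)"
  proof -
    define x where "x = 2 * real (Suc k) * \<theta>"
    have "2 * real k * \<theta> = x - 2 * \<theta>" "2 * real (Suc (Suc k)) * \<theta> = x + 2 * \<theta>"
      by (auto simp: x_def algebra_simps)
    then show ?thesis by (simp add: sin_add sin_diff x_def[symmetric] del: of_nat_Suc)
  qed
  finally show ?case .
qed auto

text \<open>As p - 2 is at least 2, the increments of the sequence never fall below the first one,
  which is 1; the two bounds support each other in the induction.\<close>

lemma cheb_ge_four:
  assumes "p \<ge> 4" shows "cheb p k \<ge> real k \<and> cheb p (Suc k) \<ge> cheb p k + 1"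
proof (induction k)
  case (Suc k)
  have "(p - 2) * cheb p (Suc k) \<ge> 2 * cheb p (Suc k)"
    using assms Suc by (intro mult_right_mono) auto
  moreover have "cheb p (Suc (Suc k)) = (p - 2) * cheb p (Suc k) - cheb p k" by simp
  ultimately show ?case using Suc unfolding of_nat_Suc by linarith
qed simp

text \<open>If \<open>s\<close>, \<open>t\<close> are (affine) reflections in \<open>\<alpha>\<close>, \<open>\<beta>\<close> with \<open>\<langle>\<alpha>, t\<rangle> = x\<close>, \<open>\<langle>\<beta>, s\<rangle> = y\<close>, and if \<open>s\<close>, \<open>t\<close> move a
  point \<open>v\<close> by \<open>- f \<alpha>\<close>, \<open>- g \<beta>\<close>, then \<open>st (v + P \<alpha> + Q \<beta>) = v + P' \<alpha> + Q' \<beta>\<close> for \<open>(P', Q') = dstep f g x y (P, Q)\<close>.\<close>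

definition dstep :: "real \<Rightarrow> real \<Rightarrow> real \<Rightarrow> real \<Rightarrow> real \<times> real \<Rightarrow> real \<times> real" where
  "dstep f g x y = (\<lambda>(P, Q). let Q' = - Q - g - P * x in (- P - f - Q' * y, Q'))"

text \<open>For \<open>f = 2\<close> and \<open>g = x\<close> the point that is moved is the root
  \<alpha> itself, so this is the orbit of \<alpha> under the powers of st.\<close>

lemma dstep_root:
  assumes "x * y = p"
  shows "(dstep 2 x x y ^^ k) (0, 0) = (cheb p (Suc k) + cheb p k - 1, - x * cheb p k)"
proof (induction k)
  case (Suc k)
  have "x * (y * r) = p * r" for r using assms by (metis mult.assoc)
  moreover have "(dstep 2 x x y ^^ Suc k) (0, 0) = dstep 2 x x y ((dstep 2 x x y ^^ k) (0, 0))" by simp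
  ultimately show ?case unfolding Suc by (simp add: dstep_def Let_def algebra_simps)
qed simp

text \<open>The conditions on \<open>f\<close> and \<open>g\<close> say that (P, Q) is a fixed point
  of the step. Around it the step is linear with a matrix M of trace p - 2 and determinant 1, and
  Cayley-Hamilton expresses M^k by M and the identity; the coefficient of the identity is minus the
  Chebyshev value at k - 1, written through its two successors so that k = 0 needs no
  exception.\<close>

lemma dstep_fixpoint:
  assumes p: "x * y = p" and f: "f = - 2 * P - Q * y" and g: "g = - x * P - 2 * Q"
  shows "(dstep f g x y ^^ k) (0, 0) =
    (P - (cheb p k * ((p - 1) * P + y * Q) + (cheb p (Suc k) - (p - 2) * cheb p k) * P),
     Q - (cheb p k * (- x * P - Q) + (cheb p (Suc k) - (p - 2) * cheb p k) * Q))"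
proof (induction k)
  case (Suc k)
  define c d where "c = cheb p k" and "d = cheb p (Suc k)"
  have E: "(dstep f g x y ^^ Suc k) (0, 0) = dstep f g x y ((dstep f g x y ^^ k) (0, 0))" by simp
  have "cheb p (Suc (Suc k)) = (p - 2) * d - c" by (simp add: c_def d_def)
  then show ?case
    unfolding E Suc c_def[symmetric] d_def[symmetric] \<open>cheb p (Suc (Suc k)) = (p - 2) * d - c\<close>
    by (simp add: dstep_def Let_def f g p[symmetric] algebra_simps)
qed simp

lemma angle_small:
  assumes "m \<ge> (3::nat)" shows "sin (2 * (pi / m)) > 0" "sin (pi / m) > 0" "cos (pi / m) > 0"
proof -
  have "2 * pi < m * pi" using assms by (intro mult_strict_right_mono) auto
  then have "2 * (pi / m) < pi" using assms by (simp add: field_simps)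
  moreover have "pi / m > 0" using assms by simp
  ultimately show "sin (2 * (pi / m)) > 0" "sin (pi / m) > 0" "cos (pi / m) > 0"
    using sin_gt_zero[of "2 * (pi / m)"] sin_gt_zero[of "pi / m"] cos_gt_zero_pi[of "pi / m"] by linarith+
qed

lemma dstep_order:
  assumes p: "x * y = 4 * (cos (pi / real m))\<^sup>2" and m: "m \<ge> 2" and z: "x = 0 \<longleftrightarrow> y = 0"
  shows "(dstep f g x y ^^ m) (0, 0) = (0, 0)"
\<comment> \<open>For m = 2 the denominator sin (2 pi / m) of the Chebyshev formula vanishes; here x
  = y = 0 and the two reflections commute.\<close>
proof (cases "m = 2")
  case True
  then have "x = 0" "y = 0" using p z by auto
  then show ?thesis using True by (simp add: numeral_2_eq_2 dstep_def)
next
  case False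
  then have m3: "m \<ge> 3" using m by simp
  note sp = angle_small[OF m3]
  define p' where "p' = 4 * (cos (pi / real m))\<^sup>2"
  have "4 - p' = 4 * (sin (pi / m))\<^sup>2" by (simp add: p'_def sin_squared_eq algebra_simps)
  then have d: "4 - p' \<noteq> 0" using sp by simp
  \<comment> \<open>Cramer's rule for the fixed point; the determinant 4 - p' equals 4 sin^2 (pi /
    m).\<close>
  define P Q where "P = (g * y - 2 * f) / (4 - p')" and "Q = (f * x - 2 * g) / (4 - p')"
  have P': "P * (4 - p') = g * y - 2 * f" and Q': "Q * (4 - p') = f * x - 2 * g"
    using d by (auto simp: P_def Q_def)
  have xy: "x * y = p'" using p by (simp add: p'_def)
  have xy': "x * (y * r) = p' * r" for r by (metis xy mult.assoc)
  have "f * (4 - p') = - 2 * (P * (4 - p')) - (Q * (4 - p')) * y"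
    unfolding P' Q' by (simp add: algebra_simps xy xy')
  then have "f * (4 - p') = (- 2 * P - Q * y) * (4 - p')" by (simp add: algebra_simps)
  then have f: "f = - 2 * P - Q * y" using d by simp
  have "g * (4 - p') = - x * (P * (4 - p')) - 2 * (Q * (4 - p'))"
    unfolding P' Q' by (simp add: algebra_simps xy xy')
  then have "g * (4 - p') = (- x * P - 2 * Q) * (4 - p')" by (simp add: algebra_simps)
  then have g: "g = - x * P - 2 * Q" using d by simp
  have "sin (2 * (pi / m)) * cheb p' m = sin (2 * real m * (pi / m))"
    using cheb_sin p'_def by blast
  then have c0: "cheb p' m = 0" using sp m3 by simp
  have "sin (2 * (pi / m)) * cheb p' (Suc m) = sin (2 * real (Suc m) * (pi / m))"
    using cheb_sin p'_def by blast
  also have "2 * real (Suc m) * (pi / m) = 2 * (pi / m) + 2 * pi" using m3 by (simp add: field_simps)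
  also have "sin \<dots> = sin (2 * (pi / m))" by simp
  finally have c1: "cheb p' (Suc m) = 1" using sp by simp
  show ?thesis using dstep_fixpoint[OF _ f g, of p' m] c0 c1 p by (simp add: p'_def)
qed

text \<open>The second coordinate gives sin (2 k pi / m) = 0, from which only
  \<open>m dvd 2 * k\<close> would follow; the first coordinate makes the cosine of the same angle
  equal to 1.\<close>

lemma dstep_order_conv:
  assumes p: "x * y = 4 * (cos (pi / real m))\<^sup>2" and m: "m \<ge> 2" and z: "x = 0 \<longleftrightarrow> y = 0"
    and k: "(dstep 2 x x y ^^ k) (0, 0) = (0, 0)"
  shows "m dvd k"
proof (cases "m = 2")
  case True
  then have x: "x = 0" "y = 0" using p z by auto
  have "(dstep 2 x x y ^^ k) (0, 0) = (if even k then 0 else - 2, 0)"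
    by (induction k) (auto simp: dstep_def x)
  then show ?thesis using k True by (auto split: if_splits)
next
  case False
  then have m3: "m \<ge> 3" using m by simp
  note sp = angle_small[OF m3]
  define p' where "p' = 4 * (cos (pi / real m))\<^sup>2"
  have "x \<noteq> 0" using p sp by auto
  then have c: "cheb p' k = 0" "cheb p' (Suc k) = 1"
    using dstep_root[OF p, of k] k by (auto simp: p'_def)
  have 1: "sin (2 * real k * (pi / m)) = 0" using cheb_sin[OF p'_def, of k] c by simp
  have "sin (2 * (pi / m)) = sin (2 * real (Suc k) * (pi / m))" using cheb_sin[OF p'_def, of "Suc k"] c by simp
  also have "2 * real (Suc k) * (pi / m) = 2 * real k * (pi / m) + 2 * (pi / m)" by (simp add: algebra_simps add_divide_distrib)
  also have "sin \<dots> = cos (2 * real k * (pi / m)) * sin (2 * (pi / m))" by (simp only: sin_add 1)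
  finally have "cos (2 * real k * (pi / m)) = 1" using sp by simp
  then obtain n :: int where "2 * real k * (pi / m) = real_of_int n * 2 * pi" using cos_one_2pi_int by blast
  then have "real k = real_of_int n * real m" using m3 by (simp add: field_simps)
  then have "int k = n * int m" by (metis of_int_eq_iff of_int_mult of_int_of_nat_eq)
  then show ?thesis by (metis dvd_triv_right int_dvd_int_iff)
qed

lemma dstep_infinite:
  assumes p: "x * y \<ge> 4" and k: "(dstep 2 x x y ^^ k) (0, 0) = (0, 0)"
  shows "k = 0"
proof -
  have "cheb (x * y) k = 0" using dstep_root[where x=x and y=y and k=k, OF refl] k p by auto
  then show ?thesis using cheb_ge_four[OF p, of k] by simp
qed

text \<open>Both expressions are positive multiples of sin (k pi / m). They occur as coefficients of
  the roots of a finite dihedral group.\<close>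

lemma cheb_alternating_nonneg:
  assumes p: "p = 4 * (cos (pi / real m))\<^sup>2" and m: "m \<ge> 3" and k: "k \<le> m"
  shows "even k \<Longrightarrow> cheb p (k div 2) \<ge> 0" "odd k \<Longrightarrow> cheb p (Suc (k div 2)) + cheb p (k div 2) \<ge> 0"
proof -
  note sp = angle_small[OF m]
  have "real k * (pi / m) \<le> pi" using m k by (simp add: field_simps)
  then have s: "sin (real k * (pi / m)) \<ge> 0" by (intro sin_ge_zero) auto
  { assume "even k"
    then have "2 * real (k div 2) = real k" by (metis dvd_mult_div_cancel of_nat_mult of_nat_numeral)
    then have "sin (2 * (pi / m)) * cheb p (k div 2) \<ge> 0" using cheb_sin[OF p, of "k div 2"] s by metis
    then show "cheb p (k div 2) \<ge> 0" using sp by (simp add: zero_le_mult_iff) }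
  { assume "odd k"
    then have kk: "real k = 2 * real (k div 2) + 1"
      by (metis odd_two_times_div_two_succ of_nat_1 of_nat_add of_nat_mult of_nat_numeral)
    define j where "j = k div 2"
    define \<theta> where "\<theta> = pi / m"
    have "sin (2 * \<theta>) * (cheb p (Suc j) + cheb p j) = sin (2 * real (Suc j) * \<theta>) + sin (2 * real j * \<theta>)"
      using cheb_sin[OF p] by (simp add: distrib_left \<theta>_def)
    also have "2 * real (Suc j) * \<theta> = real k * \<theta> + \<theta>" by (simp add: kk j_def algebra_simps)
    also have "2 * real j * \<theta> = real k * \<theta> - \<theta>" by (simp add: kk j_def algebra_simps)
    also have "sin (real k * \<theta> + \<theta>) + sin (real k * \<theta> - \<theta>) = 2 * sin (real k * \<theta>) * cos \<theta>"
      by (simp add: sin_add sin_diff)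
    also have "\<dots> \<ge> 0" using s sp by (simp add: \<theta>_def)
    finally have "sin (2 * (pi / m)) * (cheb p (Suc (k div 2)) + cheb p (k div 2)) \<ge> 0" by (simp add: \<theta>_def j_def)
    then show "cheb p (Suc (k div 2)) + cheb p (k div 2) \<ge> 0" using sp by (simp add: zero_le_mult_iff) }
qed

section \<open>Reflection representations in coordinates\<close>

text \<open>Throughout, \<open>a s t\<close> is the entry \<open>(\<alpha>\<^sub>s, \<alpha>\<^sub>t\<^sup>\<or>)\<close>, and vectors are given by their coordinates with
  respect to the simple roots.\<close>

definition cartan :: "('g, 'b) monoid_scheme \<Rightarrow> 'g set \<Rightarrow> ('g \<Rightarrow> 'g \<Rightarrow> real) \<Rightarrow> bool" where
  "cartan W S a \<longleftrightarrow> (\<forall>s\<in>S. a s s = 2) \<and>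
    (\<forall>s\<in>S. \<forall>t\<in>S. s \<noteq> t \<longrightarrow> a s t \<le> 0 \<and> (a s t = 0 \<longleftrightarrow> a t s = 0) \<and>
      (if group.ord W (s \<otimes>\<^bsub>W\<^esub> t) = 0 then a s t * a t s \<ge> 4
       else a s t * a t s = 4 * (cos (pi / real (group.ord W (s \<otimes>\<^bsub>W\<^esub> t))))\<^sup>2))"

definition coord :: "'g \<Rightarrow> 'g \<Rightarrow> real" where
  "coord s = (\<lambda>t. if t = s then 1 else 0)"

text \<open>The coroot of \<open>s\<close> as a linear form in the coordinates.\<close>

definition colin :: "('g \<Rightarrow> 'g \<Rightarrow> real) \<Rightarrow> 'g set \<Rightarrow> 'g \<Rightarrow> ('g \<Rightarrow> real) \<Rightarrow> real" where
  "colin a S s c = (\<Sum>u\<in>S. c u * a u s)"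

definition gen :: "('g \<Rightarrow> 'g \<Rightarrow> real) \<Rightarrow> 'g set \<Rightarrow> 'g \<Rightarrow> ('g \<Rightarrow> real) \<Rightarrow> 'g \<Rightarrow> real" where
  "gen a S s c = (\<lambda>t. c t - colin a S s c * coord s t)"

lemma colin_add: "colin a S s (\<lambda>t. c t + d t) = colin a S s c + colin a S s d"
  by (simp add: colin_def algebra_simps sum.distrib)

lemma colin_diff: "colin a S s (\<lambda>t. c t - d t) = colin a S s c - colin a S s d"
  by (simp add: colin_def algebra_simps sum_subtractf)

lemma colin_scale: "colin a S s (\<lambda>t. x * c t) = x * colin a S s c"
  by (simp add: colin_def sum_distrib_left mult.assoc)

lemma sum_coord: "finite S \<Longrightarrow> r \<in> S \<Longrightarrow> (\<Sum>u\<in>S. coord r u * h u) = (h r :: real)"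
  by (simp add: coord_def if_distrib[of "\<lambda>x. x * _"] cong: if_cong)

lemma sum_coord': "finite S \<Longrightarrow> r \<in> S \<Longrightarrow> (\<Sum>u\<in>S. h u * coord u r) = (h r :: real)"
  by (simp add: coord_def if_distrib[of "\<lambda>x. _ * x"] cong: if_cong)

lemma colin_coord: "finite S \<Longrightarrow> r \<in> S \<Longrightarrow> colin a S s (coord r) = a r s"
  by (simp add: colin_def sum_coord)

lemma gen_add: "gen a S s (\<lambda>t. c t + d t) = (\<lambda>t. gen a S s c t + gen a S s d t)"
  by (simp add: gen_def colin_add algebra_simps)

lemma gen_scale: "gen a S s (\<lambda>t. x * c t) = (\<lambda>t. x * gen a S s c t)"
  by (simp add: gen_def colin_scale algebra_simps)

definition act :: "('g \<Rightarrow> 'g \<Rightarrow> real) \<Rightarrow> 'g set \<Rightarrow> 'g list \<Rightarrow> ('g \<Rightarrow> real) \<Rightarrow> 'g \<Rightarrow> real" where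
  "act a S u c = foldr (gen a S) u c"

lemma act_Nil [simp]: "act a S [] c = c"
  and act_Cons [simp]: "act a S (s # u) c = gen a S s (act a S u c)"
  and act_append: "act a S (u @ v) c = act a S u (act a S v c)"
  by (auto simp: act_def)

lemma act_add: "act a S u (\<lambda>t. c t + d t) = (\<lambda>t. act a S u c t + act a S u d t)"
  by (induction u) (auto simp: gen_add)

lemma act_scale: "act a S u (\<lambda>t. x * c t) = (\<lambda>t. x * act a S u c t)"
  by (induction u) (auto simp: gen_scale)

lemma act_outside: "u \<in> lists S \<Longrightarrow> r \<notin> S \<Longrightarrow> act a S u c r = c r"
  by (induction u) (auto simp: gen_def coord_def)

lemma act_concat: "act a S (concat (replicate m [s, t])) c = ((gen a S s \<circ> gen a S t) ^^ m) c"
  by (induction m) auto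

text \<open>The two generators change a vector only along their simple roots, so its orbit is an
  iteration in a plane; the pairings of the start vector with the two coroots enter as
  offsets.\<close>

lemma gen_gen_pow:
  assumes "finite S" "s \<in> S" "t \<in> S" "a s s = 2" "a t t = 2"
  shows "((gen a S s \<circ> gen a S t) ^^ k) c =
    (\<lambda>r. c r + fst ((dstep (colin a S s c) (colin a S t c) (a s t) (a t s) ^^ k) (0, 0)) * coord s r
             + snd ((dstep (colin a S s c) (colin a S t c) (a s t) (a t s) ^^ k) (0, 0)) * coord t r)"
    (is "_ = (\<lambda>r. c r + fst (?D k) * coord s r + snd (?D k) * coord t r)")
proof (induction k)
  case (Suc k)
  obtain P Q where PQ: "?D k = (P, Q)" by fastforce
  define Q' where "Q' = - Q - colin a S t c - P * a s t"
  have D: "?D (Suc k) = (- P - colin a S s c - Q' * a t s, Q')"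
    using PQ by (simp add: dstep_def Q'_def Let_def)
  have 1: "gen a S t (\<lambda>r. c r + P * coord s r + Q * coord t r) = (\<lambda>r. c r + P * coord s r + Q' * coord t r)"
    by (simp add: gen_def colin_add colin_scale colin_coord assms Q'_def algebra_simps)
  have 2: "gen a S s (\<lambda>r. c r + P * coord s r + Q' * coord t r)
      = (\<lambda>r. c r + (- P - colin a S s c - Q' * a t s) * coord s r + Q' * coord t r)"
    by (simp add: gen_def colin_add colin_scale colin_coord assms algebra_simps)
  have "((gen a S s \<circ> gen a S t) ^^ Suc k) c = gen a S s (gen a S t (((gen a S s \<circ> gen a S t) ^^ k) c))" by simp
  also have "((gen a S s \<circ> gen a S t) ^^ k) c = (\<lambda>r. c r + P * coord s r + Q * coord t r)"
    using Suc unfolding PQ fst_conv snd_conv .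
  finally show ?case unfolding 1 2 D fst_conv snd_conv .
qed simp

locale coxeter_matrix = coxeter +
  fixes a :: "'a \<Rightarrow> 'a \<Rightarrow> real"
  assumes cartan: "cartan W S a"
begin

lemma a_diag: "s \<in> S \<Longrightarrow> a s s = 2"
  and a_nonpos: "s \<in> S \<Longrightarrow> t \<in> S \<Longrightarrow> s \<noteq> t \<Longrightarrow> a s t \<le> 0"
  and a_zero: "s \<in> S \<Longrightarrow> t \<in> S \<Longrightarrow> a s t = 0 \<longleftrightarrow> a t s = 0"
  and a_infinite: "s \<in> S \<Longrightarrow> t \<in> S \<Longrightarrow> s \<noteq> t \<Longrightarrow> ord (s \<otimes> t) = 0 \<Longrightarrow> a s t * a t s \<ge> 4"
  and a_finite: "s \<in> S \<Longrightarrow> t \<in> S \<Longrightarrow> s \<noteq> t \<Longrightarrow> ord (s \<otimes> t) \<noteq> 0 \<Longrightarrow>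
      a s t * a t s = 4 * (cos (pi / real (ord (s \<otimes> t))))\<^sup>2"
  using cartan unfolding cartan_def by metis+

lemma gen_gen_relation:
  assumes s: "s \<in> S" and t: "t \<in> S"
  shows "((gen a S s \<circ> gen a S t) ^^ ord (s \<otimes> t)) c = c"
proof (cases "s = t")
  case True
  have "colin a S t (gen a S t c) = - colin a S t c"
    using t by (simp add: gen_def colin_diff colin_scale colin_coord finS a_diag)
  moreover have "ord (s \<otimes> t) = 1" using S_invol[OF s] True by simp
  ultimately show ?thesis using True by (simp add: gen_def[of a S t "gen a S t c"]) (simp add: gen_def)
next
  case False
  show ?thesis
  proof (cases "ord (s \<otimes> t) = 0")
    case f: False
    then have "ord (s \<otimes> t) \<ge> 2" using ord_S_S[OF s t False] by linarith
    from dstep_order[OF a_finite[OF s t False f] this a_zero[OF s t]]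
    show ?thesis by (subst gen_gen_pow) (auto simp: finS s t a_diag)
  qed simp
qed

definition rho :: "'a \<Rightarrow> ('a \<Rightarrow> real) \<Rightarrow> 'a \<Rightarrow> real" where
  "rho w = act a S (SOME u. u \<in> lists S \<and> word_prod W u = w)"

lemma act_cong:
  assumes "u \<in> lists S" "v \<in> lists S" "word_prod W u = word_prod W v"
  shows "act a S u = act a S v"
  by (rule presentation_invariant[OF _ assms])
    (rule ext, simp only: act_append act_concat gen_gen_relation)

lemma rho_word: "u \<in> lists S \<Longrightarrow> rho (word_prod W u) = act a S u"
proof -
  assume u: "u \<in> lists S"
  then have "\<exists>v. v \<in> lists S \<and> word_prod W v = word_prod W u" by blast
  from someI_ex[OF this] show ?thesis unfolding rho_def by (intro act_cong) (use u in blast)+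
qed

lemma rho_one: "rho \<one> c = c"
  using rho_word[of "[]"] by simp

lemma rho_S: "s \<in> S \<Longrightarrow> rho s = gen a S s"
  using rho_word[of "[s]"] by (auto simp: S_carrier)

lemma rho_mult: "x \<in> carrier W \<Longrightarrow> y \<in> carrier W \<Longrightarrow> rho (x \<otimes> y) c = rho x (rho y c)"
proof -
  assume "x \<in> carrier W" "y \<in> carrier W"
  then obtain u v where uv: "u \<in> lists S" "word_prod W u = x" "v \<in> lists S" "word_prod W v = y"
    using word_ex by metis
  then have "u @ v \<in> lists S" by auto
  from rho_word[OF this] have "rho (word_prod W u \<otimes> word_prod W v) = act a S (u @ v)"
    using word_prod_append uv by metis
  then show ?thesis using rho_word[OF uv(1)] rho_word[OF uv(3)] uv by (simp add: act_append)
qed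

lemma rho_as_word: "w \<in> carrier W \<Longrightarrow> \<exists>u\<in>lists S. word_prod W u = w \<and> rho w = act a S u"
  using word_ex rho_word by metis

lemma rho_add: "w \<in> carrier W \<Longrightarrow> rho w (\<lambda>t. c t + d t) = (\<lambda>t. rho w c t + rho w d t)"
  using rho_as_word[of w] by (auto simp: act_add)

lemma rho_scale: "w \<in> carrier W \<Longrightarrow> rho w (\<lambda>t. x * c t) = (\<lambda>t. x * rho w c t)"
  using rho_as_word[of w] by (auto simp: act_scale)

lemma rho_diff: "w \<in> carrier W \<Longrightarrow> rho w (\<lambda>t. c t - d t) = (\<lambda>t. rho w c t - rho w d t)"
  using rho_add[of w c "\<lambda>t. (-1) * d t"] rho_scale[of w "-1" d] by simp

lemma rho_outside: "w \<in> carrier W \<Longrightarrow> r \<notin> S \<Longrightarrow> rho w c r = c r"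
  using rho_as_word[of w] act_outside by metis

lemma rho_inv: "w \<in> carrier W \<Longrightarrow> rho (inv w) (rho w c) = c" "w \<in> carrier W \<Longrightarrow> rho w (rho (inv w) c) = c"
  by (simp_all add: rho_mult[symmetric] rho_one)

lemma gen_coord_self: "s \<in> S \<Longrightarrow> gen a S s (coord s) = (\<lambda>r. - coord s r)"
  by (simp add: gen_def colin_coord finS a_diag)

lemma rho_flip: "w \<in> carrier W \<Longrightarrow> s \<in> S \<Longrightarrow> rho (w \<otimes> s) (coord s) = (\<lambda>r. - rho w (coord s) r)"
  using rho_scale[of w "-1" "coord s"] by (simp add: rho_mult S_carrier rho_S gen_coord_self)

section \<open>Positivity of roots\<close>

text \<open>Index 0 would be the letter \<open>s\<close> whose root is acted on. The word begins at
  index 1 and is reversed, so \<open>t\<close> is applied first and the letters alternate from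
  there.\<close>

lemma alternating_act:
  assumes s: "s \<in> S" and t: "t \<in> S" and st: "s \<noteq> t"
  shows "act a S (rev (map (\<lambda>i. if even i then s else t) [1..<Suc n])) (coord s) =
    (\<lambda>r. (cheb (a s t * a t s) (Suc (n div 2)) + cheb (a s t * a t s) (n div 2)) * coord s r
       + (- a s t * cheb (a s t * a t s) (Suc n div 2)) * coord t r)"
proof (induction n)
  case (Suc n)
  define p where "p = a s t * a t s"
  define P Q where "P = cheb p (Suc (n div 2)) + cheb p (n div 2)" and "Q = - a s t * cheb p (Suc n div 2)"
  note IH = Suc.IH[folded p_def, folded P_def Q_def]
  have L: "rev (map (\<lambda>i. if even i then s else t) [1..<Suc (Suc n)])
      = (if even (Suc n) then s else t) # rev (map (\<lambda>i. if even i then s else t) [1..<Suc n])" by simp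
  have A: "act a S (rev (map (\<lambda>i. if even i then s else t) [1..<Suc (Suc n)])) (coord s)
      = gen a S (if even (Suc n) then s else t) (\<lambda>r. P * coord s r + Q * coord t r)"
    by (simp only: L act_Cons IH)
  show ?case
  proof (cases "even n")
    case True
    then have d: "Suc n div 2 = n div 2" "Suc (Suc n) div 2 = Suc (n div 2)" by presburger+
    have "gen a S t (\<lambda>r. P * coord s r + Q * coord t r) = (\<lambda>r. P * coord s r + (- Q - a s t * P) * coord t r)"
      by (simp add: gen_def colin_add colin_scale colin_coord finS a_diag s t algebra_simps)
    moreover have "- Q - a s t * P = - a s t * cheb p (Suc (Suc n) div 2)"
      unfolding P_def Q_def d by (simp add: algebra_simps)
    moreover have "(if even (Suc n) then s else t) = t" using True by simp
    ultimately show ?thesis unfolding A p_def[symmetric] by (simp add: P_def d del: upt_Suc)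
  next
    case False
    then have d: "Suc n div 2 = Suc (n div 2)" "Suc (Suc n) div 2 = Suc (n div 2)" by presburger+
    have "gen a S s (\<lambda>r. P * coord s r + Q * coord t r) = (\<lambda>r. (- P - a t s * Q) * coord s r + Q * coord t r)"
      by (simp add: gen_def colin_add colin_scale colin_coord finS a_diag s t algebra_simps)
    moreover have "a t s * (a s t * z) = p * z" for z by (simp add: p_def)
    then have "- P - a t s * Q = cheb p (Suc (Suc n div 2)) + cheb p (Suc n div 2)"
      unfolding P_def Q_def d by (simp add: algebra_simps)
    moreover have "(if even (Suc n) then s else t) = s" using False by simp
    ultimately show ?thesis unfolding A p_def[symmetric] by (simp add: Q_def d del: upt_Suc)
  qed
qed simp

text \<open>Infinite order is settled by the growth of \<open>cheb\<close>, order 2 by the vanishing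
  of \<open>a s t\<close>, and the remaining orders by the sine formula, whose range up to m is just
  reached for n < m.\<close>

lemma alternating_nonneg:
  assumes s: "s \<in> S" and t: "t \<in> S" and st: "s \<noteq> t" and n: "ord (s \<otimes> t) = 0 \<or> n < ord (s \<otimes> t)"
  shows "cheb (a s t * a t s) (Suc (n div 2)) + cheb (a s t * a t s) (n div 2) \<ge> 0"
    and "- a s t * cheb (a s t * a t s) (Suc n div 2) \<ge> 0"
proof -
  define m where "m = ord (s \<otimes> t)"
  consider "m = 0" | "m = 2" | "m \<ge> 3" using ord_S_S[OF s t st] m_def by linarith
  then have "cheb (a s t * a t s) (Suc (n div 2)) + cheb (a s t * a t s) (n div 2) \<ge> 0 \<and>
     (a s t = 0 \<or> cheb (a s t * a t s) (Suc n div 2) \<ge> 0)"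
  proof cases
    case 1
    then have "cheb (a s t * a t s) k \<ge> 0" for k
      using cheb_ge_four[OF a_infinite[OF s t st], of k] m_def of_nat_0_le_iff[of k, where ?'a=real] by linarith
    then show ?thesis by (simp del: of_nat_Suc)
  next
    case 2
    then have "a s t * a t s = 0" using a_finite[OF s t st] m_def by simp
    then have "a s t = 0" using a_zero[OF s t] by auto
    moreover have "n div 2 = 0" using n 2 m_def by simp
    ultimately show ?thesis by simp
  next
    case 3
    have n': "n < m" using n 3 m_def by simp
    have p: "a s t * a t s = 4 * (cos (pi / m))\<^sup>2" using a_finite[OF s t st] 3 m_def by simp
    have "Suc (2 * (n div 2)) \<le> m" using n' by presburger
    from cheb_alternating_nonneg(2)[OF p 3 this]
    have 1: "cheb (a s t * a t s) (Suc (n div 2)) + cheb (a s t * a t s) (n div 2) \<ge> 0" by simp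
    have "2 * (Suc n div 2) \<le> m" using n' by presburger
    from cheb_alternating_nonneg(1)[OF p 3 this] 1 show ?thesis by simp
  qed
  then show "cheb (a s t * a t s) (Suc (n div 2)) + cheb (a s t * a t s) (n div 2) \<ge> 0"
    and "- a s t * cheb (a s t * a t s) (Suc n div 2) \<ge> 0"
    using a_nonpos[OF s t st] by (auto simp: mult_nonpos_nonneg)
qed

end

section \<open>Words in two letters\<close>

context coxeter
begin

lemma alternating_or_repeats:
  assumes "z \<in> lists {s, t}" "\<nexists>y1 y2 r. z @ [s] = y1 @ [r, r] @ y2"
  shows "z @ [s] = rev (map (\<lambda>i. if even i then s else t) [0..<Suc (length z)])"
  using assms
proof (induction z rule: list.induct)
  case (Cons r z)
  let ?f = "\<lambda>i::nat. if even i then s else t"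
  have "\<nexists>y1 y2 r. z @ [s] = y1 @ [r, r] @ y2" using Cons.prems(2) by (metis append_Cons)
  then have IH: "z @ [s] = rev (map ?f [0..<Suc (length z)])" using Cons by simp
  have "r \<noteq> ?f (length z)"
  proof
    assume "r = ?f (length z)"
    then have "(r # z) @ [s] = [] @ [r, r] @ rev (map ?f [0..<length z])" using IH by simp
    then show False using Cons.prems(2) by blast
  qed
  moreover have "r = s \<or> r = t" using Cons.prems(1) by auto
  ultimately have "r = ?f (Suc (length z))" by (auto split: if_splits)
  then show ?case using IH by simp
qed simp

lemma shorten_repeat:
  assumes "y1 @ [r, r] @ y2 \<in> lists S"
  shows "word_prod W (y1 @ y2) = word_prod W (y1 @ [r, r] @ y2)"
proof -
  have y: "y1 \<in> lists S" "y2 \<in> lists S" "r \<in> S" "[r, r] @ y2 \<in> lists S" using assms by auto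
  have "r \<otimes> (r \<otimes> word_prod W y2) = word_prod W y2"
    using y S_carrier[of r] S_invol[of r] by (simp add: m_assoc[symmetric] del: in_lists_conv_set)
  then show ?thesis unfolding word_prod_append[OF y(1,2)] word_prod_append[OF y(1,4)] by simp
qed

lemma concat_alternating: "concat (replicate m [s, t]) = map (\<lambda>i. if even i then s else t) [0..<2 * m]"
proof (induction m)
  case (Suc m)
  have "concat (replicate (Suc m) [s, t]) = concat (replicate m [s, t]) @ [s, t]"
    by (metis concat_append concat.simps(1,2) append_Nil2 replicate_Suc replicate_append_same)
  then show ?case using Suc by simp
qed simp

lemma word_prod_concat:
  assumes "s \<in> S" "t \<in> S" shows "word_prod W (concat (replicate m [s, t])) = (s \<otimes> t) [^] m"
proof (induction m)
  case (Suc m)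
  have "concat (replicate m [s, t]) \<in> lists S" using assms unfolding concat_alternating by auto
  then show ?case using Suc assms
    by (subst nat_pow_Suc2) (simp_all add: S_carrier m_assoc del: in_lists_conv_set nat_pow_Suc)
qed simp

text \<open>The relator (st)^m is an alternating word of 2 m letters, so its first m + 1 letters are
  inverse to its remaining m - 1. Hence the last m + 1 letters of a long alternating word can be
  replaced by m - 1 letters, which takes its length from n + 1 to n - 1.\<close>

lemma shorten_long:
  assumes s: "s \<in> S" and t: "t \<in> S" and m: "m = ord (s \<otimes> t)" "0 < m" "m \<le> n"
  defines "f \<equiv> \<lambda>i::nat. if even i then s else t"
  shows "\<exists>z\<in>lists S. length z < n \<and> word_prod W z = word_prod W (rev (map f [0..<Suc n]))"
proof -
  have fl: "map f l \<in> lists S" "rev (map f l) \<in> lists S" for l using s t by (auto simp: f_def)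
  have up: "[0..<k] = [0..<Suc m] @ [Suc m..<k]" if "Suc m \<le> k" for k
    using that upt_add_eq_append[of 0 "Suc m" "k - Suc m"] by simp
  have "[0..<2*m] = [0..<Suc m] @ [Suc m..<2*m]" using m by (intro up) simp
  then have "word_prod W (map f [0..<Suc m]) \<otimes> word_prod W (map f [Suc m..<2*m]) = (s \<otimes> t) [^] m"
    using word_prod_append[OF fl(1) fl(1)] word_prod_concat[OF s t, of m] concat_alternating[of m s t]
    unfolding f_def by (metis map_append)
  also have "\<dots> = \<one>" using m s t S_carrier by simp
  finally have "word_prod W (rev (map f [0..<Suc m])) = word_prod W (map f [Suc m..<2*m])"
    unfolding word_prod_rev[OF fl(1)] using inv_equality inv_inv fl word_prod_closed by metis
  moreover have "[0..<Suc n] = [0..<Suc m] @ [Suc m..<Suc n]"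
    using m by (intro up) simp
  then have "word_prod W (rev (map f [0..<Suc n])) =
      word_prod W (rev (map f [Suc m..<Suc n])) \<otimes> word_prod W (rev (map f [0..<Suc m]))"
    using word_prod_append[OF fl(2) fl(2)] by (metis map_append rev_append)
  ultimately have "word_prod W (rev (map f [0..<Suc n])) =
      word_prod W (rev (map f [Suc m..<Suc n]) @ map f [Suc m..<2*m])"
    using word_prod_append[OF fl(2) fl(1)] by simp
  moreover have "length (rev (map f [Suc m..<Suc n]) @ map f [Suc m..<2*m]) < n"
    using m(2,3) unfolding length_append length_rev length_map length_upt by linarith
  moreover have "rev (map f [Suc m..<Suc n]) @ map f [Suc m..<2*m] \<in> lists S" using fl by simp
  ultimately show ?thesis by metis
qed

end

section \<open>Tits' positivity theorem\<close>

context coxeter_matrix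
begin

text \<open>Let t be the last letter of a reduced word of \<open>w\<close>. Write w = v z with z in
  the subgroup generated by s and t and v of least length; then v becomes longer under both s and t
  and is shorter than w, so by induction it maps both simple roots to nonnegative vectors. The
  dihedral computation shows that z maps the simple root of s to a nonnegative combination of these
  two simple roots.\<close>

theorem root_pos:
  assumes "w \<in> carrier W" "s \<in> S" "len w < len (w \<otimes> s)"
  shows "rho w (coord s) r \<ge> 0"
  using assms
proof (induction "len w" arbitrary: w s r rule: less_induct)
  case less
  note w = less.prems(1) and s = less.prems(2) and up = less.prems(3)
  show ?case
  proof (cases "w = \<one>")
    case True
    then show ?thesis by (simp add: rho_one coord_def)
  next
    case False
    obtain u where u: "u \<in> lists S" "length u = len w" "word_prod W u = w" using reduced_ex[OF w] by blast
    then have "u \<noteq> []" using False by auto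
    then obtain u' t where ut: "u = u' @ [t]" by (metis append_butlast_last_id)
    then have u': "u' \<in> lists S" and t: "t \<in> S" using u by auto
    define w' where "w' = word_prod W u'"
    have w': "w' \<in> carrier W" "w = w' \<otimes> t" "Suc (len w') \<le> len w"
      using u' t u ut len_le[OF u'] by (auto simp: w'_def word_prod_append S_carrier simp del: in_lists_conv_set)
    then have lw': "Suc (len w') = len w" using len_mult[OF w'(1) S_carrier[OF t]] len_S[OF t] by simp
    have st: "s \<noteq> t" using w' up mult_S_S[OF w'(1) t] by auto
    \<comment> \<open>Factorizations with additive lengths; minimizing the length of the first
      factor gives the shortest representative of the coset of w.\<close>
    define Dec where "Dec = (\<lambda>(v, z). v \<in> carrier W \<and> z \<in> lists {s, t} \<and> w = v \<otimes> word_prod W z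
      \<and> len w = len v + length z)"
    have "Dec (w', [t])" using w' lw' t by (simp add: Dec_def S_carrier)
    then obtain vz where vz: "Dec vz" "\<And>vz'. Dec vz' \<Longrightarrow> len (fst vz) \<le> len (fst vz')"
      using ex_has_least_nat[of Dec _ "\<lambda>vz. len (fst vz)"] by blast
    obtain v z where vzeq: "vz = (v, z)" by fastforce
    have v: "v \<in> carrier W" and z: "z \<in> lists {s, t}" and wvz: "w = v \<otimes> word_prod W z"
      and lvz: "len w = len v + length z" using vz(1) by (auto simp: Dec_def vzeq)
    have lv: "len v < len w" using vz(2)[OF \<open>Dec (w', [t])\<close>] lw' by (simp add: vzeq)
    have zS: "z \<in> lists S" using z s t by auto
    have v_up: "len v < len (v \<otimes> r)" if r: "r \<in> {s, t}" for r
    proof (rule ccontr)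
      have rS: "r \<in> S" using r s t by auto
      assume "\<not> len v < len (v \<otimes> r)"
      then have l: "Suc (len (v \<otimes> r)) = len v" using len_step[OF v rS] by linarith
      have "(v \<otimes> r) \<otimes> (r \<otimes> word_prod W z) = (v \<otimes> r \<otimes> r) \<otimes> word_prod W z"
        using v rS zS by (simp add: m_assoc S_carrier del: in_lists_conv_set)
      then have "Dec (v \<otimes> r, r # z)"
        using v rS z r l lvz wvz by (auto simp: Dec_def S_carrier mult_S_S)
      from vz(2)[OF this] l show False by (simp add: vzeq)
    qed
    have pos: "rho v (coord r) q \<ge> 0" if "r \<in> {s, t}" for r q
      using less.hyps[OF lv v _ v_up[OF that]] that s t by blast
    \<comment> \<open>A word shorter than \<open>z\<close> for the same element as
      \<open>z @ [s]\<close> would make w s shorter than w. Hence \<open>z @ [s]\<close> has no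
      repeated neighbours and is not longer than the braid relation allows.\<close>
    have no_short: "\<not> length z' < length z" if "z' \<in> lists S" "word_prod W z' = word_prod W (z @ [s])" for z'
    proof
      assume "length z' < length z"
      have "w \<otimes> s = v \<otimes> word_prod W (z @ [s])"
        using word_prod_append[OF zS, of "[s]"] s v zS wvz by (simp add: S_carrier m_assoc del: in_lists_conv_set)
      then have "len (w \<otimes> s) \<le> len v + length z'"
        using len_mult[OF v word_prod_closed[OF that(1)]] len_le[OF that(1)] that(2) by simp
      then show False using up lvz \<open>length z' < length z\<close> by simp
    qed
    define f where "f = (\<lambda>i::nat. if even i then s else t)"
    have zs: "z @ [s] = rev (map f [0..<Suc (length z)])"
      unfolding f_def
    proof (rule alternating_or_repeats[OF z], rule notI, elim exE)
      fix y1 y2 r assume y: "z @ [s] = y1 @ [r, r] @ y2"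
      have "y1 @ [r, r] @ y2 \<in> lists S" unfolding y[symmetric] using zS s by simp
      moreover have "length (y1 @ y2) < length z" using arg_cong[OF y, of length] by simp
      ultimately show False using no_short[of "y1 @ y2"] shorten_repeat[of y1 r y2] y by simp
    qed
    have n: "ord (s \<otimes> t) = 0 \<or> length z < ord (s \<otimes> t)"
    proof (rule ccontr)
      assume "\<not> ?thesis"
      then have "0 < ord (s \<otimes> t)" "ord (s \<otimes> t) \<le> length z" by auto
      from shorten_long[OF s t refl this] no_short zs show False unfolding f_def by fastforce
    qed
    have "z = rev (map f [1..<Suc (length z)])"
      using zs upt_conv_Cons[of 0 "Suc (length z)"] by (simp add: f_def del: upt_Suc)
    then have "act a S z (coord s) =
      (\<lambda>r. (cheb (a s t * a t s) (Suc (length z div 2)) + cheb (a s t * a t s) (length z div 2)) * coord s r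
       + (- a s t * cheb (a s t * a t s) (Suc (length z) div 2)) * coord t r)"
      using alternating_act[OF s t st, of "length z"] unfolding f_def by simp
    then have "rho w (coord s) = rho v (\<lambda>r. (cheb (a s t * a t s) (Suc (length z div 2)) + cheb (a s t * a t s) (length z div 2)) * coord s r
       + (- a s t * cheb (a s t * a t s) (Suc (length z) div 2)) * coord t r)"
      using wvz v zS by (simp add: rho_mult rho_word del: in_lists_conv_set)
    moreover have nn: "rho v (\<lambda>r. P * coord s r + Q * coord t r) r \<ge> 0" if "P \<ge> 0" "Q \<ge> 0" for P Q
      using that pos by (simp only: rho_add[OF v] rho_scale[OF v]) simp
    ultimately show ?thesis using nn[OF alternating_nonneg[OF s t st n]] by simp
  qed
qed

theorem root_neg:
  assumes "w \<in> carrier W" "s \<in> S" "\<not> len w < len (w \<otimes> s)"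
  shows "rho w (coord s) r \<le> 0"
proof -
  have ws: "w \<otimes> s \<in> carrier W" using assms S_carrier by auto
  have "len (w \<otimes> s) < len (w \<otimes> s \<otimes> s)" using assms len_step[OF assms(1,2)] by (simp add: mult_S_S)
  from root_pos[OF ws assms(2) this] show ?thesis
    using rho_flip[OF ws assms(2)] mult_S_S[OF assms(1,2)] by (simp add: rho_flip assms)
qed

section \<open>Faithfulness and the reflection of a root\<close>

lemma root_nonzero:
  assumes "w \<in> carrier W" "s \<in> S" shows "\<exists>r\<in>S. rho w (coord s) r \<noteq> 0"
proof (rule ccontr)
  assume "\<not> ?thesis"
  then have "rho w (coord s) = (\<lambda>r. 0 * coord s r)"
    using rho_outside[OF assms(1)] assms(2) by (fastforce simp: coord_def)
  then have "coord s = (\<lambda>r. 0)"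
    using rho_inv(1)[OF assms(1), of "coord s"] rho_scale[of "inv w" 0 "coord s"] assms by simp
  then show False by (metis coord_def zero_neq_one)
qed

lemma root_sign_iff:
  assumes "w \<in> carrier W" "s \<in> S"
  shows "(\<forall>r\<in>S. rho w (coord s) r \<ge> 0) \<longleftrightarrow> len w < len (w \<otimes> s)"
  using root_pos[OF assms] root_neg[OF assms] root_nonzero[OF assms] by (meson order_antisym)

text \<open>An element other than the identity becomes shorter under the last letter s of a reduced
  word, so it maps the simple root of s to a vector with coefficients at most 0.\<close>

lemma rho_faithful:
  assumes w: "w \<in> carrier W" and triv: "\<And>s r. s \<in> S \<Longrightarrow> r \<in> S \<Longrightarrow> rho w (coord s) r = coord s r"
  shows "w = \<one>"
proof (rule ccontr)
  assume "w \<noteq> \<one>"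
  obtain u where u: "u \<in> lists S" "length u = len w" "word_prod W u = w" using reduced_ex[OF w] by blast
  then have "u \<noteq> []" using \<open>w \<noteq> \<one>\<close> by auto
  then obtain u' s where us: "u = u' @ [s]" by (metis append_butlast_last_id)
  then have u': "u' \<in> lists S" and s: "s \<in> S" using u by auto
  have "w \<otimes> s = word_prod W u'"
    using u us u' s mult_S_S[of "word_prod W u'" s] by (auto simp: word_prod_append S_carrier simp del: in_lists_conv_set)
  then have "\<not> len w < len (w \<otimes> s)" using len_le[OF u'] u us by simp
  from root_neg[OF w s this, of s] triv[OF s s] show False by (simp add: coord_def)
qed

text \<open>Two reflections in the same root differ by a transvection, which would produce roots with
  coefficients of both signs.\<close>

lemma reflection_forms_le:
  assumes y: "y1 \<in> carrier W" "y2 \<in> carrier W" and e: "e \<in> S" and r: "r \<in> S"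
    and h: "\<And>c. rho y1 c = (\<lambda>q. c q - h1 c * coord e q)" "\<And>c. rho y2 c = (\<lambda>q. c q - h2 c * coord e q)"
      "\<And>c l. h1 (\<lambda>q. c q - l * coord e q) = h1 c - l * 2" "h1 (coord e) = 2" "h2 (coord e) = 2"
  shows "rho (y1 \<otimes> y2) (coord r) = (\<lambda>q. coord r q + (h2 (coord r) - h1 (coord r)) * coord e q)"
    and "h1 (coord r) \<le> h2 (coord r)"
proof -
  show eq: "rho (y1 \<otimes> y2) (coord r) = (\<lambda>q. coord r q + (h2 (coord r) - h1 (coord r)) * coord e q)"
    by (simp add: rho_mult y h(1-3)) (simp add: h algebra_simps)
  show "h1 (coord r) \<le> h2 (coord r)"
  proof (cases "r = e")
    case False
    have w: "y1 \<otimes> y2 \<in> carrier W" using y by simp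
    have "rho (y1 \<otimes> y2) (coord r) r = 1" using eq False by (simp add: coord_def)
    then have "len (y1 \<otimes> y2) < len (y1 \<otimes> y2 \<otimes> r)" using root_neg[OF w r, of r] by fastforce
    from root_pos[OF w r this, of e] eq False show ?thesis by (simp add: coord_def)
  qed (simp add: h)
qed

text \<open>The conjugate \<open>y\<close> and \<open>s'\<close> are both reflections in the simple
  root of \<open>s'\<close>. The preceding inequality, applied to their products in both orders,
  makes their linear forms equal, so \<open>y \<otimes> s'\<close> acts trivially and faithfulness
  applies.\<close>

lemma reflection_unique_simple:
  assumes x: "x \<in> carrier W" and s: "s \<in> S" and s': "s' \<in> S" and eq: "rho x (coord s) = coord s'"
  shows "x \<otimes> s \<otimes> inv x = s'"
proof -
  define y where "y = x \<otimes> s \<otimes> inv x"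
  have y: "y \<in> carrier W" using x s S_carrier by (auto simp: y_def)
  have s'W: "s' \<in> carrier W" using s' S_carrier by auto
  define h1 where "h1 c = colin a S s (rho (inv x) c)" for c
  define h2 where "h2 = colin a S s'"
  have 1: "rho y c = (\<lambda>q. c q - h1 c * coord s' q)" for c
    using x s S_carrier[OF s] by (simp add: y_def rho_mult rho_S gen_def h1_def rho_diff rho_scale eq rho_inv)
  have 2: "rho s' c = (\<lambda>q. c q - h2 c * coord s' q)" for c
    using s' by (simp add: rho_S gen_def h2_def)
  have inv: "rho (inv x) (coord s') = coord s" using eq rho_inv[OF x] by metis
  have l1: "h1 (\<lambda>q. c q - l * coord s' q) = h1 c - l * 2" for c l
    using x s by (simp add: h1_def rho_diff rho_scale colin_diff colin_scale inv colin_coord finS a_diag)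
  have l2: "h2 (\<lambda>q. c q - l * coord s' q) = h2 c - l * 2" for c l
    using s' by (simp add: h2_def colin_diff colin_scale colin_coord finS a_diag)
  have e: "h1 (coord s') = 2" "h2 (coord s') = 2" using s s' by (auto simp: h1_def h2_def inv colin_coord finS a_diag)
  have "rho (y \<otimes> s') (coord r) = coord r" if r: "r \<in> S" for r
  proof -
    have "h1 (coord r) = h2 (coord r)"
      using reflection_forms_le(2)[OF y s'W s' r 1 2 l1 e] reflection_forms_le(2)[OF s'W y s' r 2 1 l2 e(2,1)] by simp
    then show ?thesis using reflection_forms_le(1)[OF y s'W s' r 1 2 l1 e] by simp
  qed
  then have "y \<otimes> s' = \<one>" using rho_faithful[of "y \<otimes> s'"] y s'W by simp
  then have "y = inv s'" using y s'W by (metis inv_equality)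
  then show ?thesis using S_inv[OF s'] y_def by simp
qed

text \<open>This makes \<open>root_refl\<close> well defined; multiplication by
  \<open>inv x'\<close> reduces it to a simple root.\<close>

lemma reflection_unique:
  assumes x: "x \<in> carrier W" "x' \<in> carrier W" and s: "s \<in> S" "s' \<in> S"
    and eq: "rho x (coord s) = rho x' (coord s')"
  shows "x \<otimes> s \<otimes> inv x = x' \<otimes> s' \<otimes> inv x'"
proof -
  have "rho (inv x' \<otimes> x) (coord s) = coord s'" using x eq by (simp add: rho_mult rho_inv)
  then have "(inv x' \<otimes> x) \<otimes> s \<otimes> inv (inv x' \<otimes> x) = s'"
    using reflection_unique_simple[of "inv x' \<otimes> x" s s'] x s by simp
  then have "x' \<otimes> ((inv x' \<otimes> x) \<otimes> s \<otimes> inv (inv x' \<otimes> x)) \<otimes> inv x' = x' \<otimes> s' \<otimes> inv x'" by simp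
  moreover have "x' \<otimes> ((inv x' \<otimes> x) \<otimes> s \<otimes> inv (inv x' \<otimes> x)) \<otimes> inv x' = x \<otimes> s \<otimes> inv x"
  proof -
    have c: "s \<in> carrier W" using s S_carrier by auto
    have "x' \<otimes> (inv x' \<otimes> z) = z" if "z \<in> carrier W" for z using that x by (simp add: m_assoc[symmetric])
    then show ?thesis using x c by (simp add: inv_mult_group m_assoc)
  qed
  ultimately show ?thesis by simp
qed

text \<open>A reflection negates its root and moves every vector along its root, so any two roots of
  one reflection are proportional. A factor is unavoidable, because distinct roots on one ray may
  share a reflection.\<close>

lemma proportional_if_same_reflection:
  assumes x: "x \<in> carrier W" "x' \<in> carrier W" and s: "s \<in> S" "s' \<in> S"
    and eq: "x \<otimes> s \<otimes> inv x = x' \<otimes> s' \<otimes> inv x'"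
  shows "\<exists>l. rho x' (coord s') = (\<lambda>r. l * rho x (coord s) r)"
proof -
  have c: "s \<in> carrier W" "s' \<in> carrier W" using s S_carrier by auto
  have refl: "rho (y \<otimes> r \<otimes> inv y) c = (\<lambda>q. c q - colin a S r (rho (inv y) c) * rho y (coord r) q)"
    if "y \<in> carrier W" "r \<in> S" for y r c
    using that S_carrier[OF that(2)] by (simp add: rho_mult rho_S gen_def rho_diff rho_scale rho_inv)
  define b where "b = rho x' (coord s')"
  have "rho (x' \<otimes> s' \<otimes> inv x') b = (\<lambda>q. b q - 2 * b q)"
    using refl[OF x(2) s(2), of b] x s by (simp add: b_def rho_inv colin_coord finS a_diag)
  moreover have "rho (x \<otimes> s \<otimes> inv x) b = (\<lambda>q. b q - colin a S s (rho (inv x) b) * rho x (coord s) q)"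
    using refl[OF x(1) s(1)] .
  ultimately have "b q = (colin a S s (rho (inv x) b) / 2) * rho x (coord s) q" for q
    using eq by (auto dest!: fun_cong[where x=q])
  then show ?thesis unfolding b_def[symmetric] by blast
qed

end

section \<open>Farkas' lemma\<close>

definition functional :: "(('g \<Rightarrow> real) \<Rightarrow> real) \<Rightarrow> bool" where
  "functional f \<longleftrightarrow> (\<forall>x y l. f (\<lambda>r. x r + l * y r) = f x + l * f y)"

lemma functional_scale: "functional f \<Longrightarrow> f (\<lambda>r. l * y r) = l * f y"
proof -
  assume f: "functional f"
  have "f (\<lambda>r. 0) = 0" using f[unfolded functional_def, rule_format, of "\<lambda>r. 0" "- 1" "\<lambda>r. 0"] by simp
  then show ?thesis using f[unfolded functional_def, rule_format, of "\<lambda>r. 0" l y] by simp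
qed

text \<open>Bartl's induction: if the last functional \<open>a j\<close> is needed, there is \<open>x0\<close> with \<open>a j x0 = -1\<close> violating the
  implication for the others, and projecting along \<open>x0\<close> onto the kernel of \<open>a j\<close> eliminates \<open>a j\<close>.\<close>

lemma farkas:
  assumes "finite I" "\<And>i. i \<in> I \<Longrightarrow> functional (a i)" "functional b"
    and "\<And>x. (\<And>i. i \<in> I \<Longrightarrow> a i x \<ge> 0) \<Longrightarrow> b x \<ge> 0"
  shows "\<exists>l. (\<forall>i\<in>I. l i \<ge> 0) \<and> (\<forall>x. b x = (\<Sum>i\<in>I. l i * a i x))"
  using assms
proof (induction I arbitrary: a b rule: finite_induct)
  case empty
  have "b x = 0" for x
    using empty(3)[of x] empty(3)[of "\<lambda>r. (-1) * x r"] functional_scale[OF empty(2), of "-1" x] by simp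
  then show ?case by simp
next
  case (insert j I)
  note fa = insert.prems(1) and fb = insert.prems(2) and imp = insert.prems(3)
  show ?case
  proof (cases "\<forall>x. (\<forall>i\<in>I. a i x \<ge> 0) \<longrightarrow> b x \<ge> 0")
    case True
    then obtain l where "\<forall>i\<in>I. l i \<ge> 0" "\<forall>x. b x = (\<Sum>i\<in>I. l i * a i x)"
      using insert.IH[of a b] fa fb by auto
    moreover have "(\<Sum>i\<in>I. (if i = j then 0 else l i) * a i x) = (\<Sum>i\<in>I. l i * a i x)" for x
      using insert.hyps by (intro sum.cong) auto
    ultimately show ?thesis using insert.hyps by (intro exI[of _ "\<lambda>i. if i = j then 0 else l i"]) simp
  next
    case False
    then obtain x1 where x1: "\<And>i. i \<in> I \<Longrightarrow> a i x1 \<ge> 0" "b x1 < 0" by (meson not_le)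
    then have neg: "a j x1 < 0" using imp[of x1] by (metis insert_iff not_le)
    define h where "h = - 1 / a j x1"
    have h: "h > 0" using neg by (simp add: h_def divide_neg_neg)
    define x0 where "x0 = (\<lambda>r. h * x1 r)"
    have sc: "f x0 = h * f x1" if "functional f" for f unfolding x0_def by (rule functional_scale[OF that])
    have j0: "a j x0 = - 1" using sc[OF fa[of j]] neg by (simp add: h_def)
    have i0: "a i x0 \<ge> 0" if "i \<in> I" for i using sc[OF fa[of i]] x1(1)[OF that] h that by simp
    have b0: "b x0 < 0" using sc[OF fb] x1(2) h by (simp add: mult_pos_neg)
    define a' where "a' i x = a i x + a j x * a i x0" for i x
    define b' where "b' x = b x + a j x * b x0" for x
    have a'_eq: "a' i x = a i (\<lambda>r. x r + a j x * x0 r)" if "i \<in> insert j I" for i x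
      using fa[OF that] by (simp add: a'_def functional_def)
    have b'_eq: "b' x = b (\<lambda>r. x r + a j x * x0 r)" for x
      using fb by (simp add: b'_def functional_def)
    have lin: "functional (\<lambda>x. f x + a j x * f x0)" if "functional f" for f
      using that fa[of j] by (simp add: functional_def algebra_simps)
    have "b' x \<ge> 0" if "\<And>i. i \<in> I \<Longrightarrow> a' i x \<ge> 0" for x
      unfolding b'_eq
    proof (rule imp)
      fix i assume i: "i \<in> insert j I"
      show "a i (\<lambda>r. x r + a j x * x0 r) \<ge> 0"
      proof (cases "i = j")
        case True
        then show ?thesis using a'_eq[OF i, of x] j0 by (simp add: a'_def)
      qed (use that a'_eq i in auto)
    qed
    then obtain l where l: "\<forall>i\<in>I. l i \<ge> 0" "\<forall>x. b' x = (\<Sum>i\<in>I. l i * a' i x)"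
      using insert.IH[of a' b'] lin fa fb unfolding a'_def[abs_def] b'_def[abs_def] by blast
    \<comment> \<open>Expanding \<open>a'\<close> and \<open>b'\<close> shows that this is the
      coefficient of \<open>a j\<close>; it is nonnegative because \<open>a i x0 \<ge> 0\<close> on
      \<open>I\<close> and \<open>b x0 < 0\<close>.\<close>
    define lj where "lj = (\<Sum>i\<in>I. l i * a i x0) - b x0"
    have "lj \<ge> 0" unfolding lj_def using b0 sum_nonneg[of I "\<lambda>i. l i * a i x0"] l i0 by fastforce
    moreover have "b x = (\<Sum>i\<in>I. l i * a i x) + lj * a j x" for x
      using l(2)[rule_format, of x]
      by (simp add: b'_def a'_def lj_def algebra_simps sum.distrib sum_distrib_left)
    moreover have "(\<Sum>i\<in>I. (if i = j then lj else l i) * a i x) = (\<Sum>i\<in>I. l i * a i x)" for x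
      using insert.hyps by (intro sum.cong) auto
    ultimately show ?thesis using l insert.hyps
      by (intro exI[of _ "\<lambda>i. if i = j then lj else l i"]) simp
  qed
qed

section \<open>The closure operator in coordinates\<close>

context coxeter
begin

text \<open>The value of \<open>signed_refl\<close> at the root of \<open>(w, s)\<close>. It does
  not mention a matrix, which makes operators of different data comparable.\<close>

definition sr :: "'g \<Rightarrow> 'g \<Rightarrow> 'g \<times> int" where
  "sr w s = (w \<otimes> s \<otimes> inv w, if len w < len (w \<otimes> s) then 1 else - 1)"

lemma sr_range: "w \<in> carrier W \<Longrightarrow> s \<in> S \<Longrightarrow> sr w s \<in> reflections W S \<times> {1, - 1}"
  by (auto simp: sr_def reflections_def)

end

context coxeter_matrix
begin

text \<open>The value, at the root of \<open>(w, s)\<close>, of the functional that takes the value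
  \<open>x r\<close> at the simple root of \<open>r\<close>.\<close>

definition ev :: "('a \<Rightarrow> real) \<Rightarrow> 'a \<times> 'a \<Rightarrow> real" where
  "ev x = (\<lambda>(w, s). \<Sum>r\<in>S. rho w (coord s) r * x r)"

text \<open>By Farkas' lemma, this is the closure operator of any realized datum with matrix \<open>a\<close> whose simple roots
  are linearly independent.\<close>

definition Cl :: "('a \<times> int) set \<Rightarrow> ('a \<times> int) set" where
  "Cl = (\<lambda>A\<in>Pow (reflections W S \<times> {1, - 1}).
     {sr w s | w s. w \<in> carrier W \<and> s \<in> S \<and>
       (\<exists>F. finite F \<and> F \<subseteq> carrier W \<times> S \<and> (\<forall>(w', s')\<in>F. sr w' s' \<in> A) \<and>
         (\<forall>x. (\<forall>g\<in>F. ev x g \<ge> 0) \<longrightarrow> ev x (w, s) \<ge> 0))})"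

lemma ev_functional: "functional (\<lambda>x. ev x g)"
  by (cases g) (simp add: functional_def ev_def algebra_simps sum.distrib sum_distrib_left)

lemma ev_coord: "r \<in> S \<Longrightarrow> ev (coord r) (w, s) = rho w (coord s) r"
  using sum_coord[OF finS, of r "rho w (coord s)"] by (simp add: ev_def mult.commute)

end

text \<open>A functional for \<open>a2\<close> that violates the implication defining membership
  would be carried to one for \<open>a1\<close> with the same signs on the finite set consisting of
  the given roots and \<open>(w, s)\<close>. Functionals thus travel against the direction of the
  inclusion.\<close>

lemma Cl_subset_if_transfer:
  assumes m: "coxeter_matrix W S a1" "coxeter_matrix W S a2"
    and tr: "\<And>F x. finite F \<Longrightarrow> F \<subseteq> carrier W \<times> S \<Longrightarrow>
      \<exists>x'. \<forall>g\<in>F. sgn (coxeter_matrix.ev W S a1 x' g) = sgn (coxeter_matrix.ev W S a2 x g)"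
    and A: "A \<in> Pow (reflections W S \<times> {1, - 1})"
  shows "coxeter_matrix.Cl W S a1 A \<subseteq> coxeter_matrix.Cl W S a2 A"
proof
  interpret m1: coxeter_matrix W S a1 by (rule m)
  interpret m2: coxeter_matrix W S a2 by (rule m)
  fix z assume "z \<in> m1.Cl A"
  then obtain w s F where z: "z = m1.sr w s" "w \<in> carrier W" "s \<in> S" and F: "finite F" "F \<subseteq> carrier W \<times> S"
    "\<forall>(w', s')\<in>F. m1.sr w' s' \<in> A" "\<forall>x. (\<forall>g\<in>F. m1.ev x g \<ge> 0) \<longrightarrow> m1.ev x (w, s) \<ge> 0"
    using A unfolding m1.Cl_def by auto
  have "m2.ev x (w, s) \<ge> 0" if x: "\<forall>g\<in>F. m2.ev x g \<ge> 0" for x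
  proof -
    have "finite (insert (w, s) F)" "insert (w, s) F \<subseteq> carrier W \<times> S" using F z by auto
    from tr[OF this] obtain x' where
      x': "\<forall>g\<in>insert (w, s) F. sgn (m1.ev x' g) = sgn (m2.ev x g)" by blast
    then have "\<forall>g\<in>F. m1.ev x' g \<ge> 0" using x by (metis insert_iff sgn_less not_less)
    then have "m1.ev x' (w, s) \<ge> 0" using F(4) by blast
    then show ?thesis using x' by (metis insertI1 sgn_less not_less)
  qed
  then show "z \<in> m2.Cl A" using z F A unfolding m2.Cl_def by auto
qed

lemma Cl_eq_if_transfer:
  assumes m: "coxeter_matrix W S a1" "coxeter_matrix W S a2"
    and "\<And>F x. finite F \<Longrightarrow> F \<subseteq> carrier W \<times> S \<Longrightarrow>
      \<exists>x'. \<forall>g\<in>F. sgn (coxeter_matrix.ev W S a1 x' g) = sgn (coxeter_matrix.ev W S a2 x g)"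
    and "\<And>F x. finite F \<Longrightarrow> F \<subseteq> carrier W \<times> S \<Longrightarrow>
      \<exists>x'. \<forall>g\<in>F. sgn (coxeter_matrix.ev W S a2 x' g) = sgn (coxeter_matrix.ev W S a1 x g)"
  shows "coxeter_matrix.Cl W S a1 = coxeter_matrix.Cl W S a2"
proof
  fix A
  show "coxeter_matrix.Cl W S a1 A = coxeter_matrix.Cl W S a2 A"
  proof (cases "A \<in> Pow (reflections W S \<times> {1, - 1})")
    case True
    then show ?thesis
      using Cl_subset_if_transfer[OF m assms(3)] Cl_subset_if_transfer[OF m(2,1) assms(4)] by blast
  next
    case False
    then show ?thesis by (simp add: coxeter_matrix.Cl_def[OF m(1)] coxeter_matrix.Cl_def[OF m(2)])
  qed
qed

section \<open>Rescaling the simple roots\<close>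

text \<open>The simple roots are multiplied by \<open>d\<close> and the coroots divided by it, which
  preserves the diagonal and all products \<open>a s t * a t s\<close>.\<close>

definition rescaled :: "'g set \<Rightarrow> ('g \<Rightarrow> 'g \<Rightarrow> real) \<Rightarrow> ('g \<Rightarrow> 'g \<Rightarrow> real) \<Rightarrow> bool" where
  "rescaled S a b \<longleftrightarrow> (\<exists>d. (\<forall>s\<in>S. d s > 0) \<and> (\<forall>s\<in>S. \<forall>t\<in>S. a s t = d s / d t * b s t))"

lemma rescaled_sym: "rescaled S a b \<Longrightarrow> rescaled S b a"
proof -
  assume "rescaled S a b"
  then obtain d where d: "\<forall>s\<in>S. d s > 0" "\<forall>s\<in>S. \<forall>t\<in>S. a s t = d s / d t * b s t" by (auto simp: rescaled_def)
  have "b s t = (1 / d s) / (1 / d t) * a s t" if "s \<in> S" "t \<in> S" for s t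
    using d that by (simp add: divide_simps less_le) (metis mult.commute)
  then show ?thesis unfolding rescaled_def using d by (intro exI[of _ "\<lambda>s. 1 / d s"]) auto
qed

lemma act_rescaled:
  assumes d: "\<forall>s\<in>S. d s > 0" "\<forall>s\<in>S. \<forall>t\<in>S. a s t = d s / d t * b s t" and u: "u \<in> lists S"
  shows "(\<lambda>r. act a S u c r * d r) = act b S u (\<lambda>r. c r * d r)"
  using u
proof (induction u)
  case (Cons s u)
  then have s: "s \<in> S" by auto
  define e where "e = act a S u c"
  have "colin a S s e * d s = colin b S s (\<lambda>r. e r * d r)"
    unfolding colin_def sum_distrib_right using s d by (intro sum.cong) (auto simp: less_le)
  then have "(\<lambda>r. gen a S s e r * d r) = gen b S s (\<lambda>r. e r * d r)"
    by (auto simp: gen_def coord_def left_diff_distrib fun_eq_iff)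
  then show ?case using Cons by (simp add: e_def)
qed simp

lemma ev_rescaled:
  assumes m: "coxeter_matrix W S a" "coxeter_matrix W S b"
    and d: "\<forall>s\<in>S. d s > 0" "\<forall>s\<in>S. \<forall>t\<in>S. a s t = d s / d t * b s t"
    and g: "w \<in> carrier W" "s \<in> S"
  shows "coxeter_matrix.ev W S a x (w, s) = d s * coxeter_matrix.ev W S b (\<lambda>r. x r / d r) (w, s)"
proof -
  interpret ma: coxeter_matrix W S a by (rule m)
  interpret mb: coxeter_matrix W S b by (rule m)
  obtain u where u: "u \<in> lists S" "word_prod W u = w" using ma.word_ex g by blast
  have "(\<lambda>r. coord s r * d r) = (\<lambda>r. d s * coord s r)" by (auto simp: coord_def)
  then have *: "act a S u (coord s) r * d r = d s * act b S u (coord s) r" for r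
    using fun_cong[OF act_rescaled[OF d u(1), of "coord s"], of r] by (simp add: act_scale)
  have "ma.ev x (w, s) = (\<Sum>r\<in>S. (act a S u (coord s) r * d r) * (x r / d r))"
    unfolding ma.ev_def prod.case using u d ma.rho_word[OF u(1)] by (intro sum.cong) (auto simp: less_le)
  also have "\<dots> = d s * mb.ev (\<lambda>r. x r / d r) (w, s)"
    unfolding * mb.ev_def prod.case using u mb.rho_word[OF u(1)] by (simp add: sum_distrib_left mult.assoc)
  finally show ?thesis .
qed

lemma Cl_rescaled:
  assumes m: "coxeter_matrix W S a" "coxeter_matrix W S b" and r: "rescaled S a b"
  shows "coxeter_matrix.Cl W S a = coxeter_matrix.Cl W S b"
proof -
  have *: "\<exists>x'. \<forall>g\<in>F. sgn (coxeter_matrix.ev W S b x' g) = sgn (coxeter_matrix.ev W S a x g)"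
    if m: "coxeter_matrix W S a" "coxeter_matrix W S b" and r: "rescaled S a b" and F: "F \<subseteq> carrier W \<times> S" for a b x F
  proof -
    obtain d where d: "\<forall>s\<in>S. d s > 0" "\<forall>s\<in>S. \<forall>t\<in>S. a s t = d s / d t * b s t"
      using r by (auto simp: rescaled_def)
    show ?thesis
    proof (intro exI ballI)
      fix g assume "g \<in> F"
      then obtain w s where g: "g = (w, s)" "w \<in> carrier W" "s \<in> S" using F by auto
      show "sgn (coxeter_matrix.ev W S b (\<lambda>r. x r / d r) g) = sgn (coxeter_matrix.ev W S a x g)"
        unfolding g(1) ev_rescaled[OF m d g(2,3)] sgn_mult using d g by simp
    qed
  qed
  show ?thesis by (rule Cl_eq_if_transfer[OF m *[OF m(2,1) rescaled_sym[OF r]] *[OF m r]])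
qed

text \<open>Definiteness of the kernel makes positively independent simple roots linearly independent.\<close>

definition definite_kernel :: "'g set \<Rightarrow> ('g \<Rightarrow> 'g \<Rightarrow> real) \<Rightarrow> bool" where
  "definite_kernel S a \<longleftrightarrow>
    (\<forall>x. (\<forall>t\<in>S. colin a S t x = 0) \<longrightarrow> (\<forall>s\<in>S. x s \<ge> 0) \<or> (\<forall>s\<in>S. x s \<le> 0))"

lemma definite_kernel_rescaled:
  assumes "rescaled S a b" "definite_kernel S b"
  shows "definite_kernel S a"
  unfolding definite_kernel_def
proof (intro allI impI)
  obtain d where d: "\<forall>s\<in>S. d s > 0" "\<forall>s\<in>S. \<forall>t\<in>S. a s t = d s / d t * b s t"
    using assms by (auto simp: rescaled_def)
  fix x assume x: "\<forall>t\<in>S. colin a S t x = 0"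
  have "colin b S t (\<lambda>s. x s * d s) = 0" if t: "t \<in> S" for t
  proof -
    have "colin b S t (\<lambda>s. x s * d s) = d t * colin a S t x"
      unfolding colin_def sum_distrib_left using d t by (intro sum.cong) (auto simp: less_le)
    then show ?thesis using x t by simp
  qed
  then have "(\<forall>s\<in>S. x s * d s \<ge> 0) \<or> (\<forall>s\<in>S. x s * d s \<le> 0)" using assms(2) unfolding definite_kernel_def by blast
  then show "(\<forall>s\<in>S. x s \<ge> 0) \<or> (\<forall>s\<in>S. x s \<le> 0)"
    using d(1) by (metis mult_less_0_iff not_le zero_less_mult_iff)
qed

section \<open>Realized root system data\<close>

lemma cone_of_add:
  assumes "x \<in> cone_of G" "y \<in> cone_of G" shows "x + y \<in> cone_of G"
proof -
  obtain F c E d where F: "x = (\<Sum>z\<in>F. c z *\<^sub>R z)" "finite F" "F \<subseteq> G \<union> {0}" "\<forall>z\<in>F. c z \<ge> 0"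
    and E: "y = (\<Sum>z\<in>E. d z *\<^sub>R z)" "finite E" "E \<subseteq> G \<union> {0}" "\<forall>z\<in>E. d z \<ge> 0"
    using assms unfolding cone_of_def by blast
  define k where "k z = (if z \<in> F then c z else 0) + (if z \<in> E then d z else 0)" for z
  have "x = (\<Sum>z\<in>F \<union> E. (if z \<in> F then c z else 0) *\<^sub>R z)" "y = (\<Sum>z\<in>F \<union> E. (if z \<in> E then d z else 0) *\<^sub>R z)"
    unfolding F(1) E(1) using F(2) E(2) by (auto intro!: sum.mono_neutral_cong_left)
  then have "x + y = (\<Sum>z\<in>F \<union> E. k z *\<^sub>R z)" by (simp add: k_def sum.distrib scaleR_left_distrib)
  moreover have "finite (F \<union> E)" "F \<union> E \<subseteq> G \<union> {0}" "\<forall>z\<in>F \<union> E. k z \<ge> 0" using F E by (auto simp: k_def)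
  ultimately show ?thesis unfolding cone_of_def by blast
qed

lemma cone_of_scaled: "g \<in> G \<Longrightarrow> l \<ge> 0 \<Longrightarrow> l *\<^sub>R g \<in> cone_of G"
  unfolding cone_of_def by (rule CollectI, rule exI[of _ "{g}"], rule exI[of _ "\<lambda>_. l"]) auto

lemma cone_of_zero: "0 \<in> cone_of G"
  unfolding cone_of_def by (rule CollectI, rule exI[of _ "{}"]) auto

lemma cone_of_sum:
  "(\<And>i. i \<in> I \<Longrightarrow> g i \<in> G \<and> l i \<ge> 0) \<Longrightarrow> (\<Sum>i\<in>I. l i *\<^sub>R g i) \<in> cone_of G"
  by (induction I rule: infinite_finite_induct) (auto simp: cone_of_zero intro!: cone_of_add cone_of_scaled)

lemma cone_of_elim:
  assumes "x \<in> cone_of G"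
  obtains F c where "finite F" "F \<subseteq> G" "\<forall>z\<in>F. c z \<ge> 0" "x = (\<Sum>z\<in>F. c z *\<^sub>R z)"
proof -
  obtain F c where F: "x = (\<Sum>z\<in>F. c z *\<^sub>R z)" "finite F" "F \<subseteq> G \<union> {0}" "\<forall>z\<in>F. c z \<ge> 0"
    using assms unfolding cone_of_def by blast
  have "x = (\<Sum>z\<in>F - {0}. c z *\<^sub>R z)" unfolding F(1) using F(2) by (intro sum.mono_neutral_right) auto
  then show ?thesis using F that[of "F - {0}" c] by blast
qed

text \<open>The carrier is an arbitrary set of permutations, so that the lemma serves both the group
  of a datum and the affine Weyl group.\<close>

lemma iso_into_Bij:
  assumes W: "group W" and f: "f \<in> iso W (BijGroup X\<lparr>carrier := C\<rparr>)" and C: "C \<subseteq> Bij X"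
  shows iso_into_Bij_mem: "\<And>w. w \<in> carrier W \<Longrightarrow> f w \<in> Bij X"
    and iso_into_Bij_mult: "\<And>x y v. x \<in> carrier W \<Longrightarrow> y \<in> carrier W \<Longrightarrow> v \<in> X \<Longrightarrow> f (x \<otimes>\<^bsub>W\<^esub> y) v = f x (f y v)"
    and iso_into_Bij_one: "\<And>v. v \<in> X \<Longrightarrow> f \<one>\<^bsub>W\<^esub> v = v"
    and iso_into_Bij_faithful: "\<And>w. w \<in> carrier W \<Longrightarrow> (\<And>v. v \<in> X \<Longrightarrow> f w v = v) \<Longrightarrow> w = \<one>\<^bsub>W\<^esub>"
proof -
  interpret group W by (rule W)
  have hom: "f \<in> hom W (BijGroup X\<lparr>carrier := C\<rparr>)" and bij: "bij_betw f (carrier W) C"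
    using f by (auto simp: iso_def)
  show mem: "f w \<in> Bij X" if "w \<in> carrier W" for w
    using hom_in_carrier[OF hom that] C by auto
  show mult: "f (x \<otimes>\<^bsub>W\<^esub> y) v = f x (f y v)" if "x \<in> carrier W" "y \<in> carrier W" "v \<in> X" for x y v
  proof -
    have "f (x \<otimes>\<^bsub>W\<^esub> y) = compose X (f x) (f y)"
      using hom_mult[OF hom that(1,2)] mem[OF that(1)] mem[OF that(2)] by (simp add: BijGroup_def)
    then show ?thesis using that(3) by (simp add: compose_def)
  qed
  show one: "f \<one>\<^bsub>W\<^esub> v = v" if v: "v \<in> X" for v
  proof -
    have "inj_on (f \<one>\<^bsub>W\<^esub>) X" "f \<one>\<^bsub>W\<^esub> v \<in> X" using mem[OF one_closed] v by (auto simp: Bij_def bij_betw_def)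
    moreover have "f \<one>\<^bsub>W\<^esub> (f \<one>\<^bsub>W\<^esub> v) = f \<one>\<^bsub>W\<^esub> v" using mult[OF one_closed one_closed v] by simp
    ultimately show ?thesis using inj_onD v by metis
  qed
  show "w = \<one>\<^bsub>W\<^esub>" if w: "w \<in> carrier W" "\<And>v. v \<in> X \<Longrightarrow> f w v = v" for w
  proof -
    have "f w v = f \<one>\<^bsub>W\<^esub> v" for v
      using w one mem[OF w(1)] mem[OF one_closed] by (cases "v \<in> X") (auto simp: Bij_def extensional_def)
    then have "f w = f \<one>\<^bsub>W\<^esub>" by blast
    then show ?thesis using bij w(1) inj_onD[of f "carrier W" w "\<one>\<^bsub>W\<^esub>"] by (simp add: bij_betw_def)
  qed
qed

section \<open>The simple roots of a datum, indexed by the generators\<close>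

locale realized = coxeter W S for W :: "('g, 'b) monoid_scheme" (structure) and S +
  fixes D :: "('v::real_vector, 'd::real_vector) root_datum" and \<phi> :: "'g \<Rightarrow> 'v \<Rightarrow> 'v"
  assumes datum: "realized_datum_of W S D \<phi>"
begin

abbreviation "V \<equiv> space_V D"
abbreviation "B \<equiv> pairing D"
abbreviation "\<iota> \<equiv> iota D"

lemma root_datum: "realized_root_datum D"
  and iso: "coxeter_iso \<phi> W S (datum_group D) (simple_refl D ` simple D)"
  using datum by (auto simp: realized_datum_of_def)

lemma simple_V: "\<alpha> \<in> simple D \<Longrightarrow> \<alpha> \<in> V"
  and iota_Vd: "\<alpha> \<in> simple D \<Longrightarrow> \<iota> \<alpha> \<in> space_Vd D"
  and V_subspace: "subspace V"
proof -
  have sp: "span (simple D) = V" "span (cosimple D) = space_Vd D" "bij_betw \<iota> (simple D) (cosimple D)"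
    using root_datum by (auto simp: realized_root_datum_def)
  show "\<alpha> \<in> simple D \<Longrightarrow> \<alpha> \<in> V" using span_base[of \<alpha> "simple D"] sp(1) by simp
  show "\<alpha> \<in> simple D \<Longrightarrow> \<iota> \<alpha> \<in> space_Vd D"
    using span_base[of "\<iota> \<alpha>" "cosimple D"] bij_betwE[OF sp(3)] sp(2) by simp
  show "subspace V" using subspace_span[of "simple D"] sp(1) by simp
qed

lemma pos_indep: "positively_independent (simple D)"
  and B_self: "\<alpha> \<in> simple D \<Longrightarrow> B \<alpha> (\<iota> \<alpha>) = 2"
  and B_nonpos: "\<alpha> \<in> simple D \<Longrightarrow> \<beta> \<in> simple D \<Longrightarrow> \<alpha> \<noteq> \<beta> \<Longrightarrow> B \<alpha> (\<iota> \<beta>) \<le> 0"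
  and B_zero: "\<alpha> \<in> simple D \<Longrightarrow> \<beta> \<in> simple D \<Longrightarrow> \<alpha> \<noteq> \<beta> \<Longrightarrow> B \<alpha> (\<iota> \<beta>) = 0 \<longleftrightarrow> B \<beta> (\<iota> \<alpha>) = 0"
  and B_prod: "\<alpha> \<in> simple D \<Longrightarrow> \<beta> \<in> simple D \<Longrightarrow> \<alpha> \<noteq> \<beta> \<Longrightarrow>
    B \<alpha> (\<iota> \<beta>) * B \<beta> (\<iota> \<alpha>) \<in> {4 * (cos (pi / real m))\<^sup>2 | m::nat. m \<ge> 2} \<union> {4..}"
proof -
  note parts = root_datum[unfolded realized_root_datum_def]
  show "positively_independent (simple D)" using parts by (elim conjE)
  have "\<forall>\<alpha>\<in>simple D. B \<alpha> (\<iota> \<alpha>) = 2" using parts by (elim conjE)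
  then show "\<alpha> \<in> simple D \<Longrightarrow> B \<alpha> (\<iota> \<alpha>) = 2" by (rule bspec)
  have "\<forall>\<alpha>\<in>simple D. \<forall>\<beta>\<in>simple D. \<alpha> \<noteq> \<beta> \<longrightarrow> B \<alpha> (\<iota> \<beta>) \<le> 0 \<and>
      (B \<alpha> (\<iota> \<beta>) = 0 \<longleftrightarrow> B \<beta> (\<iota> \<alpha>) = 0) \<and>
      B \<alpha> (\<iota> \<beta>) * B \<beta> (\<iota> \<alpha>) \<in> {4 * (cos (pi / real m))\<^sup>2 | m::nat. m \<ge> 2} \<union> {4..}"
    using parts by (elim conjE)
  note pair = this[rule_format]
  show "\<alpha> \<in> simple D \<Longrightarrow> \<beta> \<in> simple D \<Longrightarrow> \<alpha> \<noteq> \<beta> \<Longrightarrow> B \<alpha> (\<iota> \<beta>) \<le> 0"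
    "\<alpha> \<in> simple D \<Longrightarrow> \<beta> \<in> simple D \<Longrightarrow> \<alpha> \<noteq> \<beta> \<Longrightarrow> B \<alpha> (\<iota> \<beta>) = 0 \<longleftrightarrow> B \<beta> (\<iota> \<alpha>) = 0"
    "\<alpha> \<in> simple D \<Longrightarrow> \<beta> \<in> simple D \<Longrightarrow> \<alpha> \<noteq> \<beta> \<Longrightarrow>
      B \<alpha> (\<iota> \<beta>) * B \<beta> (\<iota> \<alpha>) \<in> {4 * (cos (pi / real m))\<^sup>2 | m::nat. m \<ge> 2} \<union> {4..}"
    using pair by blast+
qed

lemma B_lin: "v \<in> V \<Longrightarrow> v' \<in> V \<Longrightarrow> y \<in> space_Vd D \<Longrightarrow> B (a *\<^sub>R v + b *\<^sub>R v') y = a * B v y + b * B v' y"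
  using root_datum by (auto simp: realized_root_datum_def bilinear_between_def)

lemma B_add: "v \<in> V \<Longrightarrow> v' \<in> V \<Longrightarrow> y \<in> space_Vd D \<Longrightarrow> B (v + v') y = B v y + B v' y"
  using B_lin[of v v' y 1 1] by simp

lemma B_scale: "v \<in> V \<Longrightarrow> y \<in> space_Vd D \<Longrightarrow> B (l *\<^sub>R v) y = l * B v y"
  using B_lin[of v v y l 0] by simp

lemma B_diff: "v \<in> V \<Longrightarrow> v' \<in> V \<Longrightarrow> y \<in> space_Vd D \<Longrightarrow> B (v - v') y = B v y - B v' y"
  using B_lin[of v v' y 1 "-1"] by simp

lemma B_sum:
  "y \<in> space_Vd D \<Longrightarrow> (\<And>i. i \<in> I \<Longrightarrow> g i \<in> V) \<Longrightarrow> B (\<Sum>i\<in>I. c i *\<^sub>R g i) y = (\<Sum>i\<in>I. c i * B (g i) y)"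
proof (induction I rule: infinite_finite_induct)
  case (insert i I)
  then show ?case by (simp add: B_add B_scale V_subspace subspace_scale subspace_sum)
qed (use B_scale[of 0 y 0] subspace_0[OF V_subspace] in auto)

lemma simple_relation_impossible:
  assumes "\<alpha> \<in> simple D" "\<beta> \<in> simple D" "p *\<^sub>R \<alpha> + q *\<^sub>R \<beta> = 0" "p > 0" "q \<ge> 0"
  shows False
proof -
  have "\<exists>F c. finite F \<and> F \<noteq> {} \<and> F \<subseteq> simple D \<and> (\<forall>x\<in>F. c x > (0::real)) \<and> (\<Sum>x\<in>F. c x *\<^sub>R x) = 0"
  proof (cases "\<alpha> = \<beta> \<or> q = 0")
    case True
    then have "\<alpha> = 0"
    proof
      assume "\<alpha> = \<beta>"
      then have "(p + q) *\<^sub>R \<alpha> = 0" using assms(3) by (simp add: scaleR_left_distrib)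
      then show ?thesis using assms by simp
    qed (use assms in auto)
    then show ?thesis using assms by (intro exI[of _ "{\<alpha>}"] exI[of _ "\<lambda>_. 1"]) auto
  next
    case False
    then show ?thesis using assms
      by (intro exI[of _ "{\<alpha>, \<beta>}"] exI[of _ "\<lambda>x. if x = \<alpha> then p else q"]) auto
  qed
  then show False using pos_indep unfolding positively_independent_def by blast
qed

lemma simple_refl_apply: "v \<in> V \<Longrightarrow> simple_refl D \<alpha> v = v - B v (\<iota> \<alpha>) *\<^sub>R \<alpha>"
  by (simp add: simple_refl_def)

lemma simple_refl_V: "\<alpha> \<in> simple D \<Longrightarrow> v \<in> V \<Longrightarrow> simple_refl D \<alpha> v \<in> V"
  by (simp add: simple_refl_apply V_subspace subspace_diff subspace_scale simple_V)

lemma simple_refl_Bij: "\<alpha> \<in> simple D \<Longrightarrow> simple_refl D \<alpha> \<in> Bij V"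
proof -
  assume a: "\<alpha> \<in> simple D"
  have "simple_refl D \<alpha> (simple_refl D \<alpha> v) = v" if v: "v \<in> V" for v
  proof -
    have "B (v - B v (\<iota> \<alpha>) *\<^sub>R \<alpha>) (\<iota> \<alpha>) = - B v (\<iota> \<alpha>)"
      using v a by (simp add: B_diff B_scale B_self V_subspace subspace_scale simple_V iota_Vd)
    then show ?thesis
      using simple_refl_V[OF a v] by (simp add: simple_refl_apply v)
  qed
  then have "bij_betw (simple_refl D \<alpha>) V V"
    by (intro bij_betw_byWitness[where f'="simple_refl D \<alpha>"]) (auto simp: simple_refl_V a)
  then show ?thesis by (simp add: Bij_def simple_refl_def)
qed

text \<open>Equal reflections in \<alpha> and \<beta>, evaluated at \<alpha>, give a relation with
  coefficient 2 at \<alpha> and a nonnegative one at \<beta>, against positive independence.\<close>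

lemma simple_refl_inj: "inj_on (simple_refl D) (simple D)"
proof (rule inj_onI, rule ccontr)
  fix \<alpha> \<beta> assume a: "\<alpha> \<in> simple D" "\<beta> \<in> simple D" "simple_refl D \<alpha> = simple_refl D \<beta>" "\<alpha> \<noteq> \<beta>"
  have "simple_refl D \<alpha> \<alpha> = - \<alpha>"
    by (simp add: simple_refl_apply simple_V a(1) B_self scaleR_2)
  moreover have "simple_refl D \<beta> \<alpha> = \<alpha> - B \<alpha> (\<iota> \<beta>) *\<^sub>R \<beta>"
    by (simp add: simple_refl_apply simple_V a(1))
  ultimately have "\<alpha> - B \<alpha> (\<iota> \<beta>) *\<^sub>R \<beta> = - \<alpha>" using a(3) by simp
  then have "2 *\<^sub>R \<alpha> + (- B \<alpha> (\<iota> \<beta>)) *\<^sub>R \<beta> = 0"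
    by (metis (no_types, lifting) add_uminus_conv_diff add.assoc add.right_inverse scaleR_2 scaleR_minus_left)
  then show False using simple_relation_impossible[of \<alpha> \<beta> 2 "- B \<alpha> (\<iota> \<beta>)"] a B_nonpos by simp
qed

lemma datum_group_Bij: "carrier (datum_group D) \<subseteq> Bij V"
proof -
  have "generate (BijGroup V) (simple_refl D ` simple D) \<subseteq> carrier (BijGroup V)"
    using simple_refl_Bij by (intro group.generate_incl group_BijGroup) (auto simp: BijGroup_def)
  then show ?thesis by (simp add: datum_group_def BijGroup_def)
qed

lemma datum_group_iso: "\<phi> \<in> iso W (BijGroup V\<lparr>carrier := carrier (datum_group D)\<rparr>)"
  using iso by (simp add: coxeter_iso_def datum_group_def)

lemma phi_image_S: "\<phi> ` S = simple_refl D ` simple D"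
  using iso unfolding coxeter_iso_def by blast

lemmas phi_Bij = iso_into_Bij_mem[OF is_group datum_group_iso datum_group_Bij]
  and phi_mult = iso_into_Bij_mult[OF is_group datum_group_iso datum_group_Bij]
  and phi_one = iso_into_Bij_one[OF is_group datum_group_iso datum_group_Bij]
  and phi_faithful = iso_into_Bij_faithful[OF is_group datum_group_iso datum_group_Bij]

lemma phi_inj: "inj_on \<phi> (carrier W)"
  using datum_group_iso by (auto simp: iso_def bij_betw_def)

definition al :: "'g \<Rightarrow> 'v" where
  "al s = the_inv_into (simple D) (simple_refl D) (\<phi> s)"

lemma al: "s \<in> S \<Longrightarrow> al s \<in> simple D" "s \<in> S \<Longrightarrow> simple_refl D (al s) = \<phi> s"
proof -
  assume "s \<in> S"
  then have "\<phi> s \<in> simple_refl D ` simple D" using phi_image_S by blast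
  then show "al s \<in> simple D" "simple_refl D (al s) = \<phi> s"
    unfolding al_def using the_inv_into_into[OF simple_refl_inj _ subset_refl] f_the_inv_into_f[OF simple_refl_inj] by auto
qed

lemma al_refl: "s \<in> S \<Longrightarrow> \<alpha> \<in> simple D \<Longrightarrow> \<phi> s = simple_refl D \<alpha> \<Longrightarrow> \<alpha> = al s"
  using al inj_onD[OF simple_refl_inj] by metis

lemma al_bij: "bij_betw al S (simple D)"
proof (rule bij_betw_imageI)
  show "inj_on al S"
    by (rule inj_onI) (metis al(2) S_carrier inj_onD phi_inj)
  show "al ` S = simple D"
  proof
    show "simple D \<subseteq> al ` S"
    proof
      fix \<alpha> assume a: "\<alpha> \<in> simple D"
      then obtain s where "s \<in> S" "\<phi> s = simple_refl D \<alpha>" using phi_image_S by (metis image_iff)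
      then show "\<alpha> \<in> al ` S" using al_refl a by blast
    qed
  qed (use al in auto)
qed

lemma al_V: "s \<in> S \<Longrightarrow> al s \<in> V" using al simple_V by auto

lemma al_iota: "s \<in> S \<Longrightarrow> \<iota> (al s) \<in> space_Vd D" using al iota_Vd by auto

lemma al_neq: "s \<in> S \<Longrightarrow> t \<in> S \<Longrightarrow> s \<noteq> t \<Longrightarrow> al s \<noteq> al t"
  using al_bij by (auto simp: bij_betw_def inj_on_def)

lemma phi_S: "s \<in> S \<Longrightarrow> v \<in> V \<Longrightarrow> \<phi> s v = v - B v (\<iota> (al s)) *\<^sub>R al s"
  using al(2)[of s] simple_refl_apply[of v "al s"] by simp

section \<open>The matrix of a datum\<close>

definition mat :: "'g \<Rightarrow> 'g \<Rightarrow> real" where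
  "mat s t = B (al s) (\<iota> (al t))"

lemma mat_diag: "s \<in> S \<Longrightarrow> mat s s = 2"
  by (simp add: mat_def B_self al)

lemma mat_nonpos: "s \<in> S \<Longrightarrow> t \<in> S \<Longrightarrow> s \<noteq> t \<Longrightarrow> mat s t \<le> 0"
  by (simp add: mat_def B_nonpos al al_neq)

lemma mat_zero: "s \<in> S \<Longrightarrow> t \<in> S \<Longrightarrow> mat s t = 0 \<longleftrightarrow> mat t s = 0"
  using B_zero[of "al s" "al t"] al al_neq by (cases "s = t") (auto simp: mat_def)

text \<open>Two simple roots are linearly independent even where the set of all of them might not
  be: a relation with one positive and one negative coefficient becomes negative when paired with
  the coroot belonging to the negative one.\<close>

lemma al_pair_independent:
  assumes s: "s \<in> S" and t: "t \<in> S" and st: "s \<noteq> t" and eq: "p *\<^sub>R al s + q *\<^sub>R al t = 0"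
  shows "p = 0 \<and> q = 0"
proof -
  have 1: False if "p > 0" "p *\<^sub>R al s + q *\<^sub>R al t = 0" "s \<in> S" "t \<in> S" "s \<noteq> t" for p q s t
  proof (cases "q \<ge> 0")
    case False
    have "B (p *\<^sub>R al s + q *\<^sub>R al t) (\<iota> (al t)) = p * mat s t + q * 2"
      using B_lin[OF al_V[OF that(3)] al_V[OF that(4)] al_iota[OF that(4)], of p q] mat_diag[OF that(4)]
      by (simp add: mat_def)
    moreover have "B 0 (\<iota> (al t)) = 0" using B_scale[OF al_V al_iota, of t t 0] that by simp
    ultimately have "p * mat s t + q * 2 = 0" using that(2) by simp
    moreover have "p * mat s t \<le> 0" using mat_nonpos that by (simp add: mult_nonneg_nonpos)
    ultimately show False using False by simp
  qed (use simple_relation_impossible[of "al s" "al t" p q] that al in auto)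
  have "(-p) *\<^sub>R al s + (-q) *\<^sub>R al t = 0" using arg_cong[OF eq, of uminus] by simp
  moreover have "q *\<^sub>R al t + p *\<^sub>R al s = 0" "(-q) *\<^sub>R al t + (-p) *\<^sub>R al s = 0"
    using eq calculation by (simp_all add: add.commute)
  ultimately have "\<not> p > 0" "\<not> - p > 0" "\<not> q > 0" "\<not> - q > 0"
    using 1[of p s q t] 1[of "-p" s "-q" t] 1[of q t p s] 1[of "-q" t "-p" s] eq s t st by blast+
  then show ?thesis by linarith
qed

lemma phi_pow:
  assumes s: "s \<in> S" and t: "t \<in> S" and v: "v \<in> V"
  shows "\<phi> ((s \<otimes> t) [^] (k::nat)) v =
    v + fst ((dstep (B v (\<iota> (al s))) (B v (\<iota> (al t))) (mat s t) (mat t s) ^^ k) (0, 0)) *\<^sub>R al s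
      + snd ((dstep (B v (\<iota> (al s))) (B v (\<iota> (al t))) (mat s t) (mat t s) ^^ k) (0, 0)) *\<^sub>R al t"
    (is "_ = v + fst (?D k) *\<^sub>R al s + snd (?D k) *\<^sub>R al t")
proof (induction k)
  case 0
  then show ?case using v by (simp add: phi_one)
next
  case (Suc k)
  note c = S_carrier[OF s] S_carrier[OF t]
  note lin = V_subspace subspace_add subspace_scale al_V[OF s] al_V[OF t] v al_iota[OF s] al_iota[OF t]
  obtain P Q where PQ: "?D k = (P, Q)" by fastforce
  define Q' where "Q' = - Q - B v (\<iota> (al t)) - P * mat s t"
  have D: "?D (Suc k) = (- P - B v (\<iota> (al s)) - Q' * mat t s, Q')"
    using PQ by (simp add: dstep_def Q'_def Let_def)
  have "\<phi> t (v + P *\<^sub>R al s + Q *\<^sub>R al t)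
      = v + P *\<^sub>R al s + (Q - (B v (\<iota> (al t)) + P * mat s t + Q * mat t t)) *\<^sub>R al t"
    by (simp add: phi_S t lin B_add B_scale mat_def scaleR_left_diff_distrib)
  then have 1: "\<phi> t (v + P *\<^sub>R al s + Q *\<^sub>R al t) = v + P *\<^sub>R al s + Q' *\<^sub>R al t"
    by (simp add: Q'_def mat_diag[OF t] algebra_simps)
  have "\<phi> s (v + P *\<^sub>R al s + Q' *\<^sub>R al t)
      = v + (P - (B v (\<iota> (al s)) + P * mat s s + Q' * mat t s)) *\<^sub>R al s + Q' *\<^sub>R al t"
    by (simp add: phi_S s lin B_add B_scale mat_def scaleR_left_diff_distrib)
  also have "P - (B v (\<iota> (al s)) + P * mat s s + Q' * mat t s) = - P - B v (\<iota> (al s)) - Q' * mat t s"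
    by (simp add: mat_diag[OF s])
  finally have 2: "\<phi> s (v + P *\<^sub>R al s + Q' *\<^sub>R al t)
      = v + (- P - B v (\<iota> (al s)) - Q' * mat t s) *\<^sub>R al s + Q' *\<^sub>R al t" .
  have "\<phi> ((s \<otimes> t) [^] Suc k) v = \<phi> s (\<phi> t (\<phi> ((s \<otimes> t) [^] k) v))"
    using c v by (subst nat_pow_Suc2) (simp_all add: m_assoc phi_mult del: nat_pow_Suc)
  also have "\<phi> ((s \<otimes> t) [^] k) v = v + P *\<^sub>R al s + Q *\<^sub>R al t" using Suc unfolding PQ fst_conv snd_conv .
  finally show ?case unfolding D fst_conv snd_conv 1 2 .
qed

text \<open>The orders in \<open>W\<close> are recovered from the pairing. A product 4 cos^2 (pi /
  m) makes the m-th power act trivially on all of V, hence trivial in \<open>W\<close>, while the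
  orbit of one simple root shows that m divides the order. A product of at least 4 makes this orbit
  infinite.\<close>

lemma mat_cartan: "cartan W S mat"
  unfolding cartan_def
proof (intro conjI ballI impI)
  fix s t assume s: "s \<in> S" and t: "t \<in> S" and st: "s \<noteq> t"
  have stW: "s \<otimes> t \<in> carrier W" using s t S_carrier by auto
  define o' where "o' = ord (s \<otimes> t)"
  have one: "(s \<otimes> t) [^] o' = \<one>" unfolding o'_def using pow_ord_eq_1[OF stW] .
  have "al s + fst ((dstep 2 (mat s t) (mat s t) (mat t s) ^^ o') (0, 0)) *\<^sub>R al s
     + snd ((dstep 2 (mat s t) (mat s t) (mat t s) ^^ o') (0, 0)) *\<^sub>R al t = al s"
    using phi_pow[OF s t al_V[OF s], of o'] mat_diag[OF s] phi_one[OF al_V[OF s]]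
    unfolding one by (simp add: mat_def)
  then have zero: "(dstep 2 (mat s t) (mat s t) (mat t s) ^^ o') (0, 0) = (0, 0)"
    using al_pair_independent[OF s t st] by (simp add: prod_eq_iff add.assoc)
  have "mat s t * mat t s \<in> {4 * (cos (pi / real m))\<^sup>2 | m::nat. m \<ge> 2} \<union> {4..}"
    using B_prod[of "al s" "al t"] al s t al_neq[OF s t st] by (simp add: mat_def)
  then consider m where "m \<ge> 2" "mat s t * mat t s = 4 * (cos (pi / real m))\<^sup>2" | "mat s t * mat t s \<ge> 4" by auto
  then show "if ord (s \<otimes> t) = 0 then mat s t * mat t s \<ge> 4
       else mat s t * mat t s = 4 * (cos (pi / real (ord (s \<otimes> t))))\<^sup>2"
  proof cases
    case 1
    have "(s \<otimes> t) [^] m = \<one>"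
    proof (rule phi_faithful)
      fix v assume "v \<in> V"
      then show "\<phi> ((s \<otimes> t) [^] m) v = v"
        by (simp add: phi_pow[OF s t] dstep_order[OF 1(2,1) mat_zero[OF s t]])
    qed (use stW in simp)
    then have "o' dvd m" using pow_eq_id[OF stW] o'_def by simp
    moreover have "m dvd o'" using dstep_order_conv[OF 1(2,1) mat_zero[OF s t] zero] .
    ultimately have "o' = m" by (rule dvd_antisym)
    then show ?thesis using 1 by (simp add: o'_def)
  next
    case 2
    then show ?thesis using dstep_infinite[OF 2 zero] by (simp add: o'_def)
  qed
qed (auto simp: mat_diag mat_nonpos mat_zero)

sublocale coxeter_matrix W S mat
  by unfold_locales (rule mat_cartan)

section \<open>Coordinates with respect to the simple roots\<close>

definition vec :: "('g \<Rightarrow> real) \<Rightarrow> 'v" where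
  "vec c = (\<Sum>r\<in>S. c r *\<^sub>R al r)"

lemma vec_V: "vec c \<in> V"
  unfolding vec_def by (intro subspace_sum V_subspace subspace_scale al_V)

lemma vec_coord: "s \<in> S \<Longrightarrow> vec (coord s) = al s"
  by (simp add: vec_def coord_def if_distrib[of "\<lambda>x. x *\<^sub>R _"] finS cong: if_cong)

lemma phi_S_vec: "s \<in> S \<Longrightarrow> \<phi> s (vec c) = vec (gen mat S s c)"
proof -
  assume s: "s \<in> S"
  have "B (vec c) (\<iota> (al s)) = colin mat S s c"
    unfolding vec_def colin_def mat_def by (intro B_sum al_iota s al_V)
  moreover have "vec (gen mat S s c) = vec c - colin mat S s c *\<^sub>R vec (coord s)"
    by (simp add: vec_def gen_def scaleR_left_diff_distrib sum_subtractf scaleR_sum_right)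
  ultimately show ?thesis using s by (simp add: phi_S vec_V vec_coord)
qed

lemma phi_vec: "w \<in> carrier W \<Longrightarrow> \<phi> w (vec c) = vec (rho w c)"
proof -
  assume "w \<in> carrier W"
  then obtain u where u: "u \<in> lists S" "word_prod W u = w" using word_ex by blast
  have "\<phi> (word_prod W u) (vec c) = vec (act mat S u c)" using u(1)
  proof (induction u)
    case (Cons s u)
    then have "s \<in> S" "u \<in> lists S" by auto
    then show ?case using Cons.IH by (simp add: phi_mult S_carrier vec_V phi_S_vec del: in_lists_conv_set)
  qed (simp add: phi_one vec_V)
  then show ?thesis using u rho_word[OF u(1)] by simp
qed

lemma phi_al: "w \<in> carrier W \<Longrightarrow> s \<in> S \<Longrightarrow> \<phi> w (al s) = vec (rho w (coord s))"
  using phi_vec[of w "coord s"] by (simp add: vec_coord)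

lemma roots_eq: "roots W D \<phi> = {\<phi> w (al s) | w s. w \<in> carrier W \<and> s \<in> S}"
proof -
  have "simple D = al ` S" using al_bij by (simp add: bij_betw_def)
  then have "roots W D \<phi> = {\<phi> w \<beta> | w \<beta>. w \<in> carrier W \<and> \<beta> \<in> al ` S}" unfolding roots_def by simp
  also have "\<dots> = {\<phi> w (al s) | w s. w \<in> carrier W \<and> s \<in> S}" by auto
  finally show ?thesis .
qed

text \<open>Pairing a linear relation with all coroots puts its coefficients into the kernel of the
  matrix. They are then of one sign, and the indices with nonzero coefficient contradict positive
  independence.\<close>

lemma vec_zero_if_definite_kernel:
  assumes "definite_kernel S mat" "vec c = 0" "s \<in> S"
  shows "c s = 0"
proof -
  have pos: "c s = 0" if v: "vec c = 0" and c: "\<forall>s\<in>S. c s \<ge> 0" and s: "s \<in> S" for c s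
  proof (rule ccontr)
    assume "c s \<noteq> 0"
    define T where "T = {r \<in> S. c r > 0}"
    have T: "T \<subseteq> S" "s \<in> T" "finite T" using c s \<open>c s \<noteq> 0\<close> finS by (auto simp: T_def less_le)
    have inj: "inj_on al T" using al_bij T by (auto simp: bij_betw_def intro: inj_on_subset)
    define k where "k = c \<circ> the_inv_into T al"
    have k: "k (al r) = c r" if "r \<in> T" for r using that by (simp add: k_def the_inv_into_f_f[OF inj])
    have "(\<Sum>x\<in>al ` T. k x *\<^sub>R x) = (\<Sum>r\<in>T. c r *\<^sub>R al r)"
      by (simp add: sum.reindex[OF inj] k)
    also have "\<dots> = vec c" unfolding vec_def using c finS by (intro sum.mono_neutral_left) (auto simp: T_def less_le)
    finally have "(\<Sum>x\<in>al ` T. k x *\<^sub>R x) = 0" using v by simp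
    moreover have "finite (al ` T)" "al ` T \<noteq> {}" "al ` T \<subseteq> simple D" "\<forall>x\<in>al ` T. k x > 0"
      using T al k by (auto simp: T_def)
    ultimately show False using pos_indep unfolding positively_independent_def by blast
  qed
  have "colin mat S t c = 0" if t: "t \<in> S" for t
  proof -
    have "colin mat S t c = B (vec c) (\<iota> (al t))"
      unfolding vec_def colin_def mat_def by (rule B_sum[symmetric]) (auto intro: al_iota t al_V)
    also have "\<dots> = 0" using assms(2) B_scale[OF al_V al_iota, of t t 0] t by simp
    finally show ?thesis .
  qed
  then have "(\<forall>s\<in>S. c s \<ge> 0) \<or> (\<forall>s\<in>S. c s \<le> 0)" using assms(1) unfolding definite_kernel_def by blast
  then show ?thesis
  proof
    assume "\<forall>s\<in>S. c s \<le> 0"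
    moreover have "vec (\<lambda>r. - c r) = 0" using assms(2) by (simp add: vec_def sum_negf)
    ultimately show ?thesis using pos[of "\<lambda>r. - c r" s] assms(3) by simp
  qed (use pos assms in blast)
qed

end

section \<open>Data with linearly independent simple roots\<close>

locale independent_realized = realized +
  assumes definite: "definite_kernel S mat"
begin

lemma vec_eq: "vec c = vec d \<Longrightarrow> s \<in> S \<Longrightarrow> c s = d s"
proof -
  assume "vec c = vec d" "s \<in> S"
  then have "vec (\<lambda>r. c r - d r) = 0" by (simp add: vec_def scaleR_left_diff_distrib sum_subtractf)
  from vec_zero_if_definite_kernel[OF definite this \<open>s \<in> S\<close>] show ?thesis by simp
qed

lemma vec_cone_iff: "vec c \<in> cone_of (simple D) \<longleftrightarrow> (\<forall>r\<in>S. c r \<ge> 0)"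
proof
  assume "\<forall>r\<in>S. c r \<ge> 0"
  then show "vec c \<in> cone_of (simple D)" unfolding vec_def using al by (intro cone_of_sum) auto
next
  assume "vec c \<in> cone_of (simple D)"
  then obtain F k where F: "finite F" "F \<subseteq> simple D" "\<forall>z\<in>F. k z \<ge> 0" "vec c = (\<Sum>z\<in>F. k z *\<^sub>R z)"
    by (rule cone_of_elim)
  have inj: "inj_on al S" and im: "al ` S = simple D" using al_bij by (auto simp: bij_betw_def)
  have fin: "finite (simple D)" using finS im by (metis finite_imageI)
  have "(\<Sum>z\<in>F. k z *\<^sub>R z) = (\<Sum>z\<in>simple D. (if z \<in> F then k z else 0) *\<^sub>R z)"
    using F fin by (intro sum.mono_neutral_cong_left) auto
  also have "\<dots> = vec (\<lambda>r. if al r \<in> F then k (al r) else 0)"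
    unfolding vec_def im[symmetric] by (simp add: sum.reindex[OF inj])
  finally have "vec c = vec (\<lambda>r. if al r \<in> F then k (al r) else 0)" using F(4) by simp
  then show "\<forall>r\<in>S. c r \<ge> 0" using vec_eq[of c "\<lambda>r. if al r \<in> F then k (al r) else 0"] F(3) by auto
qed

lemma phi_al_eq:
  assumes "w \<in> carrier W" "s \<in> S" "w' \<in> carrier W" "s' \<in> S" "\<phi> w (al s) = \<phi> w' (al s')"
  shows "rho w (coord s) = rho w' (coord s')"
proof
  fix r
  show "rho w (coord s) r = rho w' (coord s') r"
  proof (cases "r \<in> S")
    case True
    then show ?thesis using vec_eq[of "rho w (coord s)" "rho w' (coord s')"] assms by (simp add: phi_al)
  next
    case False
    then show ?thesis using assms by (auto simp: rho_outside coord_def)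
  qed
qed

lemma root_refl_eq:
  assumes "w \<in> carrier W" "s \<in> S"
  shows "root_refl W S D \<phi> (\<phi> w (al s)) = w \<otimes> s \<otimes> inv w"
  unfolding root_refl_def
proof (rule the_equality)
  show "\<exists>w'\<in>carrier W. \<exists>\<beta>\<in>simple D. \<exists>s'\<in>S. \<phi> w' \<beta> = \<phi> w (al s) \<and> \<phi> s' = simple_refl D \<beta> \<and>
      w \<otimes> s \<otimes> inv w = w' \<otimes> s' \<otimes> inv w'"
    using assms al[OF assms(2)] by (intro bexI[of _ w] bexI[of _ "al s"] bexI[of _ s]) auto
next
  fix t assume "\<exists>w'\<in>carrier W. \<exists>\<beta>\<in>simple D. \<exists>s'\<in>S. \<phi> w' \<beta> = \<phi> w (al s) \<and> \<phi> s' = simple_refl D \<beta> \<and>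
      t = w' \<otimes> s' \<otimes> inv w'"
  then obtain w' \<beta> s' where w': "w' \<in> carrier W" "\<beta> \<in> simple D" "s' \<in> S" "\<phi> w' \<beta> = \<phi> w (al s)"
    "\<phi> s' = simple_refl D \<beta>" "t = w' \<otimes> s' \<otimes> inv w'" by blast
  then have "\<beta> = al s'" using al_refl by blast
  then show "t = w \<otimes> s \<otimes> inv w"
    using reflection_unique[OF w'(1) assms(1) w'(3) assms(2)] phi_al_eq[OF w'(1,3) assms] w' by simp
qed

lemma pos_roots_iff:
  assumes "w \<in> carrier W" "s \<in> S"
  shows "\<phi> w (al s) \<in> pos_roots W D \<phi> \<longleftrightarrow> len w < len (w \<otimes> s)"
proof -
  have "\<phi> w (al s) \<in> roots W D \<phi>" using assms roots_eq by blast
  then show ?thesis unfolding pos_roots_def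
    by (simp add: phi_al[OF assms] vec_cone_iff root_sign_iff[OF assms])
qed

lemma signed_refl_eq:
  assumes "w \<in> carrier W" "s \<in> S"
  shows "signed_refl W S D \<phi> (\<phi> w (al s)) = sr w s"
proof -
  have ws: "w \<otimes> s \<in> carrier W" using assms S_carrier by simp
  have "- \<phi> w (al s) = \<phi> (w \<otimes> s) (al s)"
    using assms ws by (simp add: phi_al rho_flip vec_def sum_negf)
  moreover have "(w \<otimes> s) \<otimes> s \<otimes> inv (w \<otimes> s) = w \<otimes> s \<otimes> inv w"
    using assms S_carrier[OF assms(2)] by (simp add: mult_S_S inv_mult_group S_inv m_assoc)
  ultimately show ?thesis
    unfolding signed_refl_def pos_roots_iff[OF assms] sr_def
    using root_refl_eq[OF assms] root_refl_eq[OF ws assms(2)] by simp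
qed

text \<open>One direction evaluates functionals on a conic combination. In the other, Farkas' lemma
  represents an evaluation as a conic combination of evaluations, and inserting the functionals
  \<open>coord r\<close> turns this into an identity of vectors.\<close>

lemma cone_iff:
  assumes w: "w \<in> carrier W" and s: "s \<in> S" and G: "G \<subseteq> carrier W \<times> S"
  shows "\<phi> w (al s) \<in> cone_of ((\<lambda>(w, s). \<phi> w (al s)) ` G) \<longleftrightarrow>
    (\<exists>F. finite F \<and> F \<subseteq> G \<and> (\<forall>x. (\<forall>g\<in>F. ev x g \<ge> 0) \<longrightarrow> ev x (w, s) \<ge> 0))"
    (is "?L \<longleftrightarrow> ?R")
proof -
  define rt where "rt = (\<lambda>(w, s). \<phi> w (al s))"
  define co where "co = (\<lambda>(w, s). rho w (coord s))"
  have rt: "rt g = vec (co g)" if "g \<in> carrier W \<times> S" for g using that by (auto simp: rt_def co_def phi_al)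
  have ev: "ev x g = (\<Sum>r\<in>S. co g r * x r)" for x g by (cases g) (simp add: ev_def co_def)
  have vsum: "(\<Sum>i\<in>I. l i *\<^sub>R rt (p i)) = vec (\<lambda>r. \<Sum>i\<in>I. l i * co (p i) r)"
    if "p ` I \<subseteq> carrier W \<times> S" for I :: "'z set" and l p
  proof -
    have "(\<Sum>i\<in>I. l i *\<^sub>R rt (p i)) = (\<Sum>i\<in>I. l i *\<^sub>R vec (co (p i)))" using that rt by (intro sum.cong) auto
    also have "\<dots> = vec (\<lambda>r. \<Sum>i\<in>I. l i * co (p i) r)"
      unfolding vec_def scaleR_sum_left scaleR_sum_right by (subst sum.swap) simp
    finally show ?thesis .
  qed
  have g0: "(w, s) \<in> carrier W \<times> S" using w s by simp
  have "rt (w, s) \<in> cone_of (rt ` G) \<longleftrightarrow> ?R"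
  proof
    assume "rt (w, s) \<in> cone_of (rt ` G)"
    then obtain F k where F: "finite F" "F \<subseteq> rt ` G" "\<forall>z\<in>F. k z \<ge> 0" "rt (w, s) = (\<Sum>z\<in>F. k z *\<^sub>R z)"
      by (rule cone_of_elim)
    \<comment> \<open>Several pairs \<open>(w, s)\<close> can name the same root, so one is chosen
      for each vector.\<close>
    obtain p where p: "\<forall>z\<in>F. p z \<in> G \<and> rt (p z) = z" using F(2) by (metis image_iff subset_iff)
    have pG: "p ` F \<subseteq> carrier W \<times> S" using p G by blast
    have "vec (co (w, s)) = (\<Sum>z\<in>F. k z *\<^sub>R rt (p z))" using F(4) rt[OF g0] p by simp
    then have "co (w, s) r = (\<Sum>z\<in>F. k z * co (p z) r)" if "r \<in> S" for r
      unfolding vsum[OF pG] using vec_eq that by blast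
    then have "ev x (w, s) = (\<Sum>z\<in>F. k z * ev x (p z))" for x
      unfolding ev sum_distrib_left by (subst sum.swap) (simp add: sum_distrib_right mult.assoc)
    then have 1: "\<forall>x. (\<forall>g\<in>p ` F. ev x g \<ge> 0) \<longrightarrow> ev x (w, s) \<ge> 0" using F(3) by (auto intro!: sum_nonneg)
    have 2: "p ` F \<subseteq> G" "finite (p ` F)" using F(1) p by blast+
    show ?R by (intro exI[of _ "p ` F"] conjI 1 2)
  next
    assume ?R
    then obtain F where F: "finite F" "F \<subseteq> G" "\<forall>x. (\<forall>g\<in>F. ev x g \<ge> 0) \<longrightarrow> ev x (w, s) \<ge> 0"
      by (elim exE conjE)
    obtain l where l: "\<forall>g\<in>F. l g \<ge> 0" "\<forall>x. ev x (w, s) = (\<Sum>g\<in>F. l g * ev x g)"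
      using farkas[of F "\<lambda>g x. ev x g" "\<lambda>x. ev x (w, s)", OF F(1) ev_functional ev_functional] F(3) by blast
    have "co (w, s) r = (\<Sum>g\<in>F. l g * co g r)" if "r \<in> S" for r
    proof -
      have "ev (coord r) g = co g r" for g using ev_coord[OF that] by (cases g) (simp add: co_def)
      then show ?thesis using l(2)[rule_format, of "coord r"] by simp
    qed
    then have "vec (co (w, s)) = vec (\<lambda>r. \<Sum>g\<in>F. l g * co g r)" unfolding vec_def by simp
    also have "\<dots> = (\<Sum>g\<in>F. l g *\<^sub>R rt g)" using vsum[of id F l] F G by auto
    also have "\<dots> \<in> cone_of (rt ` G)" using l F by (intro cone_of_sum) auto
    finally show "rt (w, s) \<in> cone_of (rt ` G)" using rt[OF g0] by simp
  qed
  then show ?thesis by (simp add: rt_def)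
qed

theorem closure_op_eq_Cl: "closure_op W S D \<phi> = Cl"
proof
  fix A
  show "closure_op W S D \<phi> A = Cl A"
  proof (cases "A \<in> Pow (reflections W S \<times> {1, - 1})")
    case True
    define G where "G = {(w, s). w \<in> carrier W \<and> s \<in> S \<and> sr w s \<in> A}"
    have G: "G \<subseteq> carrier W \<times> S" by (auto simp: G_def)
    have Ga: "{\<alpha> \<in> roots W D \<phi>. signed_refl W S D \<phi> \<alpha> \<in> A} = (\<lambda>(w, s). \<phi> w (al s)) ` G"
      unfolding roots_eq G_def using signed_refl_eq by auto
    have "closure_op W S D \<phi> A = {sr w s | w s. w \<in> carrier W \<and> s \<in> S \<and> \<phi> w (al s) \<in> cone_of ((\<lambda>(w, s). \<phi> w (al s)) ` G)}"
    proof -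
      have "closure_op W S D \<phi> A = signed_refl W S D \<phi> ` (cone_of ((\<lambda>(w, s). \<phi> w (al s)) ` G) \<inter> roots W D \<phi>)"
        using True Ga by (simp add: closure_op_def cone_in_def)
      also have "cone_of ((\<lambda>(w, s). \<phi> w (al s)) ` G) \<inter> roots W D \<phi> =
        {\<phi> w (al s) | w s. w \<in> carrier W \<and> s \<in> S \<and> \<phi> w (al s) \<in> cone_of ((\<lambda>(w, s). \<phi> w (al s)) ` G)}"
        unfolding roots_eq by blast
      also have "signed_refl W S D \<phi> ` \<dots> =
        {signed_refl W S D \<phi> (\<phi> w (al s)) | w s. w \<in> carrier W \<and> s \<in> S \<and> \<phi> w (al s) \<in> cone_of ((\<lambda>(w, s). \<phi> w (al s)) ` G)}"
        by blast
      also have "\<dots> = {sr w s | w s. w \<in> carrier W \<and> s \<in> S \<and> \<phi> w (al s) \<in> cone_of ((\<lambda>(w, s). \<phi> w (al s)) ` G)}"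
        by (intro Collect_cong ex_cong1) (auto simp: signed_refl_eq)
      finally show ?thesis .
    qed
    also have "\<dots> = Cl A"
    proof -
      have FG: "F \<subseteq> G \<longleftrightarrow> F \<subseteq> carrier W \<times> S \<and> (\<forall>(w', s')\<in>F. sr w' s' \<in> A)" for F by (auto simp: G_def)
      note E = cone_iff[OF _ _ G, unfolded FG conj_assoc]
      show ?thesis unfolding Cl_def restrict_apply'[OF True]
        by (intro Collect_cong ex_cong1 conj_cong refl E)
    qed
    finally show ?thesis .
  qed (simp add: closure_op_def Cl_def)
qed

end

section \<open>Symmetrizable matrices and finite groups\<close>

text \<open>If p is the form of the simple roots, then a s t sqrt (p t t) / sqrt (p s s) is the
  entry of the symmetrized matrix. Being at most 0, it is minus the square root of the product
  \<open>a s t * a t s\<close>, so the two matrices have the same symmetrization.\<close>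

lemma rescaled_if_symmetrizable:
  assumes sym1: "\<And>s. s \<in> S \<Longrightarrow> p s s > (0::real)" "\<And>s t. s \<in> S \<Longrightarrow> t \<in> S \<Longrightarrow> p s t = p t s"
      "\<And>s t. s \<in> S \<Longrightarrow> t \<in> S \<Longrightarrow> a s t * p t t = 2 * p s t"
    and sym2: "\<And>s. s \<in> S \<Longrightarrow> q s s > (0::real)" "\<And>s t. s \<in> S \<Longrightarrow> t \<in> S \<Longrightarrow> q s t = q t s"
      "\<And>s t. s \<in> S \<Longrightarrow> t \<in> S \<Longrightarrow> b s t * q t t = 2 * q s t"
    and neg: "\<And>s t. s \<in> S \<Longrightarrow> t \<in> S \<Longrightarrow> s \<noteq> t \<Longrightarrow> a s t \<le> 0 \<and> b s t \<le> 0 \<and> a s t * a t s = b s t * b t s"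
  shows "rescaled S a b"
proof -
  have root: "a s t * sqrt (p t t) / sqrt (p s s) = - sqrt (a s t * a t s)"
    if p: "p s s > (0::real)" "p t t > 0" "p s t = p t s" "a s t * p t t = 2 * p s t" "a t s * p s s = 2 * p t s" "a s t \<le> 0"
    for p a :: "'g \<Rightarrow> 'g \<Rightarrow> real" and s t
  proof -
    have "a s t * p t t = a t s * p s s" using p by simp
    then have e: "a t s = a s t * p t t / p s s" using p(1) by (simp add: field_simps)
    have "(- (a s t * sqrt (p t t) / sqrt (p s s)))\<^sup>2 = a s t * a t s"
      using p(1,2) unfolding e by (simp add: power_mult_distrib power_divide power2_eq_square)
    moreover have "- (a s t * sqrt (p t t) / sqrt (p s s)) \<ge> 0"
      using p by (simp add: divide_nonpos_pos mult_nonpos_nonneg)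
    ultimately have "sqrt (a s t * a t s) = - (a s t * sqrt (p t t) / sqrt (p s s))"
      by (metis real_sqrt_unique)
    then show ?thesis by simp
  qed
  \<comment> \<open>The ratio of the lengths of the simple roots in the two forms.\<close>
  define d where "d s = sqrt (p s s) / sqrt (q s s)" for s
  have "a s t = d s / d t * b s t" if s: "s \<in> S" and t: "t \<in> S" for s t
  proof (cases "s = t")
    case True
    then have "a s t = 2" "b s t = 2"
      using sym1(1)[OF s] sym1(3)[OF s s] sym2(1)[OF s] sym2(3)[OF s s] by auto
    then show ?thesis using True sym1(1)[OF s] sym2(1)[OF s] by (simp add: d_def)
  next
    case False
    have "a s t * sqrt (p t t) / sqrt (p s s) = b s t * sqrt (q t t) / sqrt (q s s)"
      using root[of p s t a] root[of q s t b] sym1 sym2 neg[OF s t False] s t by metis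
    then show ?thesis using sym1(1)[OF s] sym1(1)[OF t] sym2(1)[OF s] sym2(1)[OF t]
      by (simp add: d_def field_simps)
  qed
  moreover have "\<forall>s\<in>S. d s > 0" using sym1(1) sym2(1) by (simp add: d_def)
  ultimately show ?thesis unfolding rescaled_def by blast
qed

section \<open>The averaged form of a finite group\<close>

context coxeter_matrix
begin

definition avg_form :: "('a \<Rightarrow> real) \<Rightarrow> ('a \<Rightarrow> real) \<Rightarrow> real" where
  "avg_form c d = (\<Sum>w\<in>carrier W. \<Sum>r\<in>S. rho w c r * rho w d r)"

lemma avg_form_sym: "avg_form c d = avg_form d c"
  by (simp add: avg_form_def mult.commute)

lemma avg_form_lin: "avg_form (\<lambda>t. c t + l * c' t) d = avg_form c d + l * avg_form c' d"
proof -
  have "avg_form (\<lambda>t. c t + l * c' t) d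
      = (\<Sum>w\<in>carrier W. \<Sum>r\<in>S. rho w c r * rho w d r + l * (rho w c' r * rho w d r))"
    unfolding avg_form_def by (intro sum.cong refl) (simp add: rho_add rho_scale algebra_simps)
  then show ?thesis by (simp add: avg_form_def sum.distrib sum_distrib_left)
qed

lemma avg_form_zero: "avg_form (\<lambda>t. 0) d = 0"
  using avg_form_lin[of "\<lambda>t. 0" "- 1" "\<lambda>t. 0" d] by simp

lemma avg_form_sum: "finite I \<Longrightarrow> avg_form (\<lambda>t. \<Sum>i\<in>I. l i * c i t) d = (\<Sum>i\<in>I. l i * avg_form (c i) d)"
proof (induction I rule: finite_induct)
  case (insert i I)
  have "(\<lambda>t. \<Sum>i\<in>insert i I. l i * c i t) = (\<lambda>t. (\<Sum>i\<in>I. l i * c i t) + l i * c i t)"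
    using insert by (simp add: add.commute)
  then show ?case using insert by (simp only: avg_form_lin) simp
qed (simp add: avg_form_zero)

lemma avg_form_nonneg: "avg_form c c \<ge> 0"
  unfolding avg_form_def by (intro sum_nonneg) auto

text \<open>All summands are nonnegative, and the one of the identity element is the standard form
  over \<open>S\<close>.\<close>

lemma avg_form_definite:
  assumes fin: "finite (carrier W)" and z: "avg_form c c = 0" and r: "r \<in> S"
  shows "c r = 0"
proof -
  have "(\<Sum>r\<in>S. rho \<one> c r * rho \<one> c r) = 0"
    using z unfolding avg_form_def
    by (subst (asm) sum_nonneg_eq_0_iff) (auto intro: sum_nonneg fin)
  then have "c r * c r = 0" using r finS by (simp add: rho_one sum_nonneg_eq_0_iff)
  then show ?thesis by simp
qed

lemma avg_form_invariant:
  assumes "s \<in> S" shows "avg_form (gen a S s c) (gen a S s d) = avg_form c d"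
proof -
  have "bij_betw (\<lambda>w. w \<otimes> s) (carrier W) (carrier W)"
    using assms S_carrier by (intro bij_betw_byWitness[where f'="\<lambda>w. w \<otimes> s"]) (auto simp: mult_S_S)
  then have "avg_form c d = (\<Sum>w\<in>carrier W. \<Sum>r\<in>S. rho (w \<otimes> s) c r * rho (w \<otimes> s) d r)"
    unfolding avg_form_def by (rule sum.reindex_bij_betw[symmetric])
  also have "\<dots> = avg_form (gen a S s c) (gen a S s d)"
    unfolding avg_form_def using assms S_carrier by (intro sum.cong refl) (simp add: rho_mult rho_S)
  finally show ?thesis by simp
qed

text \<open>A generator preserves the form and negates its simple root, which determines its coroot
  in terms of the form.\<close>

lemma avg_form_reflection:
  assumes s: "s \<in> S" shows "colin a S s c * avg_form (coord s) (coord s) = 2 * avg_form c (coord s)"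
proof -
  have "avg_form c (coord s) = avg_form (gen a S s c) (\<lambda>r. - coord s r)"
    using avg_form_invariant[OF s, of c "coord s"] by (simp add: gen_coord_self s)
  also have "\<dots> = - avg_form (gen a S s c) (coord s)"
    using avg_form_lin[of "\<lambda>_. 0" "-1" "coord s" "gen a S s c"] by (simp add: avg_form_sym avg_form_zero)
  also have "avg_form (gen a S s c) (coord s) = avg_form c (coord s) - colin a S s c * avg_form (coord s) (coord s)"
    using avg_form_lin[of c "- colin a S s c" "coord s" "coord s"] by (simp add: gen_def)
  finally show ?thesis by simp
qed

lemma avg_form_coord_pos: "finite (carrier W) \<Longrightarrow> s \<in> S \<Longrightarrow> avg_form (coord s) (coord s) > 0"
  using avg_form_definite[of "coord s" s] avg_form_nonneg[of "coord s"] by (force simp: coord_def less_le)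

text \<open>A kernel vector is orthogonal to all simple roots, hence to itself, hence zero.\<close>

lemma finite_definite_kernel:
  assumes fin: "finite (carrier W)" shows "definite_kernel S a"
  unfolding definite_kernel_def
proof (intro allI impI disjI1 ballI)
  fix x s assume x: "\<forall>t\<in>S. colin a S t x = 0" and s: "s \<in> S"
  \<comment> \<open>The restriction of \<open>x\<close> to \<open>S\<close>, written as a
    combination of the simple roots so that bilinearity applies.\<close>
  define x' where "x' = (\<lambda>t. \<Sum>r\<in>S. x r * coord r t)"
  have x': "x' t = x t" if "t \<in> S" for t unfolding x'_def by (rule sum_coord'[OF finS that])
  have "colin a S t x' = 0" if "t \<in> S" for t using x that x' unfolding colin_def by simp
  then have "avg_form x' (coord t) = 0" if "t \<in> S" for t using avg_form_reflection[OF that, of x'] that by simp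
  then have "(\<Sum>r\<in>S. x r * avg_form (coord r) x') = 0" by (simp add: avg_form_sym)
  moreover have "avg_form x' x' = (\<Sum>r\<in>S. x r * avg_form (coord r) x')"
    using avg_form_sum[OF finS, of x coord x'] unfolding x'_def[symmetric] .
  ultimately show "x s \<ge> 0" using avg_form_definite[OF fin _ s, of x'] x'[OF s] by simp
qed

lemma product_determined:
  assumes "coxeter_matrix W S b" "s \<in> S" "t \<in> S" "s \<noteq> t" "ord (s \<otimes> t) \<noteq> 0"
  shows "a s t * a t s = b s t * b t s"
  using a_finite[OF assms(2-5)] coxeter_matrix.a_finite[OF assms] by simp

end

lemma finite_rescaled:
  assumes m: "coxeter_matrix W S a" "coxeter_matrix W S b" and fin: "finite (carrier W)"
  shows "rescaled S a b"
proof -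
  interpret ma: coxeter_matrix W S a by (rule m)
  interpret mb: coxeter_matrix W S b by (rule m)
  show ?thesis
  proof (rule rescaled_if_symmetrizable[where p="\<lambda>s t. ma.avg_form (coord s) (coord t)"
        and q="\<lambda>s t. mb.avg_form (coord s) (coord t)"])
    fix s t assume st: "s \<in> S" "t \<in> S"
    show "ma.avg_form (coord s) (coord s) > 0" "mb.avg_form (coord s) (coord s) > 0"
      using ma.avg_form_coord_pos mb.avg_form_coord_pos fin st by auto
    show "a s t * ma.avg_form (coord t) (coord t) = 2 * ma.avg_form (coord s) (coord t)"
      using ma.avg_form_reflection[OF st(2), of "coord s"] st by (simp add: colin_coord ma.finS)
    show "b s t * mb.avg_form (coord t) (coord t) = 2 * mb.avg_form (coord s) (coord t)"
      using mb.avg_form_reflection[OF st(2), of "coord s"] st by (simp add: colin_coord ma.finS)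
    show "ma.avg_form (coord s) (coord t) = ma.avg_form (coord t) (coord s)"
      "mb.avg_form (coord s) (coord t) = mb.avg_form (coord t) (coord s)"
      by (rule ma.avg_form_sym mb.avg_form_sym)+
    assume "s \<noteq> t"
    then show "a s t \<le> 0 \<and> b s t \<le> 0 \<and> a s t * a t s = b s t * b t s"
      using ma.a_nonpos mb.a_nonpos ma.product_determined[OF m(2) st]
        ma.ord_ge_1[OF fin, of "s \<otimes>\<^bsub>W\<^esub> t"] st ma.S_carrier by force
  qed
qed

section \<open>Graphs without cycles\<close>

text \<open>The hypothesis \<open>leaf\<close> states the absence of cycles: every nonempty set of
  vertices contains one with at most one neighbour in it. Removing this vertex leaves a smaller
  problem, and its scaling factor has to match a single edge.\<close>

lemma rescaled_if_forest:
  fixes a b :: "'g \<Rightarrow> 'g \<Rightarrow> real"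
  assumes fin: "finite S" and diag: "\<And>s. s \<in> S \<Longrightarrow> a s s = 2 \<and> b s s = 2"
    and neg: "\<And>s t. s \<in> S \<Longrightarrow> t \<in> S \<Longrightarrow> s \<noteq> t \<Longrightarrow> a s t \<le> 0 \<and> b s t \<le> 0 \<and> a s t * a t s = b s t * b t s"
    and zero: "\<And>s t. s \<in> S \<Longrightarrow> t \<in> S \<Longrightarrow> (a s t = 0 \<longleftrightarrow> a t s = 0) \<and> (b s t = 0 \<longleftrightarrow> b t s = 0)"
    and leaf: "\<And>X. X \<subseteq> S \<Longrightarrow> X \<noteq> {} \<Longrightarrow> \<exists>s\<in>X. \<forall>t\<in>X. \<forall>u\<in>X. t \<noteq> s \<longrightarrow> u \<noteq> s \<longrightarrow> a s t \<noteq> 0 \<longrightarrow> a s u \<noteq> 0 \<longrightarrow> t = u"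
  shows "rescaled S a b"
proof -
  have zab: "a s t = 0 \<longleftrightarrow> b s t = 0" if "s \<in> S" "t \<in> S" "s \<noteq> t" for s t
    using neg[OF that] zero[OF that(1,2)] by (metis mult_eq_0_iff)
  have "\<exists>d. (\<forall>s\<in>X. d s > 0) \<and> (\<forall>s\<in>X. \<forall>t\<in>X. a s t = d s / d t * b s t)" if "X \<subseteq> S" for X
    using finite_subset[OF that fin] that
  proof (induction X rule: finite_psubset_induct)
    case (psubset X)
    show ?case
    proof (cases "X = {}")
      case False
      then obtain s where s: "s \<in> X" "\<And>t u. t \<in> X \<Longrightarrow> u \<in> X \<Longrightarrow> t \<noteq> s \<Longrightarrow> u \<noteq> s \<Longrightarrow> a s t \<noteq> 0 \<Longrightarrow> a s u \<noteq> 0 \<Longrightarrow> t = u"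
        using leaf[OF psubset.prems] by blast
      have "X - {s} \<subset> X" "X - {s} \<subseteq> S" using s psubset.prems by auto
      then obtain d where d: "\<forall>s\<in>X - {s}. d s > 0" "\<forall>q\<in>X - {s}. \<forall>t\<in>X - {s}. a q t = d q / d t * b q t"
        using psubset.IH by meson
      obtain e where e: "e > 0" "\<forall>t\<in>X - {s}. a s t = e / d t * b s t \<and> a t s = d t / e * b t s"
      proof (cases "\<exists>t\<in>X - {s}. a s t \<noteq> 0")
        case True
        then obtain t where t: "t \<in> X" "t \<noteq> s" "a s t \<noteq> 0" by auto
        have tS: "t \<in> S" "s \<in> S" using t s psubset.prems by auto
        have dt: "d t > 0" using d t by simp
        have b0: "b s t \<noteq> 0" "b t s \<noteq> 0" "a t s \<noteq> 0" using zab zero[OF tS] t tS by metis+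
        have neg': "a s t < 0" "b s t < 0" using neg[of s t] tS t b0 by force+
        have pr: "a s t * a t s = b s t * b t s" using neg[of s t] tS t by auto
        \<comment> \<open>Chosen to match the entry from \<open>s\<close> to its neighbour; the
          reverse entry then matches because the products agree.\<close>
        define e where "e = d t * a s t / b s t"
        have e: "e > 0" unfolding e_def using dt neg' by (simp add: divide_neg_neg mult_pos_neg)
        have 1: "a s t = e / d t * b s t" using dt b0 by (simp add: e_def)
        have "d t / e * b t s = b s t * b t s / a s t" using dt b0 t by (simp add: e_def)
        also have "\<dots> = a t s" unfolding pr[symmetric] using t by simp
        finally have 2: "a t s = d t / e * b t s" by simp
        have "a s u = e / d u * b s u \<and> a u s = d u / e * b u s" if u: "u \<in> X - {s}" for u
        proof (cases "u = t")
          case False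
          then have "a s u = 0" using s(2)[of u t] u t by auto
          moreover have "u \<in> S" using u psubset.prems by auto
          ultimately have "a u s = 0" "b s u = 0" "b u s = 0" using zab[of s u] zero[of s u] u tS by auto
          then show ?thesis using \<open>a s u = 0\<close> by simp
        qed (use 1 2 in simp)
        then show thesis using that e by blast
      next
        case False
        have "a s u = 1 / d u * b s u \<and> a u s = d u / 1 * b u s" if u: "u \<in> X - {s}" for u
        proof -
          have "a s u = 0" "u \<in> S" "s \<in> S" using False u psubset.prems s by auto
          then have "a u s = 0" "b s u = 0" "b u s = 0" using zab[of s u] zero[of s u] u by auto
          then show ?thesis using \<open>a s u = 0\<close> by simp
        qed
        then show thesis using that[of 1] by simp
      qed
      have ss: "a s s = b s s" using diag s psubset.prems by auto
      define d' where "d' = d(s := e)"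
      have "\<forall>q\<in>X. d' q > 0" using d(1) e(1) by (simp add: d'_def)
      moreover have "a q t = d' q / d' t * b q t" if "q \<in> X" "t \<in> X" for q t
        using d(2) e ss that by (cases "q = s"; cases "t = s") (auto simp: d'_def)
      ultimately show ?thesis by blast
    qed simp
  qed
  then show ?thesis unfolding rescaled_def by blast
qed

text \<open>A walk that never turns back must revisit a vertex of the finite set, and the first
  repetition closes a cycle. It has at least three vertices since there are neither loops nor
  immediate returns. The cycle may still have chords.\<close>

lemma cycle_if_no_leaf:
  assumes fin: "finite X" and ne: "X \<noteq> {}" and irr: "\<And>s. \<not> E s s"
    and deg: "\<And>s. s \<in> X \<Longrightarrow> \<exists>t\<in>X. \<exists>u\<in>X. t \<noteq> u \<and> E s t \<and> E s u"
  obtains \<sigma> and K :: nat where "K \<ge> 3" "inj_on \<sigma> {..<K}" "\<sigma> ` {..<K} \<subseteq> X"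
    "\<And>k. Suc k < K \<Longrightarrow> E (\<sigma> k) (\<sigma> (Suc k))" "E (\<sigma> (K - 1)) (\<sigma> 0)"
proof -
  have "\<exists>n\<in>X. E c n \<and> n \<noteq> p" if "c \<in> X" for p c using deg[OF that] by metis
  then have ex: "\<exists>n. n \<in> X \<and> E c n \<and> n \<noteq> p" if "c \<in> X" for p c using that by blast
  define nx where "nx p c = (SOME n. n \<in> X \<and> E c n \<and> n \<noteq> p)" for p c
  have nx: "nx p c \<in> X \<and> E c (nx p c) \<and> nx p c \<noteq> p" if "c \<in> X" for p c
    unfolding nx_def by (rule someI_ex[OF ex[OF that]])
  obtain x0 where x0: "x0 \<in> X" using ne by blast
  \<comment> \<open>The state is the pair of the previous and the current vertex, so that the next
    step can avoid the previous one.\<close>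
  define P where "P = rec_nat (x0, nx x0 x0) (\<lambda>_ (p, c). (c, nx p c))"
  define w where "w i = fst (P i)" for i
  have P0: "P 0 = (x0, nx x0 x0)" and PS: "P (Suc i) = (snd (P i), nx (fst (P i)) (snd (P i)))" for i
    by (simp_all add: P_def case_prod_beta)
  have PX: "fst (P i) \<in> X \<and> snd (P i) \<in> X \<and> E (fst (P i)) (snd (P i))" for i
    by (induction i) (use nx x0 in \<open>auto simp: P0 PS\<close>)
  have wX: "w i \<in> X" and wE: "E (w i) (w (Suc i))" and w2: "w (Suc (Suc i)) \<noteq> w i" for i
    using PX[of i] nx[of "snd (P i)" "fst (P i)"] by (auto simp: w_def PS)
  have "\<not> inj w" using fin wX by (meson finite_subset image_subsetI infinite_iff_countable_subset)
  then have ex: "\<exists>j. \<exists>i<j. w i = w j" unfolding inj_def by (metis linorder_neqE_nat)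
  define j where "j = (LEAST j. \<exists>i<j. w i = w j)"
  obtain i where i: "i < j" "w i = w j" using LeastI_ex[OF ex] unfolding j_def by blast
  have min: "w k \<noteq> w l" if "k < l" "l < j" for k l
    using not_less_Least[of l "\<lambda>j. \<exists>i<j. w i = w j"] that unfolding j_def by blast
  define K where "K = j - i"
  have "K \<noteq> 1" "K \<noteq> 2"
  proof -
    show "K \<noteq> 1"
    proof
      assume "K = 1"
      then have "j = Suc i" using i K_def by simp
      then show False using wE[of i] i irr by simp
    qed
    show "K \<noteq> 2"
    proof
      assume "K = 2"
      then have "j = Suc (Suc i)" using i K_def by simp
      then show False using w2[of i] i by simp
    qed
  qed
  then have K: "K \<ge> 3" using i K_def by linarith
  define \<sigma> where "\<sigma> k = w (i + k)" for k
  have "inj_on \<sigma> {..<K}"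
  proof (rule inj_onI, rule ccontr)
    fix k l assume kl: "k \<in> {..<K}" "l \<in> {..<K}" "\<sigma> k = \<sigma> l" "k \<noteq> l"
    then have "i + k < j" "i + l < j" "w (i + k) = w (i + l)" using K_def by (auto simp: \<sigma>_def)
    then show False using min[of "i + k" "i + l"] min[of "i + l" "i + k"] kl(4)
      by (cases "k < l") (auto simp: not_less)
  qed
  moreover have "E (\<sigma> (K - 1)) (\<sigma> 0)"
  proof -
    have "Suc (i + (K - 1)) = j" using i K_def by simp
    then show ?thesis using wE[of "i + (K - 1)"] i by (simp add: \<sigma>_def)
  qed
  ultimately show thesis using that[OF K, of \<sigma>] wX wE by (auto simp: \<sigma>_def)
qed

section \<open>Affine Weyl groups\<close>

text \<open>For m at least 2 the angle pi / m lies in [0, pi / 2], where the cosine is nonnegative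
  and injective, so a product below 4 determines the order.\<close>

lemma (in coxeter_matrix) ord_if_product:
  assumes st: "s \<in> S" "t \<in> S" "s \<noteq> t"
  shows "a s t * a t s = 0 \<Longrightarrow> ord (s \<otimes> t) = 2" "a s t * a t s = 1 \<Longrightarrow> ord (s \<otimes> t) = 3"
proof -
  have *: "ord (s \<otimes> t) = n" if p: "a s t * a t s = c" "c < 4" and n: "4 * (cos (pi / real n))\<^sup>2 = c" "n \<ge> 2" for c n
  proof -
    define m where "m = ord (s \<otimes> t)"
    have m0: "m \<noteq> 0" using a_infinite[OF st] p m_def by auto
    then have m2: "m \<ge> 2" using ord_S_S[OF st] m_def by linarith
    have "a s t * a t s = 4 * (cos (pi / m))\<^sup>2" using a_finite[OF st] m0 unfolding m_def by blast
    then have "4 * (cos (pi / real m))\<^sup>2 = 4 * (cos (pi / real n))\<^sup>2" unfolding n(1) p(1) by (rule sym)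
    then have sq: "(cos (pi / real m))\<^sup>2 = (cos (pi / real n))\<^sup>2" by (rule mult_left_cancel[THEN iffD1, rotated]) simp
    have r: "0 \<le> pi / real k \<and> pi / real k \<le> pi / 2" if "k \<ge> 2" for k
      using that by (intro conjI frac_le) auto
    have cn: "cos (pi / real k) \<ge> 0" if "k \<ge> 2" for k
      using r[OF that] pi_ge_zero by (intro cos_ge_zero) linarith+
    have "cos (pi / m) = cos (pi / n)" by (rule power2_eq_imp_eq[OF sq cn[OF m2] cn[OF n(2)]])
    moreover have "0 \<le> pi / real k" "pi / real k \<le> pi" if "k \<ge> 2" for k
      using r[OF that] pi_ge_zero by linarith+
    ultimately have "pi / real m = pi / real n" using cos_inj_pi m2 n(2) by blast
    then have "real m = real n" using m0 n(2) by (simp add: divide_eq_eq eq_divide_eq)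
    then show ?thesis by (simp add: m_def)
  qed
  show "a s t * a t s = 0 \<Longrightarrow> ord (s \<otimes> t) = 2" using *[of 0 2] by simp
  show "a s t * a t s = 1 \<Longrightarrow> ord (s \<otimes> t) = 3" using *[of 1 3] by (simp add: cos_60 power2_eq_square)
qed

text \<open>The bound on \<open>card S\<close> sets the infinite dihedral group aside: its two
  extended simple roots are opposite, with product 4, while in higher rank all products are at most
  3.\<close>

locale affine_weyl = coxeter W S for W :: "('g, 'b) monoid_scheme" (structure) and S +
  fixes R \<Delta> :: "'e::euclidean_space set" and \<theta> :: 'e and f :: "'g \<Rightarrow> 'e \<Rightarrow> 'e"
  assumes weyl: "weyl_root_system R" and simple: "simple_system R \<Delta>" and highest: "highest_root R \<Delta> \<theta>"
    and iso: "coxeter_iso f W S (affine_weyl_group R) (affine_simple_reflections \<Delta> \<theta>)"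
    and rank: "card S \<ge> 3"
begin

section \<open>The finite root system and its highest root\<close>

lemma R_nonzero: "a \<in> R \<Longrightarrow> a \<noteq> 0"
  and R_multiple: "a \<in> R \<Longrightarrow> c *\<^sub>R a \<in> R \<longleftrightarrow> c = 1 \<or> c = -1"
  and R_reflect: "a \<in> R \<Longrightarrow> b \<in> R \<Longrightarrow> b - (2 * (b \<bullet> a) / (a \<bullet> a)) *\<^sub>R a \<in> R"
  and R_integral: "a \<in> R \<Longrightarrow> b \<in> R \<Longrightarrow> 2 * (b \<bullet> a) / (a \<bullet> a) \<in> \<int>"
  and R_finite: "finite R"
  using weyl by (auto simp: weyl_root_system_def)

lemma R_neg: "a \<in> R \<Longrightarrow> - a \<in> R"
  using R_multiple[of a "-1"] by simp

lemma simple_R: "a \<in> \<Delta> \<Longrightarrow> a \<in> R" and simple_indep: "independent \<Delta>"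
  and simple_cone: "a \<in> R \<Longrightarrow> a \<in> cone_of \<Delta> \<or> - a \<in> cone_of \<Delta>"
  using simple by (auto simp: simple_system_def)

lemma simple_finite: "finite \<Delta>"
  using R_finite simple_R by (meson finite_subset subsetI)

lemma theta_R: "\<theta> \<in> R" and theta_cone: "a \<in> R \<Longrightarrow> \<theta> - a \<in> cone_of \<Delta>"
  using highest by (auto simp: highest_root_def)

lemma cone_coefficients:
  assumes "v \<in> cone_of \<Delta>" shows "\<exists>c. (\<forall>x\<in>\<Delta>. c x \<ge> 0) \<and> v = (\<Sum>x\<in>\<Delta>. c x *\<^sub>R x)"
proof -
  obtain F c where F: "finite F" "F \<subseteq> \<Delta>" "\<forall>z\<in>F. c z \<ge> 0" "v = (\<Sum>z\<in>F. c z *\<^sub>R z)"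
    using assms by (rule cone_of_elim)
  have "v = (\<Sum>z\<in>\<Delta>. (if z \<in> F then c z else 0) *\<^sub>R z)"
    unfolding F(4) using F simple_finite by (intro sum.mono_neutral_cong_left) auto
  then show ?thesis using F by (intro exI[of _ "\<lambda>z. if z \<in> F then c z else 0"]) auto
qed

lemma coefficients_zero:
  assumes "(\<Sum>x\<in>\<Delta>. c x *\<^sub>R x) = 0" "x \<in> \<Delta>" shows "c x = 0"
  using simple_indep assms dependent_finite[OF simple_finite] by blast

lemma coefficients_unique:
  assumes "(\<Sum>x\<in>\<Delta>. c x *\<^sub>R x) = (\<Sum>x\<in>\<Delta>. d x *\<^sub>R x)" "x \<in> \<Delta>" shows "c x = d x"
  using coefficients_zero[of "\<lambda>x. c x - d x" x] assms by (simp add: scaleR_left_diff_distrib sum_subtractf)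

lemma sum_single: "a \<in> \<Delta> \<Longrightarrow> (\<Sum>x\<in>\<Delta>. (if x = a then k else 0) *\<^sub>R x) = k *\<^sub>R a"
  using simple_finite by (simp add: if_distrib[of "\<lambda>k. k *\<^sub>R _"] cong: if_cong)

text \<open>Reflecting \<open>a\<close> in \<open>b\<close> gives a root with coefficient 1 at
  \<open>a\<close> and - n at \<open>b\<close>; for n > 0 these would have opposite signs.\<close>

lemma simple_nonpos:
  assumes a: "a \<in> \<Delta>" and b: "b \<in> \<Delta>" and ab: "a \<noteq> b" shows "a \<bullet> b \<le> 0"
proof -
  define n where "n = 2 * (a \<bullet> b) / (b \<bullet> b)"
  define c where "c x = (if x = a then 1 else 0) + (if x = b then - n else 0)" for x
  have v: "a - n *\<^sub>R b = (\<Sum>x\<in>\<Delta>. c x *\<^sub>R x)"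
    by (simp add: c_def scaleR_left_distrib sum.distrib sum_single a b)
  have "a - n *\<^sub>R b \<in> R" unfolding n_def using R_reflect simple_R a b by blast
  then have "n \<le> 0"
  proof (rule simple_cone[THEN disjE])
    assume "a - n *\<^sub>R b \<in> cone_of \<Delta>"
    then obtain d where "\<forall>x\<in>\<Delta>. d x \<ge> 0" "a - n *\<^sub>R b = (\<Sum>x\<in>\<Delta>. d x *\<^sub>R x)" using cone_coefficients by blast
    then have "c b \<ge> 0" using coefficients_unique[of c d b] v b by simp
    then show ?thesis using ab by (simp add: c_def)
  next
    assume "- (a - n *\<^sub>R b) \<in> cone_of \<Delta>"
    then obtain d where d: "\<forall>x\<in>\<Delta>. d x \<ge> 0" "- (a - n *\<^sub>R b) = (\<Sum>x\<in>\<Delta>. d x *\<^sub>R x)" using cone_coefficients by blast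
    have "(\<Sum>x\<in>\<Delta>. (- c x) *\<^sub>R x) = (\<Sum>x\<in>\<Delta>. d x *\<^sub>R x)" using d(2) v by (simp add: sum_negf)
    then have "- c a \<ge> 0" using coefficients_unique[of "\<lambda>x. - c x" d a] d(1) a by simp
    then show ?thesis using ab by (simp add: c_def)
  qed
  moreover have "b \<bullet> b > 0" using R_nonzero simple_R b by simp
  ultimately show ?thesis by (simp add: n_def divide_le_0_iff)
qed

lemma theta_coefficients: "\<exists>c. (\<forall>x\<in>\<Delta>. c x \<ge> 1) \<and> \<theta> = (\<Sum>x\<in>\<Delta>. c x *\<^sub>R x)"
proof -
  \<comment> \<open>This is \<theta> - (- \<theta>) and provides some expansion of \<theta>; the
    bound 1 comes afterwards from \<theta> - b for each simple b.\<close>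
  have "2 *\<^sub>R \<theta> \<in> cone_of \<Delta>" using theta_cone[OF R_neg[OF theta_R]] by (simp add: scaleR_2)
  then obtain c where c: "2 *\<^sub>R \<theta> = (\<Sum>x\<in>\<Delta>. c x *\<^sub>R x)" using cone_coefficients by blast
  have th: "\<theta> = (\<Sum>x\<in>\<Delta>. (c x / 2) *\<^sub>R x)"
    using arg_cong[OF c, of "\<lambda>v. (1/2) *\<^sub>R v"] by (simp add: scaleR_sum_right)
  have le: "c b / 2 \<ge> 1" if b: "b \<in> \<Delta>" for b
  proof -
    obtain d where d: "\<forall>x\<in>\<Delta>. d x \<ge> 0" "\<theta> - b = (\<Sum>x\<in>\<Delta>. d x *\<^sub>R x)"
      using cone_coefficients theta_cone simple_R b by blast
    have "(\<Sum>x\<in>\<Delta>. (d x + (if x = b then 1 else 0)) *\<^sub>R x) = \<theta> - b + b"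
      unfolding d(2) by (simp add: scaleR_left_distrib sum.distrib sum_single b)
    then have "c b / 2 = d b + 1" using coefficients_unique[of "\<lambda>x. c x / 2" "\<lambda>x. d x + (if x = b then 1 else 0)" b] th b by simp
    then show ?thesis using d b by simp
  qed
  show ?thesis by (intro exI[of _ "\<lambda>x. c x / 2"] conjI ballI le th)
qed

text \<open>Subtracting the reflected root from \<theta> leaves n times the simple root, which lies
  in the cone because \<theta> is highest.\<close>

lemma theta_simple_nonneg:
  assumes a: "a \<in> \<Delta>" shows "\<theta> \<bullet> a \<ge> 0"
proof -
  define n where "n = 2 * (\<theta> \<bullet> a) / (a \<bullet> a)"
  have "\<theta> - n *\<^sub>R a \<in> R" unfolding n_def using R_reflect theta_R simple_R a by blast
  then have "n *\<^sub>R a \<in> cone_of \<Delta>" using theta_cone by fastforce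
  then obtain d where d: "\<forall>x\<in>\<Delta>. d x \<ge> 0" "n *\<^sub>R a = (\<Sum>x\<in>\<Delta>. d x *\<^sub>R x)" using cone_coefficients by blast
  have "n = d a" using coefficients_unique[of "\<lambda>x. if x = a then n else 0" d a] d(2) a by (simp add: sum_single)
  then have "n \<ge> 0" using d a by simp
  moreover have "a \<bullet> a > 0" using R_nonzero simple_R a by simp
  ultimately show ?thesis by (simp add: n_def zero_le_divide_iff)
qed

section \<open>The extended simple roots\<close>

definition ext_simple :: "'e set" where "ext_simple = insert (- \<theta>) \<Delta>"

text \<open>The reflection in the hyperplane of \<theta> at level 1 is the one of - \<theta> at
  level - 1. With - \<theta> in place of \<theta>, all inner products of distinct extended simple
  roots are at most 0.\<close>

definition level :: "'e \<Rightarrow> int" where "level e = (if e = - \<theta> then - 1 else 0)"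

lemma neg_theta_notin: "- \<theta> \<notin> \<Delta>"
proof
  assume m: "- \<theta> \<in> \<Delta>"
  obtain c where c: "\<forall>x\<in>\<Delta>. c x \<ge> 1" "\<theta> = (\<Sum>x\<in>\<Delta>. c x *\<^sub>R x)" using theta_coefficients by blast
  have "(\<Sum>x\<in>\<Delta>. (c x + (if x = - \<theta> then 1 else 0)) *\<^sub>R x) = \<theta> + 1 *\<^sub>R (- \<theta>)"
    unfolding c(2) by (simp add: scaleR_left_distrib sum.distrib sum_single m flip: c(2))
  then have "c (- \<theta>) + 1 = 0" using coefficients_zero[of "\<lambda>x. c x + (if x = - \<theta> then 1 else 0)" "- \<theta>"] m by simp
  then show False using c(1) m by force
qed

lemma ext_simple_R: "e \<in> ext_simple \<Longrightarrow> e \<in> R"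
  using simple_R R_neg[OF theta_R] by (auto simp: ext_simple_def)

lemma ext_simple_nonpos: "e \<in> ext_simple \<Longrightarrow> e' \<in> ext_simple \<Longrightarrow> e \<noteq> e' \<Longrightarrow> e \<bullet> e' \<le> 0"
  using simple_nonpos theta_simple_nonneg by (auto simp: ext_simple_def inner_commute[of _ "\<theta>"])

lemma affine_reflection_neg: "affine_reflection (- a) (- k) = affine_reflection a k"
proof
  fix x
  have "x \<bullet> (- a) - of_int (- k) = - (x \<bullet> a - of_int k)" by simp
  then show "affine_reflection (- a) (- k) x = affine_reflection a k x" unfolding affine_reflection_def
    by (simp only: inner_minus_left inner_minus_right minus_minus mult_minus_left scaleR_minus_left scaleR_minus_right)
qed

lemma affine_simple_reflections_eq:
  "affine_simple_reflections \<Delta> \<theta> = (\<lambda>e. affine_reflection e (level e)) ` ext_simple"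
proof -
  have "affine_reflection (- \<theta>) (- 1) = affine_reflection \<theta> 1" by (rule affine_reflection_neg)
  moreover have "level e = 0" if "e \<in> \<Delta>" for e using that neg_theta_notin by (auto simp: level_def)
  ultimately show ?thesis unfolding affine_simple_reflections_def ext_simple_def
    by (auto simp: level_def[of "- \<theta>"])
qed

text \<open>The image of 0 separates the affine reflection from the linear ones, and independence of
  \<Delta> separates the linear ones from each other.\<close>

lemma affine_reflection_inj: "inj_on (\<lambda>e. affine_reflection e (level e)) ext_simple"
proof (rule inj_onI, rule ccontr)
  fix e e' assume e: "e \<in> ext_simple" "e' \<in> ext_simple" "e \<noteq> e'"
    "affine_reflection e (level e) = affine_reflection e' (level e')"
  have nz: "e \<noteq> 0" "e' \<noteq> 0" using ext_simple_R R_nonzero e by auto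
  have "affine_reflection e (level e) 0 = affine_reflection e' (level e') 0" using e(4) by simp
  then have l: "(level e * (2 / (e \<bullet> e))) *\<^sub>R e = (level e' * (2 / (e' \<bullet> e'))) *\<^sub>R e'"
    by (simp add: affine_reflection_def)
  have "level e = level e'" using l nz by (auto simp: level_def split: if_splits)
  then have "level e = 0" "level e' = 0" using e(3) by (auto simp: level_def split: if_splits)
  then have D: "e \<in> \<Delta>" "e' \<in> \<Delta>" using e(1,2) by (auto simp: ext_simple_def level_def)
  have "affine_reflection e (level e) e = affine_reflection e' (level e') e" using e(4) by simp
  moreover have "affine_reflection e (level e) e = - e"
    using nz \<open>level e = 0\<close> by (simp add: affine_reflection_def scaleR_2)
  moreover define X where "X = (e \<bullet> e' * (2 / (e' \<bullet> e'))) *\<^sub>R e'"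
  have "affine_reflection e' (level e') e = e - X"
    using \<open>level e' = 0\<close> by (simp add: affine_reflection_def X_def)
  ultimately have "e - X = - e" by simp
  have "X = e - (e - X)" by simp
  also have "\<dots> = 2 *\<^sub>R e" unfolding \<open>e - X = - e\<close> by (simp add: scaleR_2)
  finally have "2 *\<^sub>R e = (e \<bullet> e' * (2 / (e' \<bullet> e'))) *\<^sub>R e'" unfolding X_def by (rule sym)
  then have "(\<Sum>x\<in>\<Delta>. (if x = e then 2 else 0) *\<^sub>R x)
      = (\<Sum>x\<in>\<Delta>. (if x = e' then e \<bullet> e' * (2 / (e' \<bullet> e')) else 0) *\<^sub>R x)" using D by (simp only: sum_single)
  from coefficients_unique[OF this D(1)] e(3) show False by simp
qed

lemma affine_reflection_Bij: "a \<noteq> 0 \<Longrightarrow> affine_reflection a k \<in> Bij UNIV"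
proof -
  assume a: "a \<noteq> 0"
  have "affine_reflection a k (affine_reflection a k x) = x" for x
  proof -
    define d where "d = (x \<bullet> a - of_int k) * (2 / (a \<bullet> a))"
    have "d * (a \<bullet> a) = 2 * (x \<bullet> a - of_int k)" using a by (simp add: d_def)
    then have e: "(x - d *\<^sub>R a) \<bullet> a - of_int k = - (x \<bullet> a - of_int k)" by (simp add: inner_diff_left)
    have "((x - d *\<^sub>R a) \<bullet> a - of_int k) * (2 / (a \<bullet> a)) = - d"
      unfolding e by (simp only: d_def mult_minus_left)
    then show ?thesis unfolding affine_reflection_def d_def[symmetric] by simp
  qed
  then have "bij (affine_reflection a k)" by (intro o_bij[of "affine_reflection a k"]) (auto simp: fun_eq_iff)
  then show ?thesis by (simp add: Bij_def)
qed

lemma affine_weyl_group_iso: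
  "f \<in> iso W (BijGroup UNIV\<lparr>carrier := carrier (affine_weyl_group R)\<rparr>)" "carrier (affine_weyl_group R) \<subseteq> Bij UNIV"
proof -
  show "f \<in> iso W (BijGroup UNIV\<lparr>carrier := carrier (affine_weyl_group R)\<rparr>)"
    using iso by (simp add: coxeter_iso_def affine_weyl_group_def)
  have "generate (BijGroup UNIV) {affine_reflection a k | a k. a \<in> R} \<subseteq> carrier (BijGroup UNIV)"
    using affine_reflection_Bij R_nonzero by (intro group.generate_incl group_BijGroup) (auto simp: BijGroup_def)
  then show "carrier (affine_weyl_group R) \<subseteq> Bij UNIV" by (simp add: affine_weyl_group_def BijGroup_def)
qed

lemmas f_mult = iso_into_Bij_mult[OF is_group affine_weyl_group_iso, OF _ _ UNIV_I]
  and f_one = iso_into_Bij_one[OF is_group affine_weyl_group_iso UNIV_I]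
  and f_faithful = iso_into_Bij_faithful[OF is_group affine_weyl_group_iso]

definition er :: "'g \<Rightarrow> 'e" where
  "er s = the_inv_into ext_simple (\<lambda>e. affine_reflection e (level e)) (f s)"

lemma f_image_S: "f ` S = (\<lambda>e. affine_reflection e (level e)) ` ext_simple"
  using iso affine_simple_reflections_eq by (simp add: coxeter_iso_def)

lemma er: "s \<in> S \<Longrightarrow> er s \<in> ext_simple" "s \<in> S \<Longrightarrow> f s = affine_reflection (er s) (level (er s))"
proof -
  assume "s \<in> S"
  then have m: "f s \<in> (\<lambda>e. affine_reflection e (level e)) ` ext_simple" using f_image_S by blast
  show "er s \<in> ext_simple" unfolding er_def by (rule the_inv_into_into[OF affine_reflection_inj m subset_refl])
  show "f s = affine_reflection (er s) (level (er s))"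
    unfolding er_def using f_the_inv_into_f[OF affine_reflection_inj m] by simp
qed

lemma er_bij: "bij_betw er S ext_simple"
proof (rule bij_betw_imageI)
  have inj: "inj_on f (carrier W)" using affine_weyl_group_iso(1) by (auto simp: iso_def bij_betw_def)
  show "inj_on er S"
  proof (rule inj_onI)
    fix s t assume "s \<in> S" "t \<in> S" "er s = er t"
    then show "s = t" using er(2) S_carrier inj_onD[OF inj] by metis
  qed
  show "er ` S = ext_simple"
  proof
    show "ext_simple \<subseteq> er ` S"
    proof
      fix e assume e: "e \<in> ext_simple"
      then have "affine_reflection e (level e) \<in> f ` S" unfolding f_image_S by (rule imageI)
      then obtain s where s: "affine_reflection e (level e) = f s" "s \<in> S" by (rule imageE)
      have "er s = e" unfolding er_def s(1)[symmetric] by (rule the_inv_into_f_f[OF affine_reflection_inj e])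
      then show "e \<in> er ` S" using s by blast
    qed
  qed (use er in auto)
qed

lemma er_R: "s \<in> S \<Longrightarrow> er s \<in> R" and er_nonzero: "s \<in> S \<Longrightarrow> er s \<noteq> 0"
  using er ext_simple_R R_nonzero by auto

lemma er_neq: "s \<in> S \<Longrightarrow> t \<in> S \<Longrightarrow> s \<noteq> t \<Longrightarrow> er s \<noteq> er t"
  using er_bij by (auto simp: bij_betw_def inj_on_def)

lemma er_nonpos: "s \<in> S \<Longrightarrow> t \<in> S \<Longrightarrow> s \<noteq> t \<Longrightarrow> er s \<bullet> er t \<le> 0"
  using ext_simple_nonpos er er_neq by blast

text \<open>The only relation among the extended simple roots is the one expressing \<open>\<theta>\<close>, all of whose
  coefficients are positive.\<close>

lemma er_relation:
  assumes rel: "(\<Sum>s\<in>S. x s *\<^sub>R er s) = 0"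
  shows "(\<forall>s\<in>S. x s > 0) \<or> (\<forall>s\<in>S. x s < 0) \<or> (\<forall>s\<in>S. x s = 0)"
proof -
  define y where "y = x \<circ> the_inv_into S er"
  have inj: "inj_on er S" and im: "er ` S = ext_simple" using er_bij by (auto simp: bij_betw_def)
  have y: "y (er s) = x s" if "s \<in> S" for s using that by (simp add: y_def the_inv_into_f_f[OF inj])
  obtain c where c: "\<forall>x\<in>\<Delta>. c x \<ge> 1" "\<theta> = (\<Sum>x\<in>\<Delta>. c x *\<^sub>R x)" using theta_coefficients by blast
  have "(\<Sum>e\<in>ext_simple. y e *\<^sub>R e) = 0"
    unfolding im[symmetric] using rel by (simp add: sum.reindex[OF inj] y)
  then have "(\<Sum>e\<in>\<Delta>. y e *\<^sub>R e) = y (- \<theta>) *\<^sub>R \<theta>"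
    unfolding ext_simple_def using simple_finite neg_theta_notin by simp
  also have "\<dots> = (\<Sum>e\<in>\<Delta>. (y (- \<theta>) * c e) *\<^sub>R e)" by (subst c(2)) (simp add: scaleR_sum_right)
  finally have ye: "y e = y (- \<theta>) * c e" if "e \<in> \<Delta>" for e using coefficients_unique[of y "\<lambda>e. y (- \<theta>) * c e" e] that by blast
  have "(\<forall>e\<in>ext_simple. y e > 0) \<or> (\<forall>e\<in>ext_simple. y e < 0) \<or> (\<forall>e\<in>ext_simple. y e = 0)"
  proof -
    have cpos: "c e > 0" if "e \<in> \<Delta>" for e using c(1) that by force
    consider "y (- \<theta>) > 0" | "y (- \<theta>) < 0" | "y (- \<theta>) = 0" by linarith
    then show ?thesis
    proof cases
      case 1
      then show ?thesis using ye cpos by (auto simp: ext_simple_def)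
    next
      case 2
      then show ?thesis using ye cpos by (auto simp: ext_simple_def mult_neg_pos)
    next
      case 3
      then show ?thesis using ye by (auto simp: ext_simple_def)
    qed
  qed
  then show ?thesis unfolding im[symmetric] using y by auto
qed

text \<open>Equality in Cauchy-Schwarz makes two distinct extended simple roots opposite. Their sum
  is then a relation that involves only two of at least three roots, whereas a nontrivial relation
  involves all of them.\<close>

lemma er_strict:
  assumes s: "s \<in> S" and t: "t \<in> S" and st: "s \<noteq> t"
  shows "(er s \<bullet> er t)\<^sup>2 < (er s \<bullet> er s) * (er t \<bullet> er t)"
proof (rule ccontr)
  assume "\<not> ?thesis"
  then have "(er s \<bullet> er t)\<^sup>2 = (er s \<bullet> er s) * (er t \<bullet> er t)" using Cauchy_Schwarz_ineq[of "er s" "er t"] by simp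
  moreover define v where "v = (er s \<bullet> er s) *\<^sub>R er t - (er s \<bullet> er t) *\<^sub>R er s"
  have "v \<bullet> v = (er s \<bullet> er s) * ((er s \<bullet> er s) * (er t \<bullet> er t) - (er s \<bullet> er t)\<^sup>2)"
    unfolding v_def inner_diff_left inner_diff_right inner_scaleR_left inner_scaleR_right inner_commute[of "er t" "er s"]
    by (simp add: power2_eq_square algebra_simps)
  ultimately have "v = 0" by simp
  then have k: "(er s \<bullet> er s) *\<^sub>R er t = (er s \<bullet> er t) *\<^sub>R er s" by (simp add: v_def)
  have "er t = (1 / (er s \<bullet> er s)) *\<^sub>R ((er s \<bullet> er s) *\<^sub>R er t)" using er_nonzero[OF s] by simp
  then have kt: "er t = ((er s \<bullet> er t) / (er s \<bullet> er s)) *\<^sub>R er s" unfolding k by simp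
  then have "((er s \<bullet> er t) / (er s \<bullet> er s)) *\<^sub>R er s \<in> R" using er_R[OF t] by simp
  then have "(er s \<bullet> er t) / (er s \<bullet> er s) = 1 \<or> (er s \<bullet> er t) / (er s \<bullet> er s) = - 1"
    using R_multiple[OF er_R[OF s]] by blast
  then have "er t = er s \<or> er t = - er s" by (metis kt scaleR_minus1_left scaleR_one)
  then have "er s + er t = 0" using er_neq[OF s t st] by auto
  define x where "x r = (if r = s then 1 else 0) + (if r = t then 1 else 0 :: real)" for r
  have "(\<Sum>r\<in>S. x r *\<^sub>R er r) = er s + er t"
    using s t by (simp add: x_def scaleR_left_distrib sum.distrib finS if_distrib[of "\<lambda>k. k *\<^sub>R _"] cong: if_cong)
  with er_relation[of x] \<open>er s + er t = 0\<close> have "(\<forall>s\<in>S. x s > 0) \<or> (\<forall>s\<in>S. x s < 0) \<or> (\<forall>s\<in>S. x s = 0)" by simp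
  moreover have "x s > 0" by (simp add: x_def)
  moreover have "\<exists>r\<in>S. r \<noteq> s \<and> r \<noteq> t"
  proof (rule ccontr)
    assume "\<not> ?thesis"
    then have "S \<subseteq> {s, t}" by auto
    then have "card S \<le> card {s, t}" by (intro card_mono) auto
    then show False using rank card_insert_le_m1[of 2 "{t}" s] by simp
  qed
  then have "\<exists>r\<in>S. x r = 0" by (auto simp: x_def)
  ultimately show False using s by fastforce
qed

section \<open>The Cartan matrix of the extended simple roots\<close>

definition cm :: "'g \<Rightarrow> 'g \<Rightarrow> real" where
  "cm s t = 2 * (er s \<bullet> er t) / (er t \<bullet> er t)"

text \<open>The product is an integer, nonnegative, and below 4 by the strict Cauchy-Schwarz
  inequality.\<close>

lemma cm_product:
  assumes s: "s \<in> S" and t: "t \<in> S" and st: "s \<noteq> t"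
  shows "cm s t * cm t s \<in> {0, 1, 2, 3}"
proof -
  have "cm s t \<in> \<int>" "cm t s \<in> \<int>" unfolding cm_def using R_integral er_R s t by blast+
  then obtain n where n: "cm s t * cm t s = of_int n" by (metis Ints_cases Ints_mult)
  have pos: "er s \<bullet> er s > 0" "er t \<bullet> er t > 0" using er_nonzero s t by auto
  have e: "cm s t * cm t s = 4 * ((er s \<bullet> er t)\<^sup>2 / ((er s \<bullet> er s) * (er t \<bullet> er t)))"
    by (simp add: cm_def power2_eq_square inner_commute[of "er t" "er s"])
  have "(er s \<bullet> er t)\<^sup>2 / ((er s \<bullet> er s) * (er t \<bullet> er t)) < 1"
    using er_strict[OF s t st] pos by simp
  moreover have "(er s \<bullet> er t)\<^sup>2 / ((er s \<bullet> er s) * (er t \<bullet> er t)) \<ge> 0" using pos by simp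
  ultimately have "0 \<le> cm s t * cm t s" "cm s t * cm t s < 4" unfolding e by linarith+
  then have "0 \<le> n" "n < 4" unfolding n by auto
  then have "n = 0 \<or> n = 1 \<or> n = 2 \<or> n = 3" by linarith
  then show ?thesis unfolding n by auto
qed

definition aff :: "'g \<Rightarrow> 'e \<Rightarrow> real" where
  "aff s x = (x \<bullet> er s - of_int (level (er s))) * (2 / (er s \<bullet> er s))"

lemma f_S: "s \<in> S \<Longrightarrow> f s x = x - aff s x *\<^sub>R er s"
  by (simp add: er(2) affine_reflection_def aff_def)

lemma aff_add: "s \<in> S \<Longrightarrow> t \<in> S \<Longrightarrow> aff s (x + l *\<^sub>R er t) = aff s x + l * cm t s"
  using er_nonzero by (simp add: aff_def cm_def inner_add_left field_simps)

lemma cm_diag: "s \<in> S \<Longrightarrow> cm s s = 2"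
  using er_nonzero by (simp add: cm_def)

lemma f_pow:
  assumes s: "s \<in> S" and t: "t \<in> S"
  shows "f ((s \<otimes> t) [^] (k::nat)) v =
    v + fst ((dstep (aff s v) (aff t v) (cm s t) (cm t s) ^^ k) (0, 0)) *\<^sub>R er s
      + snd ((dstep (aff s v) (aff t v) (cm s t) (cm t s) ^^ k) (0, 0)) *\<^sub>R er t"
    (is "_ = v + fst (?D k) *\<^sub>R er s + snd (?D k) *\<^sub>R er t")
proof (induction k)
  case 0
  then show ?case by (simp add: f_one)
next
  case (Suc k)
  note c = S_carrier[OF s] S_carrier[OF t]
  obtain P Q where PQ: "?D k = (P, Q)" by fastforce
  define Q' where "Q' = - Q - aff t v - P * cm s t"
  have D: "?D (Suc k) = (- P - aff s v - Q' * cm t s, Q')"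
    using PQ by (simp add: dstep_def Q'_def Let_def)
  have "f t (v + P *\<^sub>R er s + Q *\<^sub>R er t) = v + P *\<^sub>R er s + (Q - (aff t v + P * cm s t + Q * cm t t)) *\<^sub>R er t"
    by (simp add: f_S t s aff_add scaleR_left_diff_distrib)
  then have 1: "f t (v + P *\<^sub>R er s + Q *\<^sub>R er t) = v + P *\<^sub>R er s + Q' *\<^sub>R er t"
    by (simp add: Q'_def cm_diag[OF t] algebra_simps)
  have "f s (v + P *\<^sub>R er s + Q' *\<^sub>R er t)
      = v + (P - (aff s v + P * cm s s + Q' * cm t s)) *\<^sub>R er s + Q' *\<^sub>R er t"
    by (simp add: f_S t s aff_add scaleR_left_diff_distrib)
  also have "P - (aff s v + P * cm s s + Q' * cm t s) = - P - aff s v - Q' * cm t s"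
    by (simp add: cm_diag[OF s])
  finally have 2: "f s (v + P *\<^sub>R er s + Q' *\<^sub>R er t)
      = v + (- P - aff s v - Q' * cm t s) *\<^sub>R er s + Q' *\<^sub>R er t" .
  have "f ((s \<otimes> t) [^] Suc k) v = f s (f t (f ((s \<otimes> t) [^] k) v))"
    using c by (subst nat_pow_Suc2) (simp_all add: m_assoc f_mult del: nat_pow_Suc)
  also have "f ((s \<otimes> t) [^] k) v = v + P *\<^sub>R er s + Q *\<^sub>R er t" using Suc unfolding PQ fst_conv snd_conv .
  finally show ?case unfolding D fst_conv snd_conv 1 2 .
qed

lemma cm_zero: "s \<in> S \<Longrightarrow> t \<in> S \<Longrightarrow> cm s t = 0 \<longleftrightarrow> cm t s = 0"
  using er_nonzero by (simp add: cm_def inner_commute)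

text \<open>The group consists of affine maps. The upper bound for the order holds for the orbit of
  any point; the lower bound is seen at a common fixed point displaced by a root.\<close>

lemma cm_order:
  assumes s: "s \<in> S" and t: "t \<in> S" and st: "s \<noteq> t" and m: "cm s t * cm t s = 4 * (cos (pi / real m))\<^sup>2" "m \<ge> 2"
  shows "ord (s \<otimes> t) = m"
proof -
  have stW: "s \<otimes> t \<in> carrier W" using s t S_carrier by auto
  have "(s \<otimes> t) [^] m = \<one>"
  proof (rule f_faithful)
    fix v show "f ((s \<otimes> t) [^] m) v = v"
      by (simp add: f_pow[OF s t] dstep_order[OF m cm_zero[OF s t]])
  qed (use stW in simp)
  then have "ord (s \<otimes> t) dvd m" using pow_eq_id[OF stW] by simp
  moreover have "m dvd ord (s \<otimes> t)"
  proof -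
    define p q r where "p = er s \<bullet> er s" and "q = er t \<bullet> er t" and "r = er s \<bullet> er t"
    have pos: "p > 0" "q > 0" using er_nonzero s t by (auto simp: p_def q_def)
    have d: "p * q - r\<^sup>2 > 0" using er_strict[OF s t st] by (simp add: p_def q_def r_def)
    define ks kt :: real where "ks = level (er s)" and "kt = level (er t)"
    \<comment> \<open>The coefficients of the point \<open>y\<close> in the span of the two roots
      that lies on both hyperplanes. They solve the Gram system, whose determinant is positive by
      \<open>er_strict\<close>. Adding \<open>er s\<close> to \<open>y\<close> produces exactly the
      offsets of a root.\<close>
    define A B where "A = (ks * q - kt * r) / (p * q - r\<^sup>2)" and "B = (kt * p - ks * r) / (p * q - r\<^sup>2)"
    define y where "y = A *\<^sub>R er s + B *\<^sub>R er t"
    have "y \<bullet> er s = A * p + B * r" "y \<bullet> er t = A * r + B * q"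
      unfolding y_def p_def q_def r_def by (simp_all only: inner_add_left inner_scaleR_left inner_commute[of "er t" "er s"])
    moreover have "A * p + B * r = ks"
    proof -
      have "A * p + B * r = ((ks * q - kt * r) * p + (kt * p - ks * r) * r) / (p * q - r\<^sup>2)"
        by (simp add: A_def B_def add_divide_distrib)
      also have "(ks * q - kt * r) * p + (kt * p - ks * r) * r = ks * (p * q - r\<^sup>2)"
        by (simp add: algebra_simps power2_eq_square)
      finally show ?thesis using d by simp
    qed
    moreover have "A * r + B * q = kt"
    proof -
      have "A * r + B * q = ((ks * q - kt * r) * r + (kt * p - ks * r) * q) / (p * q - r\<^sup>2)"
        by (simp add: A_def B_def add_divide_distrib)
      also have "(ks * q - kt * r) * r + (kt * p - ks * r) * q = kt * (p * q - r\<^sup>2)"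
        by (simp add: algebra_simps power2_eq_square)
      finally show ?thesis using d by simp
    qed
    ultimately have "aff s y = 0" "aff t y = 0" by (auto simp: aff_def ks_def kt_def)
    then have af: "aff s (y + 1 *\<^sub>R er s) = 2" "aff t (y + 1 *\<^sub>R er s) = cm s t"
      unfolding aff_add[OF s s] aff_add[OF t s] by (auto simp: cm_diag s)
    obtain P Q where PQ: "(dstep 2 (cm s t) (cm s t) (cm t s) ^^ ord (s \<otimes> t)) (0, 0) = (P, Q)" by fastforce
    have "(s \<otimes> t) [^] ord (s \<otimes> t) = \<one>" using pow_ord_eq_1[OF stW] .
    then have "P *\<^sub>R er s + Q *\<^sub>R er t = 0"
      using f_pow[OF s t, of "ord (s \<otimes> t)" "y + 1 *\<^sub>R er s"] unfolding af PQ by (simp add: f_one add.assoc)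
    then have "(P *\<^sub>R er s + Q *\<^sub>R er t) \<bullet> er s = 0" "(P *\<^sub>R er s + Q *\<^sub>R er t) \<bullet> er t = 0" by simp_all
    then have eqs: "P * p + Q * r = 0" "P * r + Q * q = 0"
      unfolding p_def q_def r_def by (simp_all only: inner_add_left inner_scaleR_left inner_commute[of "er t" "er s"])
    have "P * (p * q - r\<^sup>2) = (P * p + Q * r) * q - (P * r + Q * q) * r" "Q * (p * q - r\<^sup>2) = (P * r + Q * q) * p - (P * p + Q * r) * r"
      by (auto simp: algebra_simps power2_eq_square)
    then have "P = 0" "Q = 0" using eqs d by auto
    then show ?thesis using dstep_order_conv[OF m cm_zero[OF s t]] PQ by simp
  qed
  ultimately show ?thesis by (rule dvd_antisym)
qed

lemma cm_cartan: "cartan W S cm"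
  unfolding cartan_def
proof (intro conjI ballI impI)
  fix s t assume s: "s \<in> S" and t: "t \<in> S" and st: "s \<noteq> t"
  show "cm s t \<le> 0" using er_nonpos[OF s t st] er_nonzero[OF t] by (simp add: cm_def divide_le_0_iff)
  have "\<exists>m\<ge>2. cm s t * cm t s = 4 * (cos (pi / real m))\<^sup>2"
  proof -
    consider "cm s t * cm t s = 0" | "cm s t * cm t s = 1" | "cm s t * cm t s = 2" | "cm s t * cm t s = 3"
      using cm_product[OF s t st] by blast
    then show ?thesis
    proof cases
      case 1 then show ?thesis by (intro exI[of _ 2]) simp
    next
      case 2 then show ?thesis by (intro exI[of _ 3]) (simp add: cos_60 power2_eq_square)
    next
      case 3 then show ?thesis by (intro exI[of _ 4]) (simp add: cos_45 power_divide)
    next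
      case 4 then show ?thesis by (intro exI[of _ 6]) (simp add: cos_30 power_divide)
    qed
  qed
  then obtain m where m: "m \<ge> 2" "cm s t * cm t s = 4 * (cos (pi / real m))\<^sup>2" by blast
  have "ord (s \<otimes> t) = m" by (rule cm_order[OF s t st m(2,1)])
  then show "if ord (s \<otimes> t) = 0 then cm s t * cm t s \<ge> 4
       else cm s t * cm t s = 4 * (cos (pi / real (ord (s \<otimes> t))))\<^sup>2"
    using m by simp
qed (auto simp: cm_diag cm_zero)

text \<open>A kernel vector gives a combination of extended simple roots that is orthogonal to all
  of them, hence zero, so its coefficients form a relation and have one sign.\<close>

lemma cm_definite_kernel: "definite_kernel S cm"
  unfolding definite_kernel_def
proof (intro allI impI)
  fix x assume x: "\<forall>t\<in>S. colin cm S t x = 0"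
  define v where "v = (\<Sum>s\<in>S. x s *\<^sub>R er s)"
  have "v \<bullet> er t = 0" if t: "t \<in> S" for t
  proof -
    have "colin cm S t x = (2 / (er t \<bullet> er t)) * (v \<bullet> er t)"
      by (simp add: colin_def cm_def v_def inner_sum_left sum_distrib_left algebra_simps)
    then show ?thesis using x t er_nonzero[OF t] by simp
  qed
  then have "v \<bullet> v = 0" by (subst (2) v_def) (simp add: inner_sum_right)
  then show "(\<forall>s\<in>S. x s \<ge> 0) \<or> (\<forall>s\<in>S. x s \<le> 0)" using er_relation[of x] by (force simp: v_def)
qed

text \<open>The normalized extended simple roots of a cycle have a sum of norm zero.\<close>

lemma cycle_type_A_tilde:
  assumes K: "K \<ge> 3" and inj: "inj_on \<sigma> {..<K}" and sub: "\<sigma> ` {..<K} \<subseteq> S"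
    and adj: "\<And>k. Suc k < K \<Longrightarrow> cm (\<sigma> k) (\<sigma> (Suc k)) \<noteq> 0" "cm (\<sigma> (K - 1)) (\<sigma> 0) \<noteq> 0"
  shows "type_A_tilde (K - 1) W S"
proof -
  define nx where "nx k = (if Suc k = K then 0 else Suc k)" for k
  define pv where "pv k = (if k = 0 then K - 1 else k - 1)" for k
  have nxpv: "nx k < K" "pv k < K" "nx k \<noteq> k" "pv k \<noteq> k" "pv k \<noteq> nx k" "nx (pv k) = k" if "k < K" for k
    using that K by (auto simp: nx_def pv_def)
  have \<sigma>S: "\<sigma> k \<in> S" if "k < K" for k using sub that by auto
  have \<sigma>_neq: "\<sigma> k \<noteq> \<sigma> l" if "k < K" "l < K" "k \<noteq> l" for k l using inj that by (auto simp: inj_on_def)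
  define u where "u k = (1 / norm (er (\<sigma> k))) *\<^sub>R er (\<sigma> k)" for k
  define g where "g k l = u k \<bullet> u l" for k l
  have g_sym: "g k l = g l k" for k l by (simp add: g_def inner_commute)
  have g_self: "g k k = 1" if "k < K" for k
    using er_nonzero[OF \<sigma>S[OF that]] by (simp add: g_def u_def dot_square_norm power2_eq_square)
  have g_nonpos: "g k l \<le> 0" if "k < K" "l < K" "k \<noteq> l" for k l
    using er_nonpos[OF \<sigma>S \<sigma>S \<sigma>_neq] that by (simp add: g_def u_def divide_le_0_iff)
  have g_cm: "4 * (g k l)\<^sup>2 = cm (\<sigma> k) (\<sigma> l) * cm (\<sigma> l) (\<sigma> k)" for k l
    by (simp add: g_def u_def cm_def power2_eq_square dot_square_norm inner_commute)
  \<comment> \<open>A nonzero product is at least 1 by integrality, and it is 4 times the squared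
    cosine.\<close>
  have g_adj: "g k l \<le> - 1/2" if "k < K" "l < K" "k \<noteq> l" "cm (\<sigma> k) (\<sigma> l) \<noteq> 0" for k l
  proof (rule ccontr)
    assume "\<not> g k l \<le> - 1/2"
    then have "\<bar>g k l\<bar> < 1/2" using g_nonpos[OF that(1-3)] by simp
    then have "(g k l)\<^sup>2 < (1/2)\<^sup>2" using power2_strict_mono[of "g k l" "1/2"] by simp
    then have "cm (\<sigma> k) (\<sigma> l) * cm (\<sigma> l) (\<sigma> k) < 1" using g_cm[of k l] by (simp add: power2_eq_square)
    then have "cm (\<sigma> k) (\<sigma> l) * cm (\<sigma> l) (\<sigma> k) = 0"
      using cm_product[OF \<sigma>S[OF that(1)] \<sigma>S[OF that(2)] \<sigma>_neq[OF that(1-3)]] by auto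
    then show False using that(4) cm_zero[OF \<sigma>S[OF that(1)] \<sigma>S[OF that(2)]] by auto
  qed
  have gn: "g k (nx k) \<le> - 1/2" if "k < K" for k
  proof (rule g_adj[OF that nxpv(1)[OF that] nxpv(3)[OF that, symmetric]])
    have "k = K - 1" if "Suc k = K" using that by simp
    then show "cm (\<sigma> k) (\<sigma> (nx k)) \<noteq> 0" using adj that by (auto simp: nx_def)
  qed
  have gp: "g k (pv k) \<le> - 1/2" if "k < K" for k
    using gn[OF nxpv(2)[OF that]] nxpv(6)[OF that] g_sym by simp
  define rest where "rest k = {..<K} - {k, nx k, pv k}" for k
  have row: "(\<Sum>l<K. g k l) = 1 + g k (nx k) + g k (pv k) + (\<Sum>l\<in>rest k. g k l)" if k: "k < K" for k
  proof -
    have "{..<K} = {k, nx k, pv k} \<union> rest k" using nxpv[OF k] k by (auto simp: rest_def)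
    then have "(\<Sum>l<K. g k l) = (\<Sum>l\<in>{k, nx k, pv k}. g k l) + (\<Sum>l\<in>rest k. g k l)"
      by (metis (no_types, lifting) Diff_disjoint finite.emptyI finite_Diff finite_insert finite_lessThan rest_def sum.union_disjoint)
    then show ?thesis using nxpv[OF k] g_self[OF k] by auto
  qed
  have rest0: "(\<Sum>l\<in>rest k. g k l) \<le> 0" if "k < K" for k
    using g_nonpos that by (intro sum_nonpos) (auto simp: rest_def)
  \<comment> \<open>The diagonal entry 1 is cancelled by two neighbours with at most - 1/2 each. The
    sum of all rows is a squared norm, so every estimate is an equality; this fixes the neighbouring
    entries and excludes chords.\<close>
  have row_le: "(\<Sum>l<K. g k l) \<le> 0" if "k < K" for k
    using row[OF that] gn[OF that] gp[OF that] rest0[OF that] by linarith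
  define U where "U = (\<Sum>k<K. u k)"
  have UU: "U \<bullet> U = (\<Sum>k<K. \<Sum>l<K. g k l)"
    unfolding U_def g_def inner_sum_left inner_sum_right by (rule sum.swap)
  then have U0: "U \<bullet> U = 0" using row_le sum_nonpos[of "{..<K}" "\<lambda>k. \<Sum>l<K. g k l"] inner_ge_zero[of U] by force
  have row0: "(\<Sum>l<K. g k l) = 0" if "k < K" for k
  proof -
    have "(\<Sum>k<K. - (\<Sum>l<K. g k l)) = 0" using UU U0 by (simp add: sum_negf)
    then have "\<forall>k\<in>{..<K}. - (\<Sum>l<K. g k l) = 0" using row_le by (subst (asm) sum_nonneg_eq_0_iff) auto
    then show ?thesis using that by simp
  qed
  have exact: "g k (nx k) = - 1/2" "(\<Sum>l\<in>rest k. g k l) = 0" if "k < K" for k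
    using row[OF that] row0[OF that] gn[OF that] gp[OF that] rest0[OF that] by linarith+
  have g0: "g k l = 0" if "k < K" "l < K" "k \<noteq> l" "l \<noteq> nx k" "k \<noteq> nx l" for k l
  proof -
    have "l \<in> rest k" using that nxpv(6)[OF that(1)] by (auto simp: rest_def)
    moreover have "(\<Sum>l\<in>rest k. - g k l) = 0" using exact(2)[OF that(1)] by (simp add: sum_negf)
    moreover have "\<forall>l\<in>rest k. - g k l \<ge> 0" using g_nonpos that(1) by (auto simp: rest_def)
    ultimately show ?thesis by (subst (asm) sum_nonneg_eq_0_iff) (auto simp: rest_def)
  qed
  have "S = \<sigma> ` {..<K}"
  proof -
    \<comment> \<open>The vanishing sum as a relation among all extended simple roots: it is
      positive on the cycle, hence nonzero everywhere, so no vertex lies outside the cycle.\<close>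
    define x where "x s = (if s \<in> \<sigma> ` {..<K} then 1 / norm (er s) else 0)" for s
    have "(\<Sum>s\<in>S. x s *\<^sub>R er s) = (\<Sum>s\<in>\<sigma> ` {..<K}. (1 / norm (er s)) *\<^sub>R er s)"
      using sub finS by (intro sum.mono_neutral_cong_right) (auto simp: x_def)
    also have "\<dots> = U" by (simp add: sum.reindex[OF inj] U_def u_def)
    finally have rel: "(\<Sum>s\<in>S. x s *\<^sub>R er s) = 0" using U0 by simp
    have "\<sigma> 0 \<in> S" "x (\<sigma> 0) > 0" using \<sigma>S[of 0] K er_nonzero[of "\<sigma> 0"] by (auto simp: x_def)
    then have "\<forall>s\<in>S. x s > 0" using er_relation[OF rel] by force
    then show ?thesis using sub by (auto simp: x_def split: if_splits)
  qed
  then have bij: "bij_betw \<sigma> {..K - 1} S" using inj K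
    by (simp add: bij_betw_def lessThan_Suc_atMost[symmetric] Suc_diff_Suc)
  interpret m: coxeter_matrix W S cm by unfold_locales (rule cm_cartan)
  have "ord (\<sigma> i \<otimes> \<sigma> j) = (if j = (i + 1) mod (K - 1 + 1) \<or> i = (j + 1) mod (K - 1 + 1) then 3 else 2)"
    if "i \<le> K - 1" "j \<le> K - 1" "i \<noteq> j" for i j
  proof -
    have ij: "i < K" "j < K" using that K by auto
    have nx: "(k + 1) mod (K - 1 + 1) = nx k" if "k < K" for k using that K by (auto simp: nx_def)
    show ?thesis
    proof (cases "j = nx i \<or> i = nx j")
      case True
      then have "g i j = - 1/2" using exact(1) ij g_sym by metis
      then have "cm (\<sigma> i) (\<sigma> j) * cm (\<sigma> j) (\<sigma> i) = 1" using g_cm[of i j] by (simp add: power2_eq_square)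
      then show ?thesis using m.ord_if_product(2)[OF \<sigma>S[OF ij(1)] \<sigma>S[OF ij(2)] \<sigma>_neq[OF ij that(3)]] True nx ij by auto
    next
      case False
      then have "g i j = 0" using g0 ij that by blast
      then have "cm (\<sigma> i) (\<sigma> j) * cm (\<sigma> j) (\<sigma> i) = 0" using g_cm[of i j] by simp
      then show ?thesis using m.ord_if_product(1)[OF \<sigma>S[OF ij(1)] \<sigma>S[OF ij(2)] \<sigma>_neq[OF ij that(3)]] False nx ij by auto
    qed
  qed
  then show ?thesis unfolding type_A_tilde_def using bij K by (intro conjI exI[of _ \<sigma>]) auto
qed

lemma rescaled_or_type_A_tilde:
  assumes m: "coxeter_matrix W S a"
  shows "rescaled S a cm \<or> (\<exists>n\<ge>2. type_A_tilde n W S)"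
proof (rule disjCI)
  assume notA: "\<not> (\<exists>n\<ge>2. type_A_tilde n W S)"
  interpret ma: coxeter_matrix W S a by (rule m)
  interpret mc: coxeter_matrix W S cm by unfold_locales (rule cm_cartan)
  \<comment> \<open>Since the products of \<open>cm\<close> are below 4, all orders are finite, and
    finite orders determine the products of any matrix.\<close>
  have prod: "a s t * a t s = cm s t * cm t s" if st: "s \<in> S" "t \<in> S" "s \<noteq> t" for s t
  proof -
    have "ord (s \<otimes> t) \<noteq> 0"
    proof
      assume "ord (s \<otimes> t) = 0"
      then have "cm s t * cm t s \<ge> 4" by (rule mc.a_infinite[OF st])
      moreover have "cm s t * cm t s \<le> 3" using cm_product[OF st] by auto
      ultimately show False by linarith
    qed
    then show ?thesis using ma.product_determined[OF _ st] mc.coxeter_matrix_axioms by blast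
  qed
  show "rescaled S a cm"
  proof (rule rescaled_if_forest[OF finS])
    fix X assume X: "X \<subseteq> S" "X \<noteq> {}"
    show "\<exists>s\<in>X. \<forall>t\<in>X. \<forall>u\<in>X. t \<noteq> s \<longrightarrow> u \<noteq> s \<longrightarrow> a s t \<noteq> 0 \<longrightarrow> a s u \<noteq> 0 \<longrightarrow> t = u"
    proof (rule ccontr)
      assume no: "\<not> ?thesis"
      define E where "E s t \<longleftrightarrow> t \<noteq> s \<and> a s t \<noteq> 0" for s t
      have "finite X" using X finS finite_subset by blast
      moreover have "\<exists>t\<in>X. \<exists>u\<in>X. t \<noteq> u \<and> E s t \<and> E s u" if "s \<in> X" for s
        using no that unfolding E_def by blast
      ultimately obtain \<sigma> and K :: nat where \<sigma>: "K \<ge> 3" "inj_on \<sigma> {..<K}" "\<sigma> ` {..<K} \<subseteq> X"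
        "\<And>k. Suc k < K \<Longrightarrow> E (\<sigma> k) (\<sigma> (Suc k))" "E (\<sigma> (K - 1)) (\<sigma> 0)"
        using cycle_if_no_leaf[of X E] X(2) E_def by metis
      have E: "cm s t \<noteq> 0" if "E s t" "s \<in> S" "t \<in> S" for s t
        using that prod[of s t] ma.a_zero[of s t] unfolding E_def by (metis mult_eq_0_iff)
      have "type_A_tilde (K - 1) W S"
      proof (rule cycle_type_A_tilde[OF \<sigma>(1,2)])
        show "\<sigma> ` {..<K} \<subseteq> S" using \<sigma>(3) X by blast
        show "cm (\<sigma> k) (\<sigma> (Suc k)) \<noteq> 0" if "Suc k < K" for k
        proof (rule E[OF \<sigma>(4)[OF that]])
          have "\<sigma> ` {..<K} \<subseteq> S" "k \<in> {..<K}" "Suc k \<in> {..<K}" using that \<sigma>(3) X(1) by auto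
          then show "\<sigma> k \<in> S" "\<sigma> (Suc k) \<in> S" by blast+
        qed
        show "cm (\<sigma> (K - 1)) (\<sigma> 0) \<noteq> 0"
        proof (rule E[OF \<sigma>(5)])
          have "\<sigma> ` {..<K} \<subseteq> S" "0 \<in> {..<K}" "K - 1 \<in> {..<K}" using \<sigma>(1,3) X(1) by auto
          then show "\<sigma> (K - 1) \<in> S" "\<sigma> 0 \<in> S" by blast+
        qed
      qed
      moreover have "K - 1 \<ge> 2" using \<sigma>(1) by simp
      ultimately show False using notA by blast
    qed
  qed (use ma.a_diag cm_diag ma.a_nonpos mc.a_nonpos ma.a_zero cm_zero prod in auto)
qed

end

section \<open>Cyclic matrices and quasi-periodic functions\<close>

context coxeter_matrix
begin

text \<open>The signed reflection does not determine the pair \<open>(w, s)\<close>, only the ray of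
  its root.\<close>

lemma ev_same_sr:
  assumes g: "w \<in> carrier W" "s \<in> S" "w' \<in> carrier W" "s' \<in> S" and eq: "sr w s = sr w' s'"
  shows "\<exists>l>0. \<forall>x. ev x (w', s') = l * ev x (w, s)"
proof -
  have refl: "w \<otimes> s \<otimes> inv w = w' \<otimes> s' \<otimes> inv w'" and len_iff: "len w < len (w \<otimes> s) \<longleftrightarrow> len w' < len (w' \<otimes> s')"
    using eq by (auto simp: sr_def split: if_splits)
  obtain l where l: "rho w' (coord s') = (\<lambda>r. l * rho w (coord s) r)"
    using proportional_if_same_reflection[OF g(1,3,2,4) refl] by blast
  obtain r where r: "r \<in> S" "rho w' (coord s') r \<noteq> 0" using root_nonzero[OF g(3,4)] by blast
  have "l > 0"
  proof (cases "len w < len (w \<otimes> s)")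
    case True
    then have "rho w (coord s) r \<ge> 0" "rho w' (coord s') r \<ge> 0" using root_pos g len_iff by blast+
    then show ?thesis using r(2) l by (auto simp: zero_le_mult_iff less_le)
  next
    case False
    then have "rho w (coord s) r \<le> 0" "rho w' (coord s') r \<le> 0" using root_neg g len_iff by blast+
    then show ?thesis using r(2) l by (auto simp: mult_le_0_iff less_le)
  qed
  moreover have "ev x (w', s') = l * ev x (w, s)" for x
    by (simp add: ev_def l sum_distrib_left mult.assoc)
  ultimately show ?thesis by blast
qed

text \<open>\<open>Cl\<close> asks for some finite set of pairs with signed reflections in the given
  set. For the image of \<open>F\<close>, every such pair lies on the ray of an element of
  \<open>F\<close>, so \<open>F\<close> itself is a sufficient choice.\<close>

lemma sr_mem_Cl_iff:
  assumes F: "finite F" "F \<subseteq> carrier W \<times> S" and g: "w \<in> carrier W" "s \<in> S"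
  shows "sr w s \<in> Cl ((\<lambda>(w, s). sr w s) ` F) \<longleftrightarrow> (\<forall>x. (\<forall>h\<in>F. ev x h \<ge> 0) \<longrightarrow> ev x (w, s) \<ge> 0)"
proof -
  let ?A = "(\<lambda>(w, s). sr w s) ` F"
  have A: "?A \<in> Pow (reflections W S \<times> {1, - 1})"
  proof (rule PowI, rule image_subsetI)
    fix g assume "g \<in> F"
    then obtain w s where "g = (w, s)" "w \<in> carrier W" "s \<in> S" using F(2) by auto
    then show "(case g of (w, s) \<Rightarrow> sr w s) \<in> reflections W S \<times> {1, - 1}" using sr_range[of w s] by simp
  qed
  show ?thesis
  proof
    assume "sr w s \<in> Cl ?A"
    then obtain w' s' E where w': "sr w s = sr w' s'" "w' \<in> carrier W" "s' \<in> S"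
      and E: "E \<subseteq> carrier W \<times> S" "\<forall>(w', s')\<in>E. sr w' s' \<in> ?A" "\<forall>x. (\<forall>h\<in>E. ev x h \<ge> 0) \<longrightarrow> ev x (w', s') \<ge> 0"
      using A unfolding Cl_def by auto
    obtain l where l: "l > 0" "\<And>x. ev x (w, s) = l * ev x (w', s')"
      using ev_same_sr[OF w'(2,3) g w'(1)[symmetric]] by blast
    show "\<forall>x. (\<forall>h\<in>F. ev x h \<ge> 0) \<longrightarrow> ev x (w, s) \<ge> 0"
    proof (intro allI impI)
      fix x assume x: "\<forall>h\<in>F. ev x h \<ge> 0"
      have "ev x h \<ge> 0" if h: "h \<in> E" for h
      proof -
        obtain v r where v: "h = (v, r)" "v \<in> carrier W" "r \<in> S" using h E(1) by auto
        then have "sr v r \<in> ?A" using h E(2) by auto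
        then obtain v' r' where v': "(v', r') \<in> F" "sr v' r' = sr v r" by auto
        then obtain k where "k > 0" "\<And>x. ev x (v, r) = k * ev x (v', r')" using ev_same_sr[of v' r' v r] v F(2) by blast
        then show ?thesis using x v'(1) v(1) by auto
      qed
      then show "ev x (w, s) \<ge> 0" using E(3) l by simp
    qed
  next
    assume "\<forall>x. (\<forall>h\<in>F. ev x h \<ge> 0) \<longrightarrow> ev x (w, s) \<ge> 0"
    then show "sr w s \<in> Cl ?A"
      unfolding Cl_def restrict_apply'[OF A] using F g
      by (intro CollectI exI[of _ w] exI[of _ s] conjI exI[of _ F]) auto
  qed
qed

text \<open>The adjoint of a generator: the first letter of a word is moved from the root to the
  functional.\<close>

lemma ev_Cons_gen:
  assumes s: "s \<in> S"
  shows "(\<Sum>r\<in>S. gen a S s c r * x r) = (\<Sum>r\<in>S. c r * (x r - a r s * x s))"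
proof -
  have "(\<Sum>r\<in>S. gen a S s c r * x r) = (\<Sum>r\<in>S. c r * x r) - colin a S s c * (\<Sum>r\<in>S. coord s r * x r)"
    by (simp add: gen_def left_diff_distrib sum_subtractf sum_distrib_left mult.assoc)
  also have "\<dots> = (\<Sum>r\<in>S. c r * x r) - (\<Sum>r\<in>S. c r * (a r s * x s))"
    unfolding sum_coord[OF finS s] by (simp add: colin_def sum_distrib_right mult.assoc)
  finally show ?thesis by (simp add: right_diff_distrib sum_subtractf)
qed

end

text \<open>With \<open>e\<^bsub>i+N\<^esub> = q e\<^sub>i\<close>, the matrix of the simple roots \<open>e\<^sub>i - e\<^bsub>i+1\<^esub>\<close> (\<open>i < N\<close>) and of the coroots dual to them,
  for \<open>s\<^sub>i\<close> interchanging \<open>e\<^sub>i\<close> and \<open>e\<^bsub>i+1\<^esub>\<close>. For \<open>N = 2\<close> the two neighbours of an index coincide, and their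
  contributions add up.\<close>

definition cyc :: "real \<Rightarrow> nat \<Rightarrow> nat \<Rightarrow> nat \<Rightarrow> real" where
  "cyc q N i j = (if i = j then 2 else
     - ((if j = Suc i mod N then (if Suc i = N then q else 1) else 0) +
        (if i = Suc j mod N then (if Suc j = N then 1 / q else 1) else 0)))"

text \<open>The affine permutation \<open>s\<^sub>j\<close> of the integers.\<close>

definition sw :: "nat \<Rightarrow> nat \<Rightarrow> int \<Rightarrow> int" where
  "sw N j i = (if i mod int N = int j then i + 1 else if i mod int N = int (Suc j mod N) then i - 1 else i)"

text \<open>\<open>z\<close> lists the values of a functional at the e_i, of which only differences
  matter, and \<open>x\<close> its values at the simple roots.\<close>

definition diffs :: "nat \<Rightarrow> real \<Rightarrow> (int \<Rightarrow> real) \<Rightarrow> (nat \<Rightarrow> real) \<Rightarrow> bool" where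
  "diffs N q z x \<longleftrightarrow> (\<forall>k. \<forall>m<N. z (int m + int N * k) - z (int m + int N * k + 1) = x m * q powi k)"

lemma int_as_residue:
  assumes "N > 0" obtains m k where "m < N" "i = int m + int N * k"
proof
  show "nat (i mod int N) < N" using assms by (simp add: nat_less_iff)
  show "i = int (nat (i mod int N)) + int N * (i div int N)" using assms by simp
qed

lemma residue_mod: "m < N \<Longrightarrow> (int m + int N * k) mod int N = int m"
  by simp

text \<open>Permuting the e_i by s_j is the reflection given by column j of \<open>cyc\<close>; this
  is where the entries of that matrix come from.\<close>

lemma diffs_sw:
  assumes N: "N \<ge> 2" and q: "q > 0" and d: "diffs N q z x" and j: "j < N"
  shows "diffs N q (\<lambda>i. z (sw N j i)) (\<lambda>m. x m - cyc q N m j * x j)"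
  unfolding diffs_def
proof (intro allI impI)
  fix k m assume m: "m < N"
  define D where "D i = z i - z (i + 1)" for i
  have D: "D (int m + int N * k) = x m * q powi k" if "m < N" for m k
    using d that by (simp add: diffs_def D_def)
  define i where "i = int m + int N * k"
  have im: "i mod int N = int m" unfolding i_def by (rule residue_mod[OF m])
  have i1: "(i + 1) mod int N = int (Suc m mod N)"
  proof (cases "Suc m = N")
    case True
    then have "i + 1 = int N * (k + 1)" by (auto simp: i_def algebra_simps)
    then show ?thesis using True by simp
  next
    case False
    then have "Suc m < N" using m by simp
    then show ?thesis using residue_mod[of "Suc m" N k] by (simp add: i_def add.assoc add.commute)
  qed
  have inj: "Suc m mod N = Suc j mod N \<longleftrightarrow> m = j" using m j
    by (cases "Suc m = N"; cases "Suc j = N") auto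
  have z1: "z (sw N j i) = z i - (if m = j then D i else 0) + (if m = Suc j mod N then D (i - 1) else 0)"
  proof -
    have "\<not> (m = j \<and> m = Suc j mod N)" using N j by (cases "Suc j = N") auto
    then show ?thesis using im by (auto simp: sw_def D_def)
  qed
  have z2: "z (sw N j (i + 1)) = z (i + 1) - (if Suc m mod N = j then D (i + 1) else 0) + (if m = j then D i else 0)"
  proof -
    have "\<not> (Suc m mod N = j \<and> m = j)" using N j by (cases "Suc j = N") auto
    then show ?thesis using i1 inj by (auto simp: sw_def D_def algebra_simps)
  qed
  have "z (sw N j i) - z (sw N j (i + 1)) = D i - (if m = j then 2 * D i else 0)
      + (if m = Suc j mod N then D (i - 1) else 0) + (if Suc m mod N = j then D (i + 1) else 0)"
    unfolding z1 z2 by (simp add: D_def)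
  moreover have "D i = x m * q powi k" unfolding i_def by (rule D[OF m])
  \<comment> \<open>If \<open>Suc j = N\<close>, the neighbour j of class 0 lies in the preceding
    period, which costs a factor 1 / q; symmetrically, the upper neighbour of class N - 1 gains a
    factor q.\<close>
  moreover have "D (i - 1) = (if Suc j = N then 1 / q else 1) * (x j * q powi k)" if "m = Suc j mod N"
  proof (cases "Suc j = N")
    case True
    then have "i - 1 = int j + int N * (k - 1)" using that by (auto simp: i_def algebra_simps)
    then show ?thesis using True D[OF j, of "k - 1"] q by (simp add: power_int_diff)
  next
    case False
    then have "i - 1 = int j + int N * k" using that j by (simp add: i_def)
    then show ?thesis using False D[OF j, of k] by simp
  qed
  moreover have "D (i + 1) = (if Suc m = N then q else 1) * (x j * q powi k)" if "Suc m mod N = j"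
  proof (cases "Suc m = N")
    case True
    then have "i + 1 = int j + int N * (k + 1)" using that by (auto simp: i_def algebra_simps)
    then show ?thesis using True D[OF j, of "k + 1"] q by (simp add: power_int_add)
  next
    case False
    then have "i + 1 = int j + int N * k" using that m by (simp add: i_def)
    then show ?thesis using False D[OF j, of k] by simp
  qed
  ultimately have fin: "z (sw N j i) - z (sw N j (i + 1)) = x m * q powi k - (if m = j then 2 * (x m * q powi k) else 0)
      + (if m = Suc j mod N then (if Suc j = N then 1 / q else 1) * (x j * q powi k) else 0)
      + (if j = Suc m mod N then (if Suc m = N then q else 1) * (x j * q powi k) else 0)"
    by (cases "m = j"; cases "m = Suc j mod N"; cases "Suc m mod N = j") simp_all
  have "\<dots> = (x m - cyc q N m j * x j) * q powi k"
  proof (cases "m = j")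
    case True
    have "m \<noteq> Suc j mod N" "j \<noteq> Suc m mod N" using True N m by (cases "Suc j = N"; auto)+
    then show ?thesis using True by (simp add: cyc_def algebra_simps)
  next
    case False
    then show ?thesis unfolding cyc_def by (simp add: algebra_simps)
  qed
  then show "z (sw N j (int m + int N * k)) - z (sw N j (int m + int N * k + 1)) = (x m - cyc q N m j * x j) * q powi k"
    using fin unfolding i_def by (rule trans[rotated])
qed

lemma sw_shift: "sw N j (i + int N * k) = sw N j i + int N * k"
  by (simp add: sw_def)

lemma sw_mod_Suc:
  assumes "N \<ge> 2" "j < N" shows "(i + 1) mod int N = int (Suc j mod N) \<longleftrightarrow> i mod int N = int j"
proof -
  obtain m k where m: "m < N" "i = int m + int N * k" using int_as_residue[of N i] assms by auto
  have "i + 1 = int (Suc m) + int N * k" unfolding m(2) by simp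
  then have "(i + 1) mod int N = int (Suc m) mod int N" by (simp only: mod_mult_self2)
  then have "(i + 1) mod int N = int (Suc m mod N)" by (simp add: zmod_int)
  moreover have "Suc m mod N = Suc j mod N \<longleftrightarrow> m = j" using m(1) assms(2)
    by (cases "Suc m = N"; cases "Suc j = N") auto
  ultimately show ?thesis using m by simp
qed

lemma sw_sw:
  assumes "N \<ge> 2" "j < N" shows "sw N j (sw N j i) = i"
proof -
  have ne: "int j \<noteq> int (Suc j mod N)" using assms by (cases "Suc j = N") auto
  consider "i mod int N = int j" | "i mod int N = int (Suc j mod N)" | "i mod int N \<noteq> int j" "i mod int N \<noteq> int (Suc j mod N)" by blast
  then show ?thesis
  proof cases
    case 1
    then have "(i + 1) mod int N = int (Suc j mod N)" using sw_mod_Suc[OF assms, of i] by simp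
    then show ?thesis using 1 ne by (simp add: sw_def)
  next
    case 2
    then have "(i - 1) mod int N = int j" using sw_mod_Suc[OF assms, of "i - 1"] by simp
    then show ?thesis using 2 ne by (simp add: sw_def)
  qed (simp add: sw_def)
qed

lemma sw_incongruent:
  assumes "N \<ge> 2" "j < N" "i mod int N \<noteq> i' mod int N" shows "sw N j i mod int N \<noteq> sw N j i' mod int N"
proof
  assume "sw N j i mod int N = sw N j i' mod int N"
  then obtain k where "sw N j i = sw N j i' + int N * k" by (metis mod_eqE add.commute diff_add_cancel mult.commute)
  then have "sw N j (sw N j i) = sw N j (sw N j i') + int N * k" by (simp add: sw_shift)
  then have "i = i' + int N * k" by (simp add: sw_sw assms)
  then show False using assms(3) by simp
qed

text \<open>For q = 1 the simple roots of one period add up to e_0 - e_N, which has to be allowed a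
  nonzero value; the summand \<tau> provides it, so that a functional stays free on all N simple
  roots.\<close>

definition quasi :: "nat \<Rightarrow> real \<Rightarrow> (int \<Rightarrow> real) \<Rightarrow> bool" where
  "quasi N q z \<longleftrightarrow> (if q = 1 then \<exists>\<tau>. \<forall>i. z (i + int N) = z i + \<tau> else \<forall>i. z (i + int N) = q * z i)"

lemma int_shift_induct:
  assumes "\<And>i. P i \<longleftrightarrow> P (i + 1)" "P (0::int)" shows "P k"
proof (induction k rule: int_induct[of _ 0])
  case (step1 i) then show ?case using assms(1)[of i] by simp
next
  case (step2 i) then show ?case using assms(1)[of "i - 1"] by simp
qed (rule assms(2))

lemma diffs_if_quasi:
  assumes q: "q > 0" and z: "quasi N q z"
  shows "diffs N q z (\<lambda>m. z (int m) - z (int m + 1))"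
  unfolding diffs_def
proof (intro allI impI)
  fix k m
  have step: "z (i + int N) - z (i + int N + 1) = q * (z i - z (i + 1))" for i
  proof -
    have e: "i + int N + 1 = (i + 1) + int N" by simp
    show ?thesis
    proof (cases "q = 1")
      case True
      then obtain \<tau> where "\<forall>i. z (i + int N) = z i + \<tau>" using z by (auto simp: quasi_def)
      then show ?thesis unfolding e using True by simp
    next
      case False
      then have "\<forall>i. z (i + int N) = q * z i" using z by (auto simp: quasi_def)
      then show ?thesis unfolding e by (simp only: right_diff_distrib)
    qed
  qed
  show "z (int m + int N * k) - z (int m + int N * k + 1) = (z (int m) - z (int m + 1)) * q powi k"
  proof (induction k rule: int_shift_induct)
    fix k
    have "int m + int N * (k + 1) = (int m + int N * k) + int N" by (simp add: algebra_simps)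
    then have "z (int m + int N * (k + 1)) - z (int m + int N * (k + 1) + 1)
        = q * (z (int m + int N * k) - z (int m + int N * k + 1))" using step by metis
    moreover have "q powi (k + 1) = q * q powi k" using q by (simp add: power_int_add)
    ultimately show "z (int m + int N * k) - z (int m + int N * k + 1) = (z (int m) - z (int m + 1)) * q powi k \<longleftrightarrow>
        z (int m + int N * (k + 1)) - z (int m + int N * (k + 1) + 1) = (z (int m) - z (int m + 1)) * q powi (k + 1)"
      using q by auto
  qed simp
qed

lemma quasi_exists:
  assumes N: "N \<ge> 2" and q: "q > 0"
  shows "\<exists>z. quasi N q z \<and> diffs N q z x"
proof -
  define T where "T = (\<Sum>l<N. x l)"
  \<comment> \<open>For q \<noteq> 1 the start value solves y 0 - q y 0 = T, since the differences
    of one period add up to T; for q = 1 it is arbitrary and the period is - T.\<close>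
  define y where "y m = (if q = 1 then 0 else T / (1 - q)) - (\<Sum>l<m. x l)" for m
  define z where "z i = (if q = 1 then y (nat (i mod int N)) - T * of_int (i div int N)
      else y (nat (i mod int N)) * q powi (i div int N))" for i
  have zm: "z (int m + int N * k) = (if q = 1 then y m - T * of_int k else y m * q powi k)" if "m < N" for m k
    using that by (simp add: z_def)
  have "quasi N q z"
  proof (cases "q = 1")
    case True
    have "z (i + int N) = z i + (- T)" for i using True N by (simp add: z_def algebra_simps)
    then show ?thesis using True by (auto simp: quasi_def)
  next
    case False
    have "z (i + int N) = q * z i" for i using False N q by (simp add: z_def power_int_add)
    then show ?thesis using False by (simp add: quasi_def)
  qed
  moreover have "z (int m) - z (int m + 1) = x m" if m: "m < N" for m
  proof (cases "Suc m = N")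
    case True
    then have e: "int m + 1 = int 0 + int N * 1" by simp
    have T: "T = (\<Sum>l<m. x l) + x m" unfolding T_def True[symmetric] by simp
    have zm0: "z (int m) = y m" using zm[OF m, of 0] by simp
    have zm1: "z (int m + 1) = (if q = 1 then y 0 - T else y 0 * q)" unfolding e using zm[of 0 1] N by simp
    show ?thesis
    proof (cases "q = 1")
      case False
      have "y m - y 0 * q = T / (1 - q) * (1 - q) - (\<Sum>l<m. x l)" using False by (simp add: y_def right_diff_distrib)
      then have "y m - y 0 * q = x m" using False T by simp
      then show ?thesis using zm0 zm1 False by simp
    qed (use T zm0 zm1 in \<open>simp add: y_def\<close>)
  next
    case False
    then have sm: "Suc m < N" using m by simp
    have "z (int m) = y m" using zm[OF m, of 0] by simp
    moreover have "z (int m + 1) = y (Suc m)" using zm[OF sm, of 0] by (simp add: add.commute)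
    ultimately show ?thesis by (simp add: y_def)
  qed
  ultimately have "quasi N q z" "diffs N q z (\<lambda>m. z (int m) - z (int m + 1))" "\<forall>m<N. z (int m) - z (int m + 1) = x m"
    using diffs_if_quasi[OF q] by auto
  then show ?thesis unfolding diffs_def by (intro exI[of _ z]) auto
qed

section \<open>Roots of a cycle as pairs of integers\<close>

locale cyclic = coxeter_matrix W S a for W :: "('g, 'b) monoid_scheme" (structure) and S a +
  fixes N :: nat and \<sigma> :: "nat \<Rightarrow> 'g" and q :: real
  assumes N: "N \<ge> 2" and bij: "bij_betw \<sigma> {..<N} S" and q: "q > 0"
    and a_cyc: "\<And>i j. i < N \<Longrightarrow> j < N \<Longrightarrow> a (\<sigma> i) (\<sigma> j) = cyc q N i j"

definition aperm :: "nat \<Rightarrow> nat list \<Rightarrow> int \<Rightarrow> int" where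
  "aperm N u = foldr (sw N) u"

lemma aperm_Nil [simp]: "aperm N [] i = i" and aperm_Cons [simp]: "aperm N (j # u) i = sw N j (aperm N u i)"
  by (simp_all add: aperm_def)

context cyclic
begin

lemma \<sigma>_S: "i < N \<Longrightarrow> \<sigma> i \<in> S"
  using bij by (auto simp: bij_betw_def)

lemma word_index:
  assumes "u \<in> lists S" shows "\<exists>v. set v \<subseteq> {..<N} \<and> u = map \<sigma> v"
proof -
  have "u \<in> lists (\<sigma> ` {..<N})" using assms bij by (simp add: bij_betw_def)
  then have "u \<in> map \<sigma> ` lists {..<N}" by (simp add: lists_image)
  then show ?thesis by auto
qed

text \<open>The first letter is absorbed into \<open>z\<close> and \<open>x\<close>, which is why
  both vary in the induction.\<close>

lemma act_aperm:
  assumes v: "set v \<subseteq> {..<N}" and z: "diffs N q z (\<lambda>m. x (\<sigma> m))" and i: "i < N"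
  shows "(\<Sum>r\<in>S. act a S (map \<sigma> v) (coord (\<sigma> i)) r * x r) = z (aperm N v (int i)) - z (aperm N v (int i + 1))"
  using v z
proof (induction v arbitrary: z x)
  case Nil
  have "z (int i) - z (int i + 1) = x (\<sigma> i)"
    using Nil(2) i unfolding diffs_def by (auto dest: spec[of _ 0])
  then show ?case using sum_coord[OF finS \<sigma>_S[OF i], of x] by simp
next
  case (Cons j v)
  have j: "j < N" using Cons.prems by auto
  define x' where "x' r = x r - a r (\<sigma> j) * x (\<sigma> j)" for r
  have "diffs N q (\<lambda>i. z (sw N j i)) (\<lambda>m. x (\<sigma> m) - cyc q N m j * x (\<sigma> j))"
    by (rule diffs_sw[OF N q Cons.prems(2) j])
  then have "diffs N q (\<lambda>i. z (sw N j i)) (\<lambda>m. x' (\<sigma> m))"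
    unfolding diffs_def x'_def using a_cyc j by simp
  from Cons.IH[OF _ this] Cons.prems(1) show ?case
    by (simp add: ev_Cons_gen[OF \<sigma>_S[OF j]] x'_def)
qed

lemma ev_aperm:
  assumes v: "set v \<subseteq> {..<N}" and z: "diffs N q z (\<lambda>m. x (\<sigma> m))" and i: "i < N"
  shows "ev x (word_prod W (map \<sigma> v), \<sigma> i) = z (aperm N v (int i)) - z (aperm N v (int i + 1))"
proof -
  have "map \<sigma> v \<in> lists S" using v \<sigma>_S by (auto simp: subset_iff)
  then show ?thesis using act_aperm[OF assms] rho_word by (simp add: ev_def)
qed

lemma ev_of_quasi:
  assumes "quasi N q z"
  shows "\<exists>x. \<forall>v i. set v \<subseteq> {..<N} \<longrightarrow> i < N \<longrightarrow>
    ev x (word_prod W (map \<sigma> v), \<sigma> i) = z (aperm N v (int i)) - z (aperm N v (int i + 1))"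
proof -
  define x where "x r = (let m = the_inv_into {..<N} \<sigma> r in z (int m) - z (int m + 1))" for r
  have x: "x (\<sigma> m) = z (int m) - z (int m + 1)" if "m < N" for m
    using that bij by (simp add: x_def bij_betw_def the_inv_into_f_f)
  have "diffs N q z (\<lambda>m. x (\<sigma> m))"
    using diffs_if_quasi[OF q assms] x unfolding diffs_def by simp
  then show ?thesis using ev_aperm by blast
qed

lemma quasi_of_ev:
  "\<exists>z. quasi N q z \<and> (\<forall>v i. set v \<subseteq> {..<N} \<longrightarrow> i < N \<longrightarrow>
    ev x (word_prod W (map \<sigma> v), \<sigma> i) = z (aperm N v (int i)) - z (aperm N v (int i + 1)))"
proof -
  obtain z where "quasi N q z" "diffs N q z (\<lambda>m. x (\<sigma> m))" using quasi_exists[OF N q] by blast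
  then show ?thesis using ev_aperm by blast
qed

lemma root_index:
  assumes "w \<in> carrier W" "s \<in> S"
  shows "\<exists>v i. set v \<subseteq> {..<N} \<and> i < N \<and> w = word_prod W (map \<sigma> v) \<and> s = \<sigma> i"
proof -
  obtain u where u: "u \<in> lists S" "word_prod W u = w" using word_ex assms by blast
  then obtain v where "set v \<subseteq> {..<N}" "u = map \<sigma> v" using word_index by blast
  moreover obtain i where "i < N" "s = \<sigma> i" using assms(2) bij by (auto simp: bij_betw_def)
  ultimately show ?thesis using u by blast
qed

lemma aperm_incongruent:
  assumes "set v \<subseteq> {..<N}" "i mod int N \<noteq> i' mod int N"
  shows "aperm N v i mod int N \<noteq> aperm N v i' mod int N"
  using assms by (induction v) (auto simp: sw_incongruent N)

end

text \<open>Every finite order pattern possible for q is possible for q'. Only incongruent indices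
  are compared, as in a root; the freedom this leaves between the periods of a single class is what
  makes N = 2 and N = 3 special.\<close>

definition pattern_le :: "nat \<Rightarrow> real \<Rightarrow> real \<Rightarrow> bool" where
  "pattern_le N q q' \<longleftrightarrow> (\<forall>z F. quasi N q z \<longrightarrow> finite F \<longrightarrow> (\<forall>(i, j)\<in>F. i mod int N \<noteq> j mod int N) \<longrightarrow>
     (\<exists>z'. quasi N q' z' \<and> (\<forall>(i, j)\<in>F. sgn (z' i - z' j) = sgn (z i - z j))))"

lemma cyclic_transfer:
  assumes c: "cyclic W S a N \<sigma> q" "cyclic W S b N \<sigma> q'" and p: "pattern_le N q q'"
    and F: "finite F" "F \<subseteq> carrier W \<times> S"
  shows "\<exists>x'. \<forall>g\<in>F. sgn (coxeter_matrix.ev W S b x' g) = sgn (coxeter_matrix.ev W S a x g)"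
proof -
  interpret a: cyclic W S a N \<sigma> q by (rule c)
  interpret b: cyclic W S b N \<sigma> q' by (rule c)
  have "\<forall>g\<in>F. \<exists>vi. set (fst vi) \<subseteq> {..<N} \<and> snd vi < N \<and> g = (word_prod W (map \<sigma> (fst vi)), \<sigma> (snd vi))"
  proof
    fix g assume "g \<in> F"
    then obtain w s where g: "g = (w, s)" "w \<in> carrier W" "s \<in> S" using F(2) by auto
    obtain v i where "set v \<subseteq> {..<N}" "i < N" "w = word_prod W (map \<sigma> v)" "s = \<sigma> i"
      using a.root_index[OF g(2,3)] by blast
    then show "\<exists>vi. set (fst vi) \<subseteq> {..<N} \<and> snd vi < N \<and> g = (word_prod W (map \<sigma> (fst vi)), \<sigma> (snd vi))"
      unfolding g(1) by (intro exI[of _ "(v, i)"]) simp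
  qed
  then obtain ix where ix: "\<forall>g\<in>F. set (fst (ix g)) \<subseteq> {..<N} \<and> snd (ix g) < N \<and>
      g = (word_prod W (map \<sigma> (fst (ix g))), \<sigma> (snd (ix g)))" by (rule bchoice[THEN exE])
  define pr where "pr g = (aperm N (fst (ix g)) (int (snd (ix g))), aperm N (fst (ix g)) (int (snd (ix g)) + 1))" for g
  obtain z where z: "quasi N q z" "\<forall>v i. set v \<subseteq> {..<N} \<longrightarrow> i < N \<longrightarrow>
    a.ev x (word_prod W (map \<sigma> v), \<sigma> i) = z (aperm N v (int i)) - z (aperm N v (int i + 1))"
    using a.quasi_of_ev by blast
  have za: "a.ev x g = z (fst (pr g)) - z (snd (pr g))" if g: "g \<in> F" for g
  proof -
    define v i where "v = fst (ix g)" and "i = snd (ix g)"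
    have vi: "set v \<subseteq> {..<N}" "i < N" "g = (word_prod W (map \<sigma> v), \<sigma> i)" using ix g unfolding v_def i_def by blast+
    have pg: "pr g = (aperm N v (int i), aperm N v (int i + 1))" by (simp add: pr_def v_def i_def)
    show ?thesis unfolding pg fst_conv snd_conv using z(2) vi by blast
  qed
  have "\<forall>(i, j)\<in>pr ` F. i mod int N \<noteq> j mod int N"
  proof -
    have "int i mod int N \<noteq> (int i + 1) mod int N" for i
    proof
      assume "int i mod int N = (int i + 1) mod int N"
      then have "int N dvd 1" by (metis add_diff_cancel_left' mod_eq_dvd_iff)
      then show False using a.N by simp
    qed
    then have "fst (pr g) mod int N \<noteq> snd (pr g) mod int N" if "g \<in> F" for g
      unfolding pr_def fst_conv snd_conv using a.aperm_incongruent ix that by blast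
    then show ?thesis by (simp add: case_prod_beta)
  qed
  then obtain z' where z': "quasi N q' z'" "\<forall>(i, j)\<in>pr ` F. sgn (z' i - z' j) = sgn (z i - z j)"
    using p z(1) F(1) unfolding pattern_le_def by blast
  obtain x' where x': "\<forall>v i. set v \<subseteq> {..<N} \<longrightarrow> i < N \<longrightarrow>
    b.ev x' (word_prod W (map \<sigma> v), \<sigma> i) = z' (aperm N v (int i)) - z' (aperm N v (int i + 1))"
    using b.ev_of_quasi[OF z'(1)] by blast
  have zb: "b.ev x' g = z' (fst (pr g)) - z' (snd (pr g))" if g: "g \<in> F" for g
  proof -
    define v i where "v = fst (ix g)" and "i = snd (ix g)"
    have vi: "set v \<subseteq> {..<N}" "i < N" "g = (word_prod W (map \<sigma> v), \<sigma> i)" using ix g unfolding v_def i_def by blast+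
    have pg: "pr g = (aperm N v (int i), aperm N v (int i + 1))" by (simp add: pr_def v_def i_def)
    show ?thesis unfolding pg fst_conv snd_conv using x' vi by blast
  qed
  show ?thesis
  proof (intro exI ballI)
    fix g assume g: "g \<in> F"
    show "sgn (b.ev x' g) = sgn (a.ev x g)" unfolding za[OF g] zb[OF g] using z'(2) g by (auto simp: case_prod_beta)
  qed
qed

lemma cyclic_Cl_eq:
  assumes c: "cyclic W S a N \<sigma> q" "cyclic W S b N \<sigma> q'" and p: "pattern_le N q q'" "pattern_le N q' q"
  shows "coxeter_matrix.Cl W S a = coxeter_matrix.Cl W S b"
  using Cl_eq_if_transfer[OF cyclic.axioms(1)[OF c(1)] cyclic.axioms(1)[OF c(2)]
      cyclic_transfer[OF c(2,1) p(2)] cyclic_transfer[OF c p(1)]] .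

section \<open>Comparing order patterns\<close>

lemma quasi_one: "quasi N 1 z \<longleftrightarrow> (\<exists>\<tau>. \<forall>i. z (i + int N) = z i + \<tau>)"
  by (simp add: quasi_def)

lemma quasi_not_one: "q \<noteq> 1 \<Longrightarrow> quasi N q z \<longleftrightarrow> (\<forall>i. z (i + int N) = q * z i)"
  by (simp add: quasi_def)

lemma sgn_diff_strict_mono:
  assumes "\<And>s t :: real. s < t \<Longrightarrow> h s < (h t :: real)" shows "sgn (h s - h t) = sgn (s - t)"
  using assms[of s t] assms[of t s] by (cases s t rule: linorder_cases) auto

lemma pattern_le_refl: "pattern_le N q q"
  unfolding pattern_le_def by blast

lemma pattern_le_trans:
  assumes "pattern_le N q r" "pattern_le N r s" shows "pattern_le N q s"
  unfolding pattern_le_def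
proof (intro allI impI)
  fix z F assume z: "quasi N q z" "finite F" "\<forall>(i, j)\<in>F. i mod int N \<noteq> j mod int N"
  obtain y where y: "quasi N r y" "\<forall>(i, j)\<in>F. sgn (y i - y j) = sgn (z i - z j)"
    using assms(1) z unfolding pattern_le_def by blast
  obtain x where x: "quasi N s x" "\<forall>(i, j)\<in>F. sgn (x i - x j) = sgn (y i - y j)"
    using assms(2) y(1) z(2,3) unfolding pattern_le_def by blast
  have "\<forall>(i, j)\<in>F. sgn (x i - x j) = sgn (z i - z j)" using x(2) y(2) by fastforce
  then show "\<exists>z'. quasi N s z' \<and> (\<forall>(i, j)\<in>F. sgn (z' i - z' j) = sgn (z i - z j))" using x(1) by blast
qed

lemma signed_powr_strict_mono:
  assumes "p > 0" "s < (t::real)" shows "sgn s * \<bar>s\<bar> powr p < sgn t * \<bar>t\<bar> powr p"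
proof -
  consider "s < 0" "t > 0" | "s \<ge> 0" | "t \<le> 0" using assms by linarith
  then show ?thesis
  proof cases
    case 1
    then have "sgn s * \<bar>s\<bar> powr p < 0" "sgn t * \<bar>t\<bar> powr p > 0" by simp_all
    then show ?thesis by linarith
  next
    case 2
    then show ?thesis using assms powr_less_mono2[of p s t] by (cases "s = 0") auto
  next
    case 3
    then show ?thesis using assms powr_less_mono2[of p "- t" "- s"] by (cases "t = 0") auto
  qed
qed

lemma pattern_le_same_side:
  assumes "q > 0" "q' > 0" "(q > 1 \<and> q' > 1) \<or> (q < 1 \<and> q' < 1)"
  shows "pattern_le N q q'"
  unfolding pattern_le_def
proof (intro allI impI)
  fix z F assume z: "quasi N q z"
  \<comment> \<open>The solution of q powr p = q'; it is positive because both logarithms have the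
    same sign.\<close>
  define p where "p = ln q' / ln q"
  have p: "p > 0" using assms by (auto simp: p_def divide_neg_neg)
  have "ln q \<noteq> 0" using assms by auto
  then have qp: "q powr p = q'" using assms by (simp add: powr_def p_def)
  have zq: "z (i + int N) = q * z i" for i using z assms by (auto simp: quasi_def split: if_splits)
  define h where "h t = sgn t * \<bar>t\<bar> powr p" for t :: real
  have "h (z (i + int N)) = q' * h (z i)" for i
    unfolding zq h_def using assms(1) qp by (simp add: sgn_mult abs_mult powr_mult)
  then have "quasi N q' (\<lambda>i. h (z i))" using assms by (auto simp: quasi_def)
  moreover have "sgn (h s - h t) = sgn (s - t)" for s t
    unfolding h_def by (rule sgn_diff_strict_mono) (rule signed_powr_strict_mono[OF p])
  ultimately show "\<exists>z'. quasi N q' z' \<and> (\<forall>(i, j)\<in>F. sgn (z' i - z' j) = sgn (z i - z j))"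
    by (intro exI[of _ "\<lambda>i. h (z i)"]) auto
qed

lemma four_residues:
  assumes "N \<in> {2, 3}" "i mod int N \<noteq> j mod int N" "k mod int N \<noteq> l mod int N"
    "i mod int N \<noteq> k mod int N" "i mod int N \<noteq> l mod int N" "j mod int N \<noteq> k mod int N" "j mod int N \<noteq> l mod int N"
  shows False
proof -
  have "x mod int N \<in> {0, 1, 2}" for x
  proof -
    have "0 \<le> x mod int N" "x mod int N < 3" using assms(1) pos_mod_bound[of "int N" x] by auto
    then show ?thesis by auto
  qed
  from this[of i] this[of j] this[of k] this[of l] show False using assms(2-) by auto
qed

lemma quasi_sgn:
  fixes z :: "int \<Rightarrow> real"
  assumes "q > 0" "\<And>i. z (i + int N) = q * z i" "i mod int N = j mod int N"
  shows "sgn (z i) = sgn (z j)"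
proof -
  obtain k where k: "i = j + int N * k" using assms(3) by (metis mod_eqE add.commute diff_add_cancel mult.commute)
  have "sgn (z (j + int N * k)) = sgn (z j)" for k
  proof (induction k rule: int_shift_induct)
    fix k
    have "j + int N * (k + 1) = (j + int N * k) + int N" by (simp add: algebra_simps)
    then have "z (j + int N * (k + 1)) = q * z (j + int N * k)" using assms(2) by metis
    then show "sgn (z (j + int N * k)) = sgn (z j) \<longleftrightarrow> sgn (z (j + int N * (k + 1))) = sgn (z j)"
      using assms(1) by (simp add: sgn_mult)
  qed simp
  then show ?thesis using k by simp
qed

text \<open>At most one sign is taken on two residue classes; on the classes with this sign, a logarithm of \<open>\<bar>z\<bar>\<close>
  turns the multiplicative quasi-periodicity into an additive one, and the other classes are moved far away.\<close>

lemma pattern_le_to_one: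
  assumes N: "N \<in> {2, 3}" and q: "q > 0"
  shows "pattern_le N q 1"
proof (cases "q = 1")
  case False
  show ?thesis unfolding pattern_le_def
  proof (intro allI impI)
    fix z F assume z: "quasi N q z" and F: "finite F" "\<forall>(i, j)\<in>F. i mod int N \<noteq> j mod int N"
    have zq: "z (i + int N) = q * z i" for i using z False by (simp add: quasi_def)
    have cong: "sgn (z i) = sgn (z j)" if "i mod int N = j mod int N" for i j
      using quasi_sgn[of q z N i j] q zq that by blast
    \<comment> \<open>The only sign that can occur on two different classes, as a second such sign
      would need four classes; 0 if there is none.\<close>
    obtain h where h: "h \<in> {- 1, 0, 1}" "\<And>i j. i mod int N \<noteq> j mod int N \<Longrightarrow> sgn (z i) = sgn (z j) \<Longrightarrow> sgn (z i) = h"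
    proof (cases "\<exists>i j. i mod int N \<noteq> j mod int N \<and> sgn (z i) = sgn (z j)")
      case True
      then obtain i j where ij: "i mod int N \<noteq> j mod int N" "sgn (z i) = sgn (z j)" by blast
      have "sgn (z k) = sgn (z i)" if kl: "k mod int N \<noteq> l mod int N" "sgn (z k) = sgn (z l)" for k l
      proof (rule ccontr)
        assume "sgn (z k) \<noteq> sgn (z i)"
        then have "i mod int N \<noteq> k mod int N" "i mod int N \<noteq> l mod int N" "j mod int N \<noteq> k mod int N" "j mod int N \<noteq> l mod int N"
          using cong[of i k] cong[of i l] cong[of j k] cong[of j l] ij(2) kl(2) by auto
        from four_residues[OF N ij(1) kl(1) this] show False .
      qed
      moreover have "sgn (z i) \<in> {- 1, 0, 1}" by (simp add: sgn_if)
      ultimately show thesis using that by blast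
    next
      case False
      then show thesis using that[of 0] by blast
    qed
    define \<tau> where "\<tau> = h * ln q"
    \<comment> \<open>The factor h makes the logarithm increasing in z on the negative side too. A
      class with another sign is compared only with classes of different sign, so it may carry any
      function with the period \<tau>.\<close>
    define y where "y i = (if sgn (z i) = h then h * ln \<bar>z i\<bar> else \<tau> * of_int (i div int N))" for i
    have sz: "sgn (z (i + int N)) = sgn (z i)" for i using q by (simp add: zq sgn_mult)
    have N0: "int N \<noteq> 0" using N by auto
    have yq: "y (i + int N) = y i + \<tau>" for i
    proof (cases "sgn (z i) = h")
      case True
      have "h * ln \<bar>q * z i\<bar> = h * ln \<bar>z i\<bar> + h * ln q"
      proof (cases "z i = 0")
        case True
        then show ?thesis using \<open>sgn (z i) = h\<close> by simp
      next
        case False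
        then show ?thesis using q by (simp add: abs_mult ln_mult algebra_simps)
      qed
      then show ?thesis using True sz[of i] by (simp add: y_def zq \<tau>_def)
    next
      case False
      then show ?thesis using sz[of i] N0 by (simp add: y_def algebra_simps)
    qed
    \<comment> \<open>Larger than every difference of \<open>y\<close> that is tested, so
      \<open>M * sgn (z i)\<close> decides all comparisons between different signs.\<close>
    define M where "M = 1 + (\<Sum>(i, j)\<in>F. \<bar>y i - y j\<bar>)"
    have M: "\<bar>y i - y j\<bar> < M" if "(i, j) \<in> F" for i j
    proof -
      have "\<bar>y i - y j\<bar> \<le> (\<Sum>(i, j)\<in>F. \<bar>y i - y j\<bar>)"
        using member_le_sum[OF that, of "\<lambda>(i, j). \<bar>y i - y j\<bar>"] F(1) by auto
      then show ?thesis by (simp add: M_def)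
    qed
    define z' where "z' i = M * sgn (z i) + y i" for i
    have "quasi N 1 z'" unfolding quasi_one by (intro exI[of _ \<tau>]) (simp add: z'_def sz yq)
    moreover have "sgn (z' i - z' j) = sgn (z i - z j)" if ij: "(i, j) \<in> F" for i j
    proof (cases "sgn (z i) = sgn (z j)")
      case True
      have inc: "i mod int N \<noteq> j mod int N" using F(2) ij by auto
      have hs: "sgn (z i) = h" "sgn (z j) = h" using h(2)[OF inc True] True by auto
      have d: "z' i - z' j = h * ln \<bar>z i\<bar> - h * ln \<bar>z j\<bar>" using hs by (simp add: z'_def y_def)
      consider "h = 0" | "h = 1" | "h = - 1" using h(1) by blast
      then show ?thesis
      proof cases
        case 1
        then show ?thesis using hs d by (simp add: sgn_zero_iff)
      next
        case 2
        then have "z i > 0" "z j > 0" using hs by (auto simp: sgn_1_pos)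
        then show ?thesis unfolding d using 2 by (cases "z i" "z j" rule: linorder_cases) auto
      next
        case 3
        then have "z i < 0" "z j < 0" using hs by (auto simp: sgn_1_neg)
        then show ?thesis unfolding d using 3 by (cases "z i" "z j" rule: linorder_cases) auto
      qed
    next
      case False
      have m: "\<bar>y i - y j\<bar> < M" by (rule M[OF ij])
      have d: "z' i - z' j = M * (sgn (z i) - sgn (z j)) + (y i - y j)" by (simp add: z'_def algebra_simps)
      have M0: "M > 0" using m by linarith
      show ?thesis
      proof (cases "z i < z j")
        case True
        then have "sgn (z i) - sgn (z j) \<le> - 1" using False by (auto simp: sgn_if split: if_splits)
        then have "M * (sgn (z i) - sgn (z j)) \<le> M * (- 1)" using M0 by (intro mult_left_mono) auto
        then have "z' i - z' j < 0" unfolding d using m by linarith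
        then show ?thesis using True by simp
      next
        case ge: False
        then have gt: "z j < z i" using False by (metis linorder_neqE_linordered_idom)
        then have "sgn (z i) - sgn (z j) \<ge> 1" using False by (auto simp: sgn_if split: if_splits)
        then have "M * (sgn (z i) - sgn (z j)) \<ge> M * 1" using M0 by (intro mult_left_mono) auto
        then have "z' i - z' j > 0" unfolding d using m by linarith
        then show ?thesis using gt by simp
      qed
    qed
    ultimately show "\<exists>z'. quasi N 1 z' \<and> (\<forall>(i, j)\<in>F. sgn (z' i - z' j) = sgn (z i - z j))" by blast
  qed
qed (simp add: pattern_le_refl)

text \<open>\<open>v\<close> is the median, and no two of three numbers lie strictly on the same
  side of their median.\<close>

lemma median_separates:
  fixes A B C :: real
  defines "v \<equiv> max (min A B) (min (max A B) C)"
  shows "sgn (A - v) = sgn (B - v) \<Longrightarrow> A = v \<and> B = v" "sgn (A - v) = sgn (C - v) \<Longrightarrow> A = v \<and> C = v"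
    "sgn (B - v) = sgn (C - v) \<Longrightarrow> B = v \<and> C = v"
  unfolding v_def by (auto simp: max_def min_def sgn_if split: if_splits)

text \<open>If \<tau> \<noteq> 0, an exponential with rate ln q / \<tau> converts the period \<tau>
  into the factor q, and the sign of the rate makes it increasing. If \<tau> = 0, z takes at most
  one value on each class; measured from a suitable level, the median for N = 3, each strict side
  contains at most one class, so the growth by q has no effect on any comparison.\<close>

lemma pattern_le_from_one:
  assumes N: "N \<in> {2, 3}" and q: "q > 0"
  shows "pattern_le N 1 q"
proof (cases "q = 1")
  case q1: False
  show ?thesis unfolding pattern_le_def
  proof (intro allI impI)
    fix z F assume z: "quasi N 1 z" and F: "finite F" "\<forall>(i, j)\<in>F. i mod int N \<noteq> j mod int N"
    obtain \<tau> where \<tau>: "\<And>i. z (i + int N) = z i + \<tau>" using z by (auto simp: quasi_one)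
    have N0: "int N \<noteq> 0" using N by auto
    show "\<exists>z'. quasi N q z' \<and> (\<forall>(i, j)\<in>F. sgn (z' i - z' j) = sgn (z i - z j))"
    proof (cases "\<tau> = 0")
      case False
      define \<kappa> where "\<kappa> = ln q / \<tau>"
      have \<kappa>: "\<kappa> \<noteq> 0" "\<kappa> * \<tau> = ln q" using False q q1 by (auto simp: \<kappa>_def)
      define h where "h t = sgn \<kappa> * exp (\<kappa> * t)" for t
      have "h (z (i + int N)) = q * h (z i)" for i
        unfolding h_def \<tau> distrib_left \<kappa>(2) exp_add using q by simp
      then have "quasi N q (\<lambda>i. h (z i))" using q1 by (simp add: quasi_not_one)
      moreover have "h s < h t" if "s < t" for s t
        using that \<kappa>(1) by (cases "\<kappa> > 0") (auto simp: h_def sgn_if)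
      then have "sgn (h s - h t) = sgn (s - t)" for s t by (rule sgn_diff_strict_mono)
      ultimately show ?thesis by (intro exI[of _ "\<lambda>i. h (z i)"]) auto
    next
      case True
      have zmod: "z i = z (i mod int N)" for i
      proof -
        have "z (i mod int N + int N * k) = z (i mod int N)" for k
        proof (induction k rule: int_shift_induct)
          fix k
          have "i mod int N + int N * (k + 1) = (i mod int N + int N * k) + int N" by (simp add: algebra_simps)
          then have "z (i mod int N + int N * (k + 1)) = z (i mod int N + int N * k)" using \<tau> True by (metis add.right_neutral)
          then show "z (i mod int N + int N * k) = z (i mod int N) \<longleftrightarrow> z (i mod int N + int N * (k + 1)) = z (i mod int N)" by simp
        qed simp
        from this[of "i div int N"] show ?thesis by simp
      qed
      have "\<exists>v. \<forall>i j. i mod int N \<noteq> j mod int N \<longrightarrow> sgn (z i - v) = sgn (z j - v) \<longrightarrow> z i = v \<and> z j = v"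
      proof (cases "N = 2")
        case True
        have res: "i mod 2 = 0 \<or> i mod 2 = 1" for i :: int by auto
        show ?thesis
        proof (intro exI[of _ "z 0"] allI impI)
          fix i j assume a: "i mod int N \<noteq> j mod int N" "sgn (z i - z 0) = sgn (z j - z 0)"
          have "z i = z 0 \<or> z j = z 0" using a(1) res[of i] res[of j] zmod[of i] zmod[of j] True by auto
          then show "z i = z 0 \<and> z j = z 0" using a(2) by (auto simp: sgn_zero_iff)
        qed
      next
        case False
        then have N3: "N = 3" using N by auto
        define v where "v = max (min (z 0) (z 1)) (min (max (z 0) (z 1)) (z 2))"
        note sep = median_separates[where A="z 0" and B="z 1" and C="z 2", folded v_def]
        have res: "i mod 3 = 0 \<or> i mod 3 = 1 \<or> i mod 3 = 2" for i :: int by auto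
        show ?thesis
        proof (intro exI[of _ v] allI impI)
          fix i j assume a: "i mod int N \<noteq> j mod int N" "sgn (z i - v) = sgn (z j - v)"
          show "z i = v \<and> z j = v"
            using a res[of i] res[of j] sep unfolding N3 zmod[of i, unfolded N3] zmod[of j, unfolded N3]
            by (elim disjE) auto
        qed
      qed
      then obtain v where v: "\<And>i j. i mod int N \<noteq> j mod int N \<Longrightarrow> sgn (z i - v) = sgn (z j - v) \<Longrightarrow> z i = v \<and> z j = v" by blast
      \<comment> \<open>Only the side of \<open>v\<close> is kept: incongruent indices on the same
        side both have the value \<open>v\<close>, and different sides are ordered by their signs
        whatever the power of q.\<close>
      define z' where "z' i = sgn (z i - v) * q powi (i div int N)" for i
      have "z' (i + int N) = q * z' i" for i
        using \<tau>[of i] True N0 q by (simp add: z'_def power_int_add)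
      then have "quasi N q z'" using q1 by (simp add: quasi_not_one)
      moreover have "sgn (z' i - z' j) = sgn (z i - z j)" if "(i, j) \<in> F" for i j
      proof (cases "sgn (z i - v) = sgn (z j - v)")
        case True
        then have "z i = v" "z j = v" using v[of i j] F(2) that by auto
        then show ?thesis by (simp add: z'_def)
      next
        case False
        have pos: "q powi k > 0" for k using q by simp
        show ?thesis
        proof (cases "z i < z j")
          case True
          then have "z i - v \<le> 0 \<and> z j - v \<ge> 0 \<and> (z i - v < 0 \<or> z j - v > 0)" using False by (auto simp: sgn_if split: if_splits)
          then have "z' i < z' j" using pos[of "i div int N"] pos[of "j div int N"] by (auto simp: z'_def sgn_if)
          then show ?thesis using True by simp
        next
          case ge: False
          then have gt: "z j < z i" using False by (metis linorder_neqE_linordered_idom)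
          then have "z j - v \<le> 0 \<and> z i - v \<ge> 0 \<and> (z j - v < 0 \<or> z i - v > 0)" using False by (auto simp: sgn_if split: if_splits)
          then have "z' j < z' i" using pos[of "i div int N"] pos[of "j div int N"] by (auto simp: z'_def sgn_if)
          then show ?thesis using gt by simp
        qed
      qed
      ultimately show ?thesis by blast
    qed
  qed
qed (simp add: pattern_le_refl)

lemma cyclic_Cl_eq_small:
  assumes "cyclic W S a N \<sigma> q" "cyclic W S b N \<sigma> q'" "N \<in> {2, 3}"
  shows "coxeter_matrix.Cl W S a = coxeter_matrix.Cl W S b"
proof (rule cyclic_Cl_eq[OF assms(1,2)])
  have "q > 0" "q' > 0" using cyclic.q[OF assms(1)] cyclic.q[OF assms(2)] by auto
  then show "pattern_le N q q'" "pattern_le N q' q"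
    using pattern_le_trans pattern_le_to_one pattern_le_from_one assms(3) by blast+
qed

lemma cyclic_Cl_eq_sgn:
  assumes "cyclic W S a N \<sigma> q" "cyclic W S b N \<sigma> q'" "sgn (q - 1) = sgn (q' - 1)"
  shows "coxeter_matrix.Cl W S a = coxeter_matrix.Cl W S b"
proof (rule cyclic_Cl_eq[OF assms(1,2)])
  have "q > 0" "q' > 0" using cyclic.q[OF assms(1)] cyclic.q[OF assms(2)] by auto
  moreover have "q = q' \<or> (q > 1 \<and> q' > 1) \<or> (q < 1 \<and> q' < 1)"
    using assms(3) by (auto simp: sgn_if split: if_splits)
  ultimately show "pattern_le N q q'" "pattern_le N q' q"
    using pattern_le_refl pattern_le_same_side by blast+
qed

section \<open>Separating the three structures\<close>

text \<open>Up to a power of q, e_i - e_j is a root: a common shift of both indices by a multiple of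
  N only rescales it.\<close>

definition reach :: "nat \<Rightarrow> int \<Rightarrow> int \<Rightarrow> bool" where
  "reach N i j \<longleftrightarrow> (\<exists>v m k. set v \<subseteq> {..<N} \<and> m < N \<and>
     aperm N v (int m) = i + int N * k \<and> aperm N v (int m + 1) = j + int N * k)"

lemma reach_base: "N > 0 \<Longrightarrow> reach N i (i + 1)"
proof -
  assume "N > 0"
  then obtain m k where "m < N" "i = int m + int N * k" by (rule int_as_residue)
  then show ?thesis unfolding reach_def
    by (intro exI[of _ "[]"] exI[of _ m] exI[of _ "- k"]) simp
qed

lemma reach_sw: "r < N \<Longrightarrow> reach N i j \<Longrightarrow> reach N (sw N r i) (sw N r j)"
proof -
  assume r: "r < N" and "reach N i j"
  then obtain v m k where "set v \<subseteq> {..<N}" "m < N" "aperm N v (int m) = i + int N * k" "aperm N v (int m + 1) = j + int N * k"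
    unfolding reach_def by blast
  then show ?thesis unfolding reach_def using r
    by (intro exI[of _ "r # v"] exI[of _ m] exI[of _ k]) (simp add: sw_shift)
qed

lemma sw_up: "r < N \<Longrightarrow> i mod int N = int r \<Longrightarrow> sw N r i = i + 1"
  by (simp add: sw_def)

lemma sw_down: "N \<ge> 2 \<Longrightarrow> r < N \<Longrightarrow> i mod int N = int r \<Longrightarrow> sw N r (i + 1) = i"
  using sw_sw[of N r i] by (simp add: sw_up)

lemma sw_fix: "i mod int N \<noteq> int r \<Longrightarrow> i mod int N \<noteq> int (Suc r mod N) \<Longrightarrow> sw N r i = i"
  by (simp add: sw_def)

lemma reach_test:
  assumes N: "N \<ge> 4"
  shows "reach N 0 1" "reach N 1 (int N)" "reach N 3 2" "reach N (int N + 2) 3" "reach N 0 2" "reach N 2 0"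
proof -
  have small: "int r mod int N = int r" if "r < N" for r using that by simp
  have N2: "N \<ge> 2" using N by simp
  show r01: "reach N 0 1" using reach_base[of N 0] N by simp
  \<comment> \<open>The first index descends from N - 1 to 1 through s_{N-2}, ..., s_1, which do not
    move the class of N.\<close>
  have "reach N (int N - 1 - int k) (int N)" if "k \<le> N - 2" for k
    using that
  proof (induction k)
    case 0
    show ?case using reach_base[of N "int N - 1"] N by simp
  next
    case (Suc k)
    define r where "r = N - 2 - k"
    have r: "r < N" "1 \<le> r" "Suc r < N" "int N - 1 - int k = int r + 1" "int N - 1 - int (Suc k) = int r"
      using Suc.prems N by (auto simp: r_def of_nat_diff)
    have "sw N r (int r + 1) = int r" using sw_down[OF N2 r(1) small[OF r(1)]] .
    moreover have "sw N r (int N) = int N" using r by (intro sw_fix) auto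
    ultimately show ?case using reach_sw[OF r(1), of "int r + 1" "int N"] Suc.IH Suc.prems r by simp
  qed
  from this[of "N - 2"] show "reach N 1 (int N)" using N by (simp add: of_nat_diff)
  have s2: "sw N 2 2 = 3" "sw N 2 3 = 2" using sw_up[of 2 N 2] sw_down[of N 2 2] small[of 2] N by auto
  have "reach N 2 3" using reach_base[of N 2] N by simp
  then show "reach N 3 2" using reach_sw[of 2 N 2 3] s2 N by simp
  have s1: "sw N 1 1 = 2" "sw N 1 0 = 0" "sw N 1 2 = 1"
    using sw_up[of 1 N 1] sw_down[of N 1 1] small[of 1] N sw_fix[of 0 N 1] by auto
  have s0: "sw N 0 0 = 1" "sw N 0 1 = 0" using sw_up[of 0 N 0] sw_down[of N 0 0] small[of 0] N by auto
  show "reach N 0 2" using reach_sw[of 1 N 0 1] r01 s1 N by simp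
  have "reach N 1 0" using reach_sw[of 0 N 0 1] r01 s0 N by simp
  then show "reach N 2 0" using reach_sw[of 1 N 1 0] s1 N by simp
  \<comment> \<open>From the neighbours N + 1 and N + 2: s_1 exchanges them, and s_0 lowers N + 1 to
    N.\<close>
  have "reach N (1 + int N * 1) (2 + int N * 1)" using reach_base[of N "1 + int N"] N by (simp add: algebra_simps)
  then have "reach N (2 + int N * 1) (1 + int N * 1)" using reach_sw[of 1 N "1 + int N * 1" "2 + int N * 1"] s1 N by (simp only: sw_shift)
  then have "reach N (sw N 0 (2 + int N * 1)) (sw N 0 (1 + int N * 1))" using N by (intro reach_sw) auto
  moreover have "sw N 0 (2 + int N * 1) = 2 + int N" using N by (intro trans[OF sw_fix]) auto
  moreover have "sw N 0 (1 + int N * 1) = int N" unfolding sw_shift s0 by simp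
  ultimately have start: "reach N (int N + 2) (int N)" by (simp add: add.commute)
  \<comment> \<open>The second index descends from N to 3 through s_{N-1}, ..., s_3, which do not
    move the class of 2.\<close>
  have "reach N (int N + 2) (int N - int k)" if "k \<le> N - 3" for k
    using that
  proof (induction k)
    case (Suc k)
    define r where "r = N - 1 - k"
    have r: "r < N" "3 \<le> r" "int N - int k = int r + 1" "int N - int (Suc k) = int r"
      using Suc.prems N by (auto simp: r_def of_nat_diff)
    have "sw N r (int r + 1) = int r" using sw_down[OF N2 r(1) small[OF r(1)]] .
    moreover have "sw N r (int N + 2) = int N + 2"
    proof (rule sw_fix)
      have "(int N + 2) mod int N = 2" using N by simp
      then show "(int N + 2) mod int N \<noteq> int r" "(int N + 2) mod int N \<noteq> int (Suc r mod N)"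
        using r by (auto simp: mod_Suc)
    qed
    ultimately show ?case using reach_sw[OF r(1), of "int N + 2" "int r + 1"] Suc.IH Suc.prems r by simp
  qed (use start in simp)
  from this[of "N - 3"] show "reach N (int N + 2) 3" using N by (simp add: of_nat_diff)
qed

lemma quasi_diff:
  assumes "q > 0" "quasi N q z" shows "z (i + int N * k) - z (j + int N * k) = q powi k * (z i - z j)"
proof (induction k rule: int_shift_induct)
  fix k
  have e: "l + int N * (k + 1) = (l + int N * k) + int N" for l by (simp add: algebra_simps)
  have "z (i' + int N) - z (j' + int N) = q * (z i' - z j')" for i' j'
  proof (cases "q = 1")
    case True
    then obtain \<tau> where "\<forall>i. z (i + int N) = z i + \<tau>" using assms(2) by (auto simp: quasi_def)
    then show ?thesis using True by simp
  next
    case False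
    then have "\<forall>i. z (i + int N) = q * z i" using assms(2) by (auto simp: quasi_def)
    then show ?thesis by (simp add: right_diff_distrib)
  qed
  then have "z (i + int N * (k + 1)) - z (j + int N * (k + 1)) = q * (z (i + int N * k) - z (j + int N * k))"
    unfolding e .
  moreover have "q powi (k + 1) = q * q powi k" using assms(1) by (simp add: power_int_add)
  ultimately show "z (i + int N * k) - z (j + int N * k) = q powi k * (z i - z j) \<longleftrightarrow>
    z (i + int N * (k + 1)) - z (j + int N * (k + 1)) = q powi (k + 1) * (z i - z j)"
    using assms(1) by (simp add: mult.assoc)
qed simp

text \<open>A root \<open>(w, s)\<close> on the ray of \<open>e\<^sub>i - e\<^sub>j\<close>, chosen independently of \<open>q\<close>.\<close>

definition ray :: "('g, 'b) monoid_scheme \<Rightarrow> nat \<Rightarrow> (nat \<Rightarrow> 'g) \<Rightarrow> int \<times> int \<Rightarrow> 'g \<times> 'g" where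
  "ray W N \<sigma> p = (let (v, m, k) = (SOME (v, m, k). set v \<subseteq> {..<N} \<and> m < N \<and>
     aperm N v (int m) = fst p + int N * k \<and> aperm N v (int m + 1) = snd p + int N * k)
   in (word_prod W (map \<sigma> v), \<sigma> m))"

lemma ray_props:
  assumes "reach N i j"
  obtains v m k where "set v \<subseteq> {..<N}" "m < N" "aperm N v (int m) = i + int N * k"
    "aperm N v (int m + 1) = j + int N * k" "ray W N \<sigma> (i, j) = (word_prod W (map \<sigma> v), \<sigma> m)"
proof -
  define P where "P = (\<lambda>(v, m, k). set v \<subseteq> {..<N} \<and> m < N \<and>
     aperm N v (int m) = i + int N * k \<and> aperm N v (int m + 1) = j + int N * k)"
  have "\<exists>t. P t" using assms unfolding reach_def P_def by auto
  then have "P (SOME t. P t)" by (rule someI_ex)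
  moreover obtain v m k where t: "(SOME t. P t) = (v, m, k)" by (metis surj_pair)
  ultimately have "P (v, m, k)" by simp
  moreover have "ray W N \<sigma> (i, j) = (word_prod W (map \<sigma> v), \<sigma> m)"
    using t unfolding ray_def P_def by simp
  ultimately show thesis using that unfolding P_def by blast
qed

context cyclic
begin

lemma ray_mem: "reach N i j \<Longrightarrow> ray W N \<sigma> (i, j) \<in> carrier W \<times> S"
proof -
  assume "reach N i j"
  then obtain v m k where v: "set v \<subseteq> {..<N}" "m < N" "ray W N \<sigma> (i, j) = (word_prod W (map \<sigma> v), \<sigma> m)"
    by (rule ray_props)
  have "map \<sigma> v \<in> lists S" using v(1) \<sigma>_S by (auto simp: subset_iff)
  then show ?thesis using v \<sigma>_S by simp
qed

text \<open>Functionals and quasi-periodic functions correspond in both directions, and the power of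
  q by which a ray representative differs from e_i - e_j is positive.\<close>

lemma ray_dual:
  assumes P: "\<And>p. p \<in> P \<Longrightarrow> reach N (fst p) (snd p)" and g: "reach N i j"
  shows "(\<forall>x. (\<forall>h\<in>ray W N \<sigma> ` P. ev x h \<ge> 0) \<longrightarrow> ev x (ray W N \<sigma> (i, j)) \<ge> 0) \<longleftrightarrow>
    (\<forall>z. quasi N q z \<longrightarrow> (\<forall>p\<in>P. z (snd p) \<le> z (fst p)) \<longrightarrow> z j \<le> z i)"
proof -
  define link where "link x z \<longleftrightarrow> quasi N q z \<and> (\<forall>v i. set v \<subseteq> {..<N} \<longrightarrow> i < N \<longrightarrow>
    ev x (word_prod W (map \<sigma> v), \<sigma> i) = z (aperm N v (int i)) - z (aperm N v (int i + 1)))" for x z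
  have l: "ev x (ray W N \<sigma> (i, j)) \<ge> 0 \<longleftrightarrow> z j \<le> z i" if "reach N i j" "link x z" for i j x z
  proof -
    obtain v m k where v: "set v \<subseteq> {..<N}" "m < N" "aperm N v (int m) = i + int N * k"
      "aperm N v (int m + 1) = j + int N * k" "ray W N \<sigma> (i, j) = (word_prod W (map \<sigma> v), \<sigma> m)"
      using \<open>reach N i j\<close> by (rule ray_props)
    have "ev x (ray W N \<sigma> (i, j)) = q powi k * (z i - z j)"
      using that(2) v quasi_diff[OF q] unfolding link_def by metis
    moreover have "q powi k > 0" using q by simp
    ultimately show ?thesis by (simp add: zero_le_mult_iff)
  qed
  have ex: "\<exists>z. link x z" for x using quasi_of_ev[of x] unfolding link_def by blast
  have ez: "\<exists>x. link x z" if "quasi N q z" for z using ev_of_quasi[OF that] that unfolding link_def by blast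
  have lP: "(\<forall>h\<in>ray W N \<sigma> ` P. ev x h \<ge> 0) \<longleftrightarrow> (\<forall>p\<in>P. z (snd p) \<le> z (fst p))" if "link x z" for x z
    using l[OF P that] by simp
  show ?thesis
  proof
    assume L: "\<forall>x. (\<forall>h\<in>ray W N \<sigma> ` P. ev x h \<ge> 0) \<longrightarrow> ev x (ray W N \<sigma> (i, j)) \<ge> 0"
    show "\<forall>z. quasi N q z \<longrightarrow> (\<forall>p\<in>P. z (snd p) \<le> z (fst p)) \<longrightarrow> z j \<le> z i"
    proof (intro allI impI)
      fix z assume "quasi N q z" and zP: "\<forall>p\<in>P. z (snd p) \<le> z (fst p)"
      then obtain x where x: "link x z" using ez by blast
      then show "z j \<le> z i" using L lP[OF x] l[OF g x] zP by blast
    qed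
  next
    assume Rr: "\<forall>z. quasi N q z \<longrightarrow> (\<forall>p\<in>P. z (snd p) \<le> z (fst p)) \<longrightarrow> z j \<le> z i"
    show "\<forall>x. (\<forall>h\<in>ray W N \<sigma> ` P. ev x h \<ge> 0) \<longrightarrow> ev x (ray W N \<sigma> (i, j)) \<ge> 0"
    proof (intro allI impI)
      fix x assume xP: "\<forall>h\<in>ray W N \<sigma> ` P. ev x h \<ge> 0"
      obtain z where z: "link x z" using ex by blast
      then have "quasi N q z" by (simp add: link_def)
      then show "ev x (ray W N \<sigma> (i, j)) \<ge> 0" using Rr lP[OF z] l[OF g z] xP by blast
    qed
  qed
qed

text \<open>A pair (i, j) stands for e_i - e_j; for q \<noteq> 1, N and N + 2 stand for q times e_0
  and e_2.\<close>

definition test_set :: "(int \<times> int) set" where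
  "test_set = {(0, 1), (1, int N), (3, 2), (int N + 2, 3)}"

lemma test_membership:
  assumes g: "reach N i j" and N4: "N \<ge> 4"
  shows "(case ray W N \<sigma> (i, j) of (w, s) \<Rightarrow> sr w s) \<in> Cl ((\<lambda>(w, s). sr w s) ` ray W N \<sigma> ` test_set) \<longleftrightarrow>
    (\<forall>z. quasi N q z \<longrightarrow> z 1 \<le> z 0 \<and> z (int N) \<le> z 1 \<and> z 2 \<le> z 3 \<and> z 3 \<le> z (int N + 2) \<longrightarrow> z j \<le> z i)"
proof -
  have P: "reach N (fst p) (snd p)" if "p \<in> test_set" for p
    using that reach_test[OF N4] by (auto simp: test_set_def)
  have F: "finite (ray W N \<sigma> ` test_set)" "ray W N \<sigma> ` test_set \<subseteq> carrier W \<times> S"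
    using ray_mem P by (auto simp: test_set_def)
  obtain w s where ws: "ray W N \<sigma> (i, j) = (w, s)" "w \<in> carrier W" "s \<in> S" using ray_mem[OF g] by auto
  show ?thesis using sr_mem_Cl_iff[OF F ws(2,3)] ray_dual[of test_set, OF P g] unfolding ws(1)
    by (simp add: test_set_def)
qed

lemma quasi_piecewise:
  assumes "N \<ge> 4"
  shows "quasi N q (\<lambda>i. (if i mod int N \<in> {0, 1} then \<alpha> else \<beta>) * (if q = 1 then 1 else q powi (i div int N)))"
  using q N by (simp add: quasi_def power_int_add)

text \<open>The two memberships together detect all three signs of q - 1: for q = 1 neither holds,
  because the values on the classes 0 and 2 are then unrelated.\<close>

lemma test_cone_iff:
  assumes N4: "N \<ge> 4"
  shows "(case ray W N \<sigma> (0, 2) of (w, s) \<Rightarrow> sr w s) \<in> Cl ((\<lambda>(w, s). sr w s) ` ray W N \<sigma> ` test_set) \<longleftrightarrow> q < 1"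
    and "(case ray W N \<sigma> (2, 0) of (w, s) \<Rightarrow> sr w s) \<in> Cl ((\<lambda>(w, s). sr w s) ` ray W N \<sigma> ` test_set) \<longleftrightarrow> q > 1"
proof -
  \<comment> \<open>Equal base values within the classes 0, 1 and within the classes 2, 3 reduce the
    test conditions to a sign condition on each of \<alpha> and \<beta>; the pairs (- 1, 1) and (1,
    - 1) serve as counterexamples below.\<close>
  define \<zeta> where "\<zeta> \<alpha> \<beta> i = (if i mod int N \<in> {0, 1} then \<alpha> else \<beta>) * (if q = 1 then 1 else q powi (i div int N))" for \<alpha> \<beta> :: real and i
  have qu: "quasi N q (\<zeta> \<alpha> \<beta>)" for \<alpha> \<beta> unfolding \<zeta>_def using quasi_piecewise[OF N4] .
  have \<zeta>: "\<zeta> \<alpha> \<beta> 0 = \<alpha>" "\<zeta> \<alpha> \<beta> 1 = \<alpha>" "\<zeta> \<alpha> \<beta> 2 = \<beta>" "\<zeta> \<alpha> \<beta> 3 = \<beta>"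
    "\<zeta> \<alpha> \<beta> (int N) = q * \<alpha>" "\<zeta> \<alpha> \<beta> (int N + 2) = q * \<beta>" for \<alpha> \<beta>
    using N4 by (auto simp: \<zeta>_def)
  define T where "T z \<longleftrightarrow> z 1 \<le> z 0 \<and> z (int N) \<le> z 1 \<and> z 2 \<le> z 3 \<and> z 3 \<le> z (int N + 2)" for z :: "int \<Rightarrow> real"
  have T\<zeta>: "T (\<zeta> \<alpha> \<beta>) \<longleftrightarrow> q * \<alpha> \<le> \<alpha> \<and> \<beta> \<le> q * \<beta>" for \<alpha> \<beta> unfolding T_def \<zeta> by simp
  have Tz: "(1 - q) * z 0 \<ge> 0 \<and> (1 - q) * z 2 \<le> 0" if "T z" "quasi N q z" "q \<noteq> 1" for z
  proof -
    have zz: "\<forall>i. z (i + int N) = q * z i" using that(2,3) by (simp add: quasi_not_one)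
    have "z (0 + int N) = q * z 0" "z (2 + int N) = q * z 2" using zz by blast+
    then show ?thesis using that(1) by (auto simp: T_def algebra_simps)
  qed
  note m = test_membership[OF reach_test(5)[OF N4] N4] test_membership[OF reach_test(6)[OF N4] N4]
  show "(case ray W N \<sigma> (0, 2) of (w, s) \<Rightarrow> sr w s) \<in> Cl ((\<lambda>(w, s). sr w s) ` ray W N \<sigma> ` test_set) \<longleftrightarrow> q < 1"
    unfolding m(1) T_def[symmetric]
  proof
    assume a: "\<forall>z. quasi N q z \<longrightarrow> T z \<longrightarrow> z 2 \<le> z 0"
    show "q < 1"
    proof (rule ccontr)
      assume "\<not> q < 1"
      then have "T (\<zeta> (- 1) 1)" unfolding T\<zeta> by simp
      then have "\<zeta> (- 1) 1 2 \<le> \<zeta> (- 1) 1 0" using a qu by blast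
      then show False unfolding \<zeta> by simp
    qed
  next
    assume q1: "q < 1"
    show "\<forall>z. quasi N q z \<longrightarrow> T z \<longrightarrow> z 2 \<le> z 0"
    proof (intro allI impI)
      fix z assume "quasi N q z" "T z"
      then have "(1 - q) * z 0 \<ge> 0" "(1 - q) * z 2 \<le> 0" using Tz q1 by auto
      then have "z 0 \<ge> 0" "z 2 \<le> 0" using q1 by (auto simp: zero_le_mult_iff mult_le_0_iff)
      then show "z 2 \<le> z 0" by simp
    qed
  qed
  show "(case ray W N \<sigma> (2, 0) of (w, s) \<Rightarrow> sr w s) \<in> Cl ((\<lambda>(w, s). sr w s) ` ray W N \<sigma> ` test_set) \<longleftrightarrow> q > 1"
    unfolding m(2) T_def[symmetric]
  proof
    assume a: "\<forall>z. quasi N q z \<longrightarrow> T z \<longrightarrow> z 0 \<le> z 2"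
    show "q > 1"
    proof (rule ccontr)
      assume "\<not> q > 1"
      then have "T (\<zeta> 1 (- 1))" unfolding T\<zeta> by simp
      then have "\<zeta> 1 (- 1) 0 \<le> \<zeta> 1 (- 1) 2" using a qu by blast
      then show False unfolding \<zeta> by simp
    qed
  next
    assume q1: "q > 1"
    show "\<forall>z. quasi N q z \<longrightarrow> T z \<longrightarrow> z 0 \<le> z 2"
    proof (intro allI impI)
      fix z assume "quasi N q z" "T z"
      then have "(1 - q) * z 0 \<ge> 0" "(1 - q) * z 2 \<le> 0" using Tz q1 by auto
      then have "z 0 \<le> 0" "z 2 \<ge> 0" using q1 by (auto simp: zero_le_mult_iff mult_le_0_iff)
      then show "z 0 \<le> z 2" by simp
    qed
  qed
qed

end

lemma cyclic_Cl_distinct: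
  assumes "cyclic W S a N \<sigma> q" "cyclic W S b N \<sigma> q'" "N \<ge> 4" "sgn (q - 1) \<noteq> sgn (q' - 1)"
  shows "coxeter_matrix.Cl W S a \<noteq> coxeter_matrix.Cl W S b"
proof
  interpret a: cyclic W S a N \<sigma> q by (rule assms)
  interpret b: cyclic W S b N \<sigma> q' by (rule assms)
  assume eq: "a.Cl = b.Cl"
  have "a.test_set = b.test_set" unfolding a.test_set_def b.test_set_def ..
  then have "q < 1 \<longleftrightarrow> q' < 1" "q > 1 \<longleftrightarrow> q' > 1"
    using a.test_cone_iff[OF assms(3)] b.test_cone_iff[OF assms(3)] eq by metis+
  then show False using assms(4) by (auto simp: sgn_if split: if_splits)
qed

section \<open>Matrices of type A tilde and of rank two\<close>

definition cycm :: "nat \<Rightarrow> (nat \<Rightarrow> 'g) \<Rightarrow> real \<Rightarrow> 'g \<Rightarrow> 'g \<Rightarrow> real" where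
  "cycm N \<sigma> q s t = cyc q N (the_inv_into {..<N} \<sigma> s) (the_inv_into {..<N} \<sigma> t)"

lemma cycm_index: "bij_betw \<sigma> {..<N} S \<Longrightarrow> i < N \<Longrightarrow> j < N \<Longrightarrow> cycm N \<sigma> q (\<sigma> i) (\<sigma> j) = cyc q N i j"
  by (simp add: cycm_def bij_betw_def the_inv_into_f_f)

lemma cyclic_cycm:
  assumes "coxeter_matrix W S (cycm N \<sigma> q)" "N \<ge> 2" "bij_betw \<sigma> {..<N} S" "q > 0"
  shows "cyclic W S (cycm N \<sigma> q) N \<sigma> q"
  using assms by (intro cyclic.intro cyclic_axioms.intro) (auto simp: cycm_index)

lemma cyc_self: "cyc q N i i = 2"
  by (simp add: cyc_def)

lemma cyc_next:
  assumes "N \<ge> 3" "i < N"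
  shows "cyc q N i (Suc i mod N) = - (if Suc i = N then q else 1)"
    "cyc q N (Suc i mod N) i = - (if Suc i = N then 1 / q else 1)"
  using assms by (cases "Suc i = N"; auto simp: cyc_def mod_Suc)+

lemma cyc_other: "i \<noteq> j \<Longrightarrow> j \<noteq> Suc i mod N \<Longrightarrow> i \<noteq> Suc j mod N \<Longrightarrow> cyc q N i j = 0"
  by (simp add: cyc_def)

text \<open>A column as a sum of three point masses, so that sums over it can be evaluated. For N =
  2 the two off-diagonal ones fall on the same index and add up.\<close>

lemma cyc_as_delta:
  assumes "N \<ge> 2" "i < N" "j < N"
  shows "cyc q N i j = (if i = j then 2 else 0) - (if i = (if j = 0 then N - 1 else j - 1) then (if j = 0 then q else 1) else 0)
    - (if i = Suc j mod N then (if Suc j = N then 1 / q else 1) else 0)"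
proof -
  have 1: "j = Suc i mod N \<longleftrightarrow> i = (if j = 0 then N - 1 else j - 1)"
    using assms by (cases "Suc i = N") auto
  have 2: "Suc i = N \<longleftrightarrow> j = 0" if "j = Suc i mod N" using that assms by (cases "Suc i = N") auto
  have 3: "i \<noteq> (if j = 0 then N - 1 else j - 1)" "i \<noteq> Suc j mod N" if "i = j"
    using that assms by (auto simp: mod_Suc)
  show ?thesis
  proof (cases "i = j")
    case True
    then show ?thesis using 3 by (simp add: cyc_def)
  next
    case False
    then show ?thesis using 1 2 by (auto simp: cyc_def)
  qed
qed

text \<open>A kernel vector is an arithmetic progression along the cycle, whose difference v is also
  y 0 - q y (N - 1) at the closing edge. The last equation gives q v = v, so v = 0 or q = 1; in the
  latter case going round gives N v = 0. The vector is therefore constant.\<close>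

lemma definite_kernel_cycm:
  assumes N: "N \<ge> 2" and bij: "bij_betw \<sigma> {..<N} S" and q: "q > 0"
  shows "definite_kernel S (cycm N \<sigma> q)"
  unfolding definite_kernel_def
proof (intro allI impI)
  fix x assume x: "\<forall>t\<in>S. colin (cycm N \<sigma> q) S t x = 0"
  have inj: "inj_on \<sigma> {..<N}" and im: "S = \<sigma> ` {..<N}" using bij by (auto simp: bij_betw_def)
  define y where "y i = x (\<sigma> i)" for i
  have eq: "2 * y j = y (if j = 0 then N - 1 else j - 1) * (if j = 0 then q else 1)
      + y (Suc j mod N) * (if Suc j = N then 1 / q else 1)" if j: "j < N" for j
  proof -
    have "colin (cycm N \<sigma> q) S (\<sigma> j) x = (\<Sum>i<N. y i * cyc q N i j)"
      unfolding colin_def im sum.reindex[OF inj] y_def by (intro sum.cong) (auto simp: cycm_index[OF bij] j)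
    also have "\<dots> = (\<Sum>i<N. (if i = j then 2 * y i else 0)
       - (if i = (if j = 0 then N - 1 else j - 1) then y i * (if j = 0 then q else 1) else 0)
       - (if i = Suc j mod N then y i * (if Suc j = N then 1 / q else 1) else 0))"
    proof (intro sum.cong refl)
      fix i assume "i \<in> {..<N}"
      then have i: "i < N" by simp
      have dist: "y i * ((if b1 then 2 else 0) - (if b2 then A else 0) - (if b3 then B else 0))
        = (if b1 then 2 * y i else 0) - (if b2 then y i * A else 0) - (if b3 then y i * B else 0)" for b1 b2 b3 A B
        by (auto simp: algebra_simps)
      show "y i * cyc q N i j = (if i = j then 2 * y i else 0)
       - (if i = (if j = 0 then N - 1 else j - 1) then y i * (if j = 0 then q else 1) else 0)
       - (if i = Suc j mod N then y i * (if Suc j = N then 1 / q else 1) else 0)"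
        unfolding cyc_as_delta[OF N i j] by (rule dist)
    qed
    also have "\<dots> = 2 * y j - y (if j = 0 then N - 1 else j - 1) * (if j = 0 then q else 1)
      - y (Suc j mod N) * (if Suc j = N then 1 / q else 1)"
    proof -
      have "j - Suc 0 < N" "N - Suc 0 < N" "Suc j mod N < N" using j N by auto
      then show ?thesis using j by (simp add: sum_subtractf sum.delta)
    qed
    finally show ?thesis using x im j by auto
  qed
  define v where "v = y 0 - q * y (N - 1)"
  have step: "y j = y 0 + real j * v" if "j < N" for j
    using that
  proof (induction j rule: induct_nat_012)
    case 1
    then show ?case using eq[of 0] N by (simp add: v_def)
  next
    case (ge2 n)
    have "2 * y (Suc n) = y n + y (Suc (Suc n))" using eq[of "Suc n"] ge2.prems by simp
    then show ?case using ge2 by (simp add: algebra_simps)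
  qed simp
  have last: "q * (y (N - 1) - y (N - 2)) = v"
  proof -
    have "2 * y (N - 1) = y (N - 1 - 1) + y 0 * (1 / q)" using eq[of "N - 1"] N by (simp add: Suc_diff_Suc)
    moreover have "N - 1 - 1 = N - 2" by simp
    ultimately have "q * (2 * y (N - 1)) = q * (y (N - 2) + y 0 * (1 / q))" by metis
    then show ?thesis using q by (simp add: v_def algebra_simps)
  qed
  have "y (N - 1) - y (N - 2) = v" using step[of "N - 1"] step[of "N - 2"] N by (simp add: of_nat_diff algebra_simps)
  then have qv: "q * v = v" using last by simp
  have "v = 0 \<and> (q = 1 \<or> y 0 = 0)"
  proof (cases "q = 1")
    case True
    have "y (N - 1) = y 0 + (real N - 1) * v" using step[of "N - 1"] N by (simp add: of_nat_diff)
    then have "y (N - 1) = y 0 + real N * v - v" by (simp add: algebra_simps)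
    moreover have "v = y 0 - y (N - 1)" using True by (simp add: v_def)
    ultimately have "real N * v = 0" by linarith
    then show ?thesis using N True by simp
  next
    case False
    then have v0: "v = 0" using qv by simp
    then have "y 0 = q * y 0" using step[of "N - 1"] N by (simp add: v_def)
    then show ?thesis using v0 False by simp
  qed
  then have "x (\<sigma> i) = y 0" if "i < N" for i using step[OF that] by (simp add: y_def)
  then show "(\<forall>s\<in>S. x s \<ge> 0) \<or> (\<forall>s\<in>S. x s \<le> 0)" unfolding im by (cases "y 0 \<ge> 0") auto
qed

section \<open>Cycles of length at least three\<close>

locale coxeter_cycle = coxeter W S for W :: "('g, 'b) monoid_scheme" (structure) and S +
  fixes N :: nat and \<sigma> :: "nat \<Rightarrow> 'g"
  assumes N: "N \<ge> 3" and bij: "bij_betw \<sigma> {..<N} S"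
    and ords: "\<And>i j. i < N \<Longrightarrow> j < N \<Longrightarrow> i \<noteq> j \<Longrightarrow>
      ord (\<sigma> i \<otimes> \<sigma> j) = (if j = Suc i mod N \<or> i = Suc j mod N then 3 else 2)"
begin

lemma \<sigma>_mem: "i < N \<Longrightarrow> \<sigma> i \<in> S" and \<sigma>_onto: "s \<in> S \<Longrightarrow> \<exists>i<N. s = \<sigma> i"
  and \<sigma>_eq: "i < N \<Longrightarrow> j < N \<Longrightarrow> \<sigma> i = \<sigma> j \<longleftrightarrow> i = j"
  using bij by (auto simp: bij_betw_def inj_on_def)

lemma cycm_cartan:
  assumes q: "q > 0" shows "cartan W S (cycm N \<sigma> q)"
  unfolding cartan_def
proof (intro conjI ballI impI)
  fix s assume "s \<in> S"
  then show "cycm N \<sigma> q s s = 2" using \<sigma>_onto cycm_index[OF bij] cyc_self by metis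
next
  fix s t assume st: "s \<in> S" "t \<in> S" "s \<noteq> t"
  obtain i j where ij: "i < N" "s = \<sigma> i" "j < N" "t = \<sigma> j" using st \<sigma>_onto by metis
  then have ne: "i \<noteq> j" using st by auto
  have c: "cycm N \<sigma> q s t = cyc q N i j" "cycm N \<sigma> q t s = cyc q N j i" using ij cycm_index[OF bij] by auto
  consider "j = Suc i mod N" | "i = Suc j mod N" | "j \<noteq> Suc i mod N" "i \<noteq> Suc j mod N" by blast
  then have "cyc q N i j \<le> 0 \<and> (cyc q N i j = 0 \<longleftrightarrow> cyc q N j i = 0) \<and>
    cyc q N i j * cyc q N j i = (if j = Suc i mod N \<or> i = Suc j mod N then 1 else 0)"
  proof cases
    case 1
    then show ?thesis using cyc_next[OF N ij(1), of q] q by auto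
  next
    case 2
    then show ?thesis using cyc_next[OF N ij(3), of q] q by auto
  next
    case 3
    then show ?thesis using cyc_other[OF ne 3, of q] cyc_other[OF ne[symmetric] 3(2,1), of q] by simp
  qed
  moreover have "ord (s \<otimes> t) = (if j = Suc i mod N \<or> i = Suc j mod N then 3 else 2)"
    using ords ij ne by simp
  ultimately show "cycm N \<sigma> q s t \<le> 0" "cycm N \<sigma> q s t = 0 \<longleftrightarrow> cycm N \<sigma> q t s = 0"
    "if ord (s \<otimes> t) = 0 then cycm N \<sigma> q s t * cycm N \<sigma> q t s \<ge> 4
       else cycm N \<sigma> q s t * cycm N \<sigma> q t s = 4 * (cos (pi / real (ord (s \<otimes> t))))\<^sup>2"
    unfolding c by (auto simp: cos_60 power2_eq_square)
qed

lemma cycm_cyclic: "q > 0 \<Longrightarrow> cyclic W S (cycm N \<sigma> q) N \<sigma> q"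
  using cycm_cartan N bij by (intro cyclic_cycm coxeter_matrix.intro coxeter_matrix_axioms.intro coxeter_axioms) auto

text \<open>Scaling successively along the cycle turns every entry to the next vertex into - 1
  except at the closing edge. What remains there is q, the product of all
  \<open>- a (\<sigma> i) (\<sigma> (Suc i mod N))\<close>, which rescaling cannot change.\<close>

lemma rescaled_cycm:
  assumes m: "coxeter_matrix W S a" shows "\<exists>q>0. rescaled S a (cycm N \<sigma> q)"
proof -
  interpret ma: coxeter_matrix W S a by (rule m)
  have sN: "Suc i mod N < N" "Suc i mod N \<noteq> i" if "i < N" for i using that N by (auto simp: mod_Suc)
  have prod: "a (\<sigma> i) (\<sigma> (Suc i mod N)) * a (\<sigma> (Suc i mod N)) (\<sigma> i) = 1" if i: "i < N" for i
    using ma.a_finite[OF \<sigma>_mem[OF i] \<sigma>_mem[OF sN(1)[OF i]]] sN[OF i] ords[OF i sN(1)[OF i]] \<sigma>_eq[OF i sN(1)[OF i]]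
    by (auto simp: cos_60 power2_eq_square)
  have other: "a (\<sigma> i) (\<sigma> j) = 0" if ij: "i < N" "j < N" "i \<noteq> j" "j \<noteq> Suc i mod N" "i \<noteq> Suc j mod N" for i j
  proof -
    have "a (\<sigma> i) (\<sigma> j) * a (\<sigma> j) (\<sigma> i) = 0"
      using ma.a_finite[OF \<sigma>_mem[OF ij(1)] \<sigma>_mem[OF ij(2)]] ords[OF ij(1-3)] ij \<sigma>_eq by simp
    then show ?thesis using ma.a_zero[OF \<sigma>_mem[OF ij(1)] \<sigma>_mem[OF ij(2)]] by auto
  qed
  have neg: "a (\<sigma> i) (\<sigma> (Suc i mod N)) < 0" if i: "i < N" for i
    using ma.a_nonpos[OF \<sigma>_mem[OF i] \<sigma>_mem[OF sN(1)[OF i]]] prod[OF i] sN[OF i] \<sigma>_eq[OF i sN(1)[OF i]]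
    by (metis less_eq_real_def mult_zero_left zero_neq_one)
  \<comment> \<open>Each factor is chosen to normalize the entry from the preceding vertex; the
    product accumulated in \<open>d (N - 1)\<close> is corrected in \<open>q\<close>.\<close>
  define d where "d = rec_nat 1 (\<lambda>i r. r / (- a (\<sigma> i) (\<sigma> (Suc i))))"
  have d0: "d 0 = 1" and dS: "d (Suc i) = d i / (- a (\<sigma> i) (\<sigma> (Suc i)))" for i by (simp_all add: d_def)
  have dpos: "d i > 0" if "i < N" for i
    using that
  proof (induction i)
    case (Suc i)
    then have "Suc i mod N = Suc i" "a (\<sigma> i) (\<sigma> (Suc i mod N)) < 0" using neg[of i] by auto
    then show ?case unfolding dS using Suc by (intro divide_pos_pos) auto
  qed (simp add: d0)
  define q where "q = - a (\<sigma> (N - 1)) (\<sigma> 0) / d (N - 1)"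
  have "a (\<sigma> (N - 1)) (\<sigma> 0) < 0" using neg[of "N - 1"] N by (simp add: Suc_diff_Suc)
  then have q: "q > 0" unfolding q_def using dpos[of "N - 1"] N by (intro divide_pos_pos) auto
  have nxt: "a (\<sigma> i) (\<sigma> (Suc i mod N)) = d i / d (Suc i mod N) * cyc q N i (Suc i mod N)" if i: "i < N" for i
  proof (cases "Suc i = N")
    case True
    then have "i = N - 1" by simp
    then show ?thesis using cyc_next(1)[OF N i, of q] True d0 dpos[OF i] by (simp add: q_def)
  next
    case False
    then have "Suc i < N" using i by simp
    then show ?thesis using cyc_next(1)[OF N i, of q] dS[of i] dpos[OF i] neg[OF i] False by simp
  qed
  have prv: "a (\<sigma> (Suc i mod N)) (\<sigma> i) = d (Suc i mod N) / d i * cyc q N (Suc i mod N) i" if i: "i < N" for i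
  proof -
    have c: "cyc q N (Suc i mod N) i = 1 / cyc q N i (Suc i mod N)" using cyc_next[OF N i, of q] by auto
    have "a (\<sigma> (Suc i mod N)) (\<sigma> i) = 1 / a (\<sigma> i) (\<sigma> (Suc i mod N))"
      using prod[OF i] neg[OF i] by (simp add: field_simps)
    then show ?thesis unfolding nxt[OF i] c by simp
  qed
  have all: "a (\<sigma> i) (\<sigma> j) = d i / d j * cyc q N i j" if ij: "i < N" "j < N" for i j
  proof -
    consider "i = j" | "j = Suc i mod N" | "i = Suc j mod N" | "i \<noteq> j" "j \<noteq> Suc i mod N" "i \<noteq> Suc j mod N" by blast
    then show ?thesis
    proof cases
      case 1
      then show ?thesis using dpos[OF ij(1)] ma.a_diag[OF \<sigma>_mem[OF ij(1)]] by (simp add: cyc_self)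
    next
      case 2
      then show ?thesis using nxt[OF ij(1)] by simp
    next
      case 3
      then show ?thesis using prv[OF ij(2)] by simp
    next
      case 4
      then show ?thesis using other[OF ij] cyc_other by simp
    qed
  qed
  define e where "e s = d (the_inv_into {..<N} \<sigma> s)" for s
  have e: "e (\<sigma> i) = d i" if "i < N" for i using that bij by (simp add: e_def bij_betw_def the_inv_into_f_f)
  have "rescaled S a (cycm N \<sigma> q)"
    unfolding rescaled_def
  proof (intro exI[of _ e] conjI ballI)
    fix s assume "s \<in> S"
    then show "e s > 0" using \<sigma>_onto e dpos by metis
  next
    fix s t assume "s \<in> S" "t \<in> S"
    then obtain i j where ij: "i < N" "s = \<sigma> i" "j < N" "t = \<sigma> j" using \<sigma>_onto by metis
    then show "a s t = e s / e t * cycm N \<sigma> q s t" using all[of i j] e cycm_index[OF bij] by simp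
  qed
  then show ?thesis using q by blast
qed

lemma Cl_eq_if_sgn:
  assumes "coxeter_matrix W S a" "rescaled S a (cycm N \<sigma> q)" "q > 0" "q' > 0" "sgn (q - 1) = sgn (q' - 1)"
  shows "coxeter_matrix.Cl W S a = coxeter_matrix.Cl W S (cycm N \<sigma> q')"
proof -
  have c: "cyclic W S (cycm N \<sigma> q) N \<sigma> q" "cyclic W S (cycm N \<sigma> q') N \<sigma> q'" using cycm_cyclic assms by auto
  show ?thesis
    using Cl_rescaled[OF assms(1) cyclic.axioms(1)[OF c(1)] assms(2)] cyclic_Cl_eq_sgn[OF c assms(5)] by simp
qed

lemma definite_kernel: "coxeter_matrix W S a \<Longrightarrow> definite_kernel S a"
proof -
  assume "coxeter_matrix W S a"
  then obtain q where "q > 0" "rescaled S a (cycm N \<sigma> q)" using rescaled_cycm by blast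
  moreover have "N \<ge> 2" using N by simp
  ultimately show "definite_kernel S a" using definite_kernel_rescaled definite_kernel_cycm[OF _ bij] by blast
qed

lemma triangle_Cl:
  assumes "N = 3" "coxeter_matrix W S a" "coxeter_matrix W S b"
  shows "coxeter_matrix.Cl W S a = coxeter_matrix.Cl W S b"
proof -
  obtain q q' where q: "q > 0" "rescaled S a (cycm N \<sigma> q)" "q' > 0" "rescaled S b (cycm N \<sigma> q')"
    using rescaled_cycm assms by blast
  have c: "cyclic W S (cycm N \<sigma> q) N \<sigma> q" "cyclic W S (cycm N \<sigma> q') N \<sigma> q'" using cycm_cyclic q by auto
  show ?thesis
    using Cl_rescaled[OF assms(2) cyclic.axioms(1)[OF c(1)] q(2)] Cl_rescaled[OF assms(3) cyclic.axioms(1)[OF c(2)] q(4)]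
      cyclic_Cl_eq_small[OF c] assms(1) by simp
qed

end

lemma (in coxeter) type_A_tilde_cycle:
  assumes "type_A_tilde n W S" shows "\<exists>\<sigma>. coxeter_cycle W S (n + 1) \<sigma>"
proof -
  obtain \<sigma> where n: "n \<ge> 2" and bij: "bij_betw \<sigma> {..n} S" and o: "\<forall>i\<le>n. \<forall>j\<le>n. i \<noteq> j \<longrightarrow>
    ord (\<sigma> i \<otimes> \<sigma> j) = (if j = (i + 1) mod (n + 1) \<or> i = (j + 1) mod (n + 1) then 3 else 2)"
    using assms unfolding type_A_tilde_def by blast
  have "coxeter_cycle W S (n + 1) \<sigma>"
    using n bij o by (intro coxeter_cycle.intro coxeter_cycle_axioms.intro coxeter_axioms)
      (auto simp: lessThan_Suc_atMost)
  then show ?thesis by blast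
qed

section \<open>Rank at most two, and the affine case\<close>

context coxeter
begin

text \<open>The infinite dihedral group as a cycle of length 2. The product of the entries of
  \<open>cyc\<close> is (1 + 1 / q) (1 + q), so q + 1 / q = p - 2 is required; it has a positive
  solution because p is at least 4.\<close>

lemma rank_two_cyclic:
  assumes m: "coxeter_matrix W S a" and S: "S = {s, t}" and st: "s \<noteq> t" and inf: "ord (s \<otimes> t) = 0"
  shows "\<exists>b q. cyclic W S b 2 (\<lambda>i. if i = 0 then s else t) q \<and> rescaled S a b"
proof -
  interpret ma: coxeter_matrix W S a by (rule m)
  let ?\<sigma> = "\<lambda>i::nat. if i = 0 then s else t"
  define p where "p = a s t * a t s"
  have p: "p \<ge> 4" unfolding p_def using ma.a_infinite[of s t] S st inf by simp
  \<comment> \<open>The square root of the discriminant of q^2 - (p - 2) q + 1.\<close>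
  define r where "r = sqrt ((p - 2)\<^sup>2 - 4)"
  define q where "q = ((p - 2) + r) / 2"
  have "2\<^sup>2 \<le> (p - 2)\<^sup>2" using p by (intro power_mono) auto
  then have r: "r \<ge> 0" "r\<^sup>2 = (p - 2)\<^sup>2 - 4" by (auto simp: r_def)
  have q: "q > 0" using p r by (simp add: q_def)
  have "q\<^sup>2 - (p - 2) * q + 1 = (r\<^sup>2 - (p - 2)\<^sup>2) / 4 + 1"
    by (simp add: q_def power2_eq_square field_simps)
  then have "q\<^sup>2 - (p - 2) * q + 1 = 0" unfolding r(2) by simp
  then have qp: "(1 + 1 / q) * (1 + q) = p" using q by (simp add: field_simps power2_eq_square)
  have bij: "bij_betw ?\<sigma> {..<2} S"
  proof -
    have "{..<2::nat} = {0, 1}" by auto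
    then show ?thesis using st by (auto simp: bij_betw_def S)
  qed
  define b where "b = cycm 2 ?\<sigma> q"
  have b: "b s s = 2" "b t t = 2" "b s t = - (1 + 1 / q)" "b t s = - (1 + q)"
    using cycm_index[OF bij, of 0 0 q] cycm_index[OF bij, of 1 1 q] cycm_index[OF bij, of 0 1 q] cycm_index[OF bij, of 1 0 q]
    by (auto simp: b_def cyc_def)
  have "1 + 1 / q > 0" using q by (simp add: add_pos_pos)
  have bb: "b s t * b t s \<ge> 4" "b t s * b s t \<ge> 4"
    using p qp unfolding b(3,4) by (simp_all only: minus_mult_minus mult.commute)
  have neg: "b s t < 0" "b t s < 0" using \<open>1 + 1 / q > 0\<close> q unfolding b(3,4) by linarith+
  have "ord (t \<otimes> s) = 0" using ord_commute[of s t] S inf by simp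
  then have "cartan W S b"
    unfolding cartan_def S using b(1,2) bb neg inf by auto
  then have cy: "cyclic W S b 2 ?\<sigma> q"
    unfolding b_def using bij q by (intro cyclic_cycm coxeter_matrix.intro coxeter_matrix_axioms.intro coxeter_axioms) auto
  define d where "d r = (if r = s then 1 else (1 + 1 / q) / (- a s t))" for r
  have nz: "a s t < 0" using p ma.a_nonpos[of s t] S st by (force simp: p_def less_le)
  define g where "g = 1 + 1 / q"
  have g: "g > 0" "g * (1 + q) = p" "b s t = - g" using \<open>1 + 1 / q > 0\<close> qp b(3) by (simp_all only: g_def)
  have d: "d s = 1" "d t = g / (- a s t)" using st by (simp_all add: d_def g_def)
  have e1: "a s t = d s / d t * b s t" unfolding d g(3) using nz g(1) by simp
  have "a t s = p / a s t" using nz by (simp add: p_def)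
  then have e2: "a t s = d t / d s * b t s" unfolding d b(4) g(2)[symmetric]
    by (simp only: mult_minus_right minus_divide_right[symmetric] mult_minus_left minus_minus div_by_1 times_divide_eq_left)
  have "rescaled S a b"
    unfolding rescaled_def
  proof (intro exI[of _ d] conjI ballI)
    fix r u assume ru: "r \<in> S" "u \<in> S"
    show "a r u = d r / d u * b r u"
    proof (cases "r = u")
      case True
      have "d r > 0" using ru(1) S d g(1) nz by (auto simp: divide_pos_neg)
      then show ?thesis using True ru(1) ma.a_diag[OF ru(1)] b(1,2) S by auto
    next
      case False
      then show ?thesis using ru e1 e2 unfolding S by blast
    qed
  qed (use nz \<open>1 + 1 / q > 0\<close> in \<open>auto simp: d_def divide_pos_neg\<close>)
  then show ?thesis using cy by blast
qed

lemma small_rank_cases: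
  assumes "card S \<le> 2" "s \<in> S" "t \<in> S" "s \<noteq> t" shows "S = {s, t}"
proof (rule card_seteq[symmetric, OF finS])
  show "card S \<le> card {s, t}" using assms by simp
qed (use assms in auto)

text \<open>For two generators a single kernel equation expresses one coefficient as a nonnegative
  multiple of the other.\<close>

lemma small_rank_definite_kernel:
  assumes c: "card S \<le> 2" and m: "coxeter_matrix W S a" shows "definite_kernel S a"
  unfolding definite_kernel_def
proof (intro allI impI)
  interpret ma: coxeter_matrix W S a by (rule m)
  fix x assume x: "\<forall>t\<in>S. colin a S t x = 0"
  show "(\<forall>s\<in>S. x s \<ge> 0) \<or> (\<forall>s\<in>S. x s \<le> 0)"
  proof (cases "\<exists>s\<in>S. \<exists>t\<in>S. s \<noteq> t")
    case True
    then obtain s t where st: "s \<in> S" "t \<in> S" "s \<noteq> t" by blast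
    then have S: "S = {s, t}" using small_rank_cases c by blast
    have "colin a S s x = 0" using x st(1) by blast
    then have "x s * 2 + x t * a t s = 0" using st ma.a_diag[OF st(1)] by (simp add: colin_def S)
    then have "2 * x s = - a t s * x t" by (simp add: mult.commute)
    moreover have "- a t s \<ge> 0" using ma.a_nonpos[OF st(2,1)] st by simp
    ultimately have "x t \<ge> 0 \<Longrightarrow> x s \<ge> 0" "x t \<le> 0 \<Longrightarrow> x s \<le> 0"
      using mult_nonneg_nonneg[of "- a t s" "x t"] mult_nonneg_nonpos[of "- a t s" "x t"] by linarith+
    then show ?thesis unfolding S by (cases "x t \<ge> 0") auto
  next
    case False
    show ?thesis
    proof (cases "S = {}")
      case ne: False
      then obtain s where "S = {s}" using False by blast
      then show ?thesis by (cases "x s \<ge> 0") auto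
    qed simp
  qed
qed

lemma small_rank_Cl:
  assumes c: "card S \<le> 2" and m: "coxeter_matrix W S a" "coxeter_matrix W S b"
  shows "coxeter_matrix.Cl W S a = coxeter_matrix.Cl W S b"
proof (cases "\<exists>s\<in>S. \<exists>t\<in>S. s \<noteq> t \<and> ord (s \<otimes> t) = 0")
  case True
  then obtain s t where st: "s \<in> S" "t \<in> S" "s \<noteq> t" "ord (s \<otimes> t) = 0" by blast
  then have S: "S = {s, t}" using small_rank_cases c by blast
  obtain a' q where a': "cyclic W S a' 2 (\<lambda>i. if i = 0 then s else t) q" "rescaled S a a'"
    using rank_two_cyclic[OF m(1) S st(3,4)] by blast
  obtain b' q' where b': "cyclic W S b' 2 (\<lambda>i. if i = 0 then s else t) q'" "rescaled S b b'"
    using rank_two_cyclic[OF m(2) S st(3,4)] by blast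
  show ?thesis
    using Cl_rescaled[OF m(1) cyclic.axioms(1)[OF a'(1)] a'(2)] Cl_rescaled[OF m(2) cyclic.axioms(1)[OF b'(1)] b'(2)]
      cyclic_Cl_eq_small[OF a'(1) b'(1)] by simp
next
  case False
  interpret ma: coxeter_matrix W S a by (rule m)
  interpret mb: coxeter_matrix W S b by (rule m)
  have "rescaled S a b"
  proof (rule rescaled_if_forest[OF finS])
    fix X assume X: "X \<subseteq> S" "X \<noteq> {}"
    then obtain s where s: "s \<in> X" by blast
    have "t = u" if "t \<in> X" "u \<in> X" "t \<noteq> s" "u \<noteq> s" for t u
      using small_rank_cases[OF c, of s t] that s X(1) by blast
    then show "\<exists>s\<in>X. \<forall>t\<in>X. \<forall>u\<in>X. t \<noteq> s \<longrightarrow> u \<noteq> s \<longrightarrow> a s t \<noteq> 0 \<longrightarrow> a s u \<noteq> 0 \<longrightarrow> t = u"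
      using s by blast
  next
    fix s t assume "s \<in> S" "t \<in> S" "s \<noteq> t"
    then show "a s t \<le> 0 \<and> b s t \<le> 0 \<and> a s t * a t s = b s t * b t s"
      using ma.a_nonpos mb.a_nonpos ma.product_determined[OF m(2)] False by blast
  qed (use ma.a_diag mb.a_diag ma.a_zero mb.a_zero in auto)
  then show ?thesis by (rule Cl_rescaled[OF m])
qed

text \<open>The only cycles that the hypothesis admits are triangles, on which every q gives the
  same operator.\<close>

lemma affine_unique:
  assumes aff: "irreducible_affine_weyl_group TYPE('e::euclidean_space) W S" and notA: "\<not> (\<exists>n\<ge>3. type_A_tilde n W S)"
    and m: "coxeter_matrix W S a"
  shows "definite_kernel S a \<and> (\<forall>b. coxeter_matrix W S b \<longrightarrow> coxeter_matrix.Cl W S a = coxeter_matrix.Cl W S b)"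
proof (cases "card S \<le> 2")
  case True
  then show ?thesis using small_rank_definite_kernel small_rank_Cl m by blast
next
  case False
  obtain R \<Delta> and \<theta> :: 'e and f where "weyl_root_system R" "simple_system R \<Delta>" "highest_root R \<Delta> \<theta>"
    "coxeter_iso f W S (affine_weyl_group R) (affine_simple_reflections \<Delta> \<theta>)"
    using aff unfolding irreducible_affine_weyl_group_def by blast
  then interpret aw: affine_weyl W S R \<Delta> \<theta> f
    using False by unfold_locales auto
  have cm: "coxeter_matrix W S aw.cm" by unfold_locales (rule aw.cm_cartan)
  show ?thesis
  proof (cases "\<exists>n\<ge>2. type_A_tilde n W S")
    case True
    then obtain n where n: "n \<ge> 2" "type_A_tilde n W S" by blast
    then have "\<not> n \<ge> 3" using notA by blast
    then have "n = 2" using n(1) by linarith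
    obtain \<sigma> where "coxeter_cycle W S (n + 1) \<sigma>" using type_A_tilde_cycle n by blast
    then interpret cc: coxeter_cycle W S "n + 1" \<sigma> .
    show ?thesis using cc.definite_kernel[OF m] cc.triangle_Cl[OF _ m] \<open>n = 2\<close> by simp
  next
    case False
    then have r: "rescaled S b aw.cm" if "coxeter_matrix W S b" for b using aw.rescaled_or_type_A_tilde[OF that] by blast
    have "coxeter_matrix.Cl W S b = coxeter_matrix.Cl W S aw.cm" if "coxeter_matrix W S b" for b
      by (rule Cl_rescaled[OF that cm r[OF that]])
    then show ?thesis using definite_kernel_rescaled[OF r[OF m] aw.cm_definite_kernel] m by simp
  qed
qed

end

section \<open>Existence of realizations\<close>

lemma lookup_scaleR: "Poly_Mapping.lookup (l *\<^sub>R x) i = l *\<^sub>R Poly_Mapping.lookup x i"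
proof -
  have "{i. l *\<^sub>R Poly_Mapping.lookup x i \<noteq> 0} \<subseteq> Poly_Mapping.keys x" by (auto simp: in_keys_iff)
  then have "finite {i. l *\<^sub>R Poly_Mapping.lookup x i \<noteq> 0}" by (rule finite_subset) simp
  then show ?thesis unfolding scaleR_poly_mapping_def by (subst lookup_Abs_poly_mapping) auto
qed

context coxeter_matrix
begin

text \<open>A function vanishing on \<open>S\<close> is fixed by all generators; vectors are total
  functions, so their values outside \<open>S\<close> have to be separated off.\<close>

lemma rho_cong_S:
  assumes w: "w \<in> carrier W" and c: "\<And>r. r \<in> S \<Longrightarrow> c r = c' r" and r: "r \<in> S"
  shows "rho w c r = rho w c' r"
proof -
  define d where "d = (\<lambda>r. c r - c' r)"
  have "gen a S s d = d" for s
    using c by (simp add: gen_def colin_def d_def fun_eq_iff)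
  then have "act a S u d = d" for u by (induction u) auto
  then have "rho w d = d" using rho_as_word[OF w] by metis
  then have "rho w c r - rho w c' r = d r" unfolding d_def using rho_diff[OF w, of c c'] by (metis (no_types))
  then show ?thesis using c[OF r] by (simp add: d_def)
qed

text \<open>Roots and coroots are the same unit vectors, and the matrix enters through the pairing
  alone. The coordinates \<open>co\<close> invert \<open>vc\<close>, so positive independence is
  read off from them and faithfulness is inherited from \<open>rho\<close>.\<close>

lemma realization_exists:
  "\<exists>(D :: (real_inf, real_inf) root_datum) \<phi>. realized_datum_of W S D \<phi> \<and>
     (\<forall>s\<in>S. \<forall>t\<in>S. realized.mat D \<phi> s t = a s t)"
proof -
  obtain h :: "'a \<Rightarrow> nat" where h: "inj_on h S"
    using finite_imp_inj_to_nat_seg[OF finS] by blast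
  define \<alpha> :: "'a \<Rightarrow> real_inf" where "\<alpha> s = Poly_Mapping.single (h s) 1" for s
  define co :: "real_inf \<Rightarrow> 'a \<Rightarrow> real" where "co v r = Poly_Mapping.lookup v (h r)" for v r
  have co_add: "co (v + v') r = co v r + co v' r" and co_scale: "co (l *\<^sub>R v) r = l * co v r"
    and co_zero: "co 0 r = 0" for v v' l r
    by (simp_all add: co_def lookup_add lookup_scaleR)
  have co_sum: "co (sum g I) r = (\<Sum>i\<in>I. co (g i) r)" for g r and I :: "'z set"
    by (simp add: co_def lookup_sum)
  have co_\<alpha>: "co (\<alpha> s) r = coord s r" if "s \<in> S" "r \<in> S" for s r
    using that h by (auto simp: co_def \<alpha>_def coord_def lookup_single when_def inj_on_def)
  have \<alpha>_inj: "inj_on \<alpha> S"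
    using co_\<alpha> by (intro inj_onI) (metis coord_def zero_neq_one)
  define vc where "vc c = (\<Sum>r\<in>S. c r *\<^sub>R \<alpha> r)" for c :: "'a \<Rightarrow> real"
  have co_vc: "co (vc c) r = c r" if "r \<in> S" for c r
    using sum_coord'[OF finS that, of c] that unfolding vc_def co_sum co_scale by (simp add: co_\<alpha>)
  define V where "V = span (\<alpha> ` S)"
  have vc_V: "vc c \<in> V" for c
    unfolding vc_def V_def by (intro span_sum span_scale span_base) auto
  have \<alpha>_V: "\<alpha> s \<in> V" if "s \<in> S" for s unfolding V_def using that by (intro span_base) auto
  have vc_coord: "vc (coord s) = \<alpha> s" if "s \<in> S" for s
    using that by (simp add: vc_def coord_def if_distrib[of "\<lambda>x. x *\<^sub>R _"] finS cong: if_cong)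
  have vc_cong: "vc c = vc c'" if "\<And>r. r \<in> S \<Longrightarrow> c r = c' r" for c c' using that by (simp add: vc_def)
  have vc_co: "vc (co v) = v" if "v \<in> V" for v
    using that unfolding V_def
  proof (induction rule: span_induct_alt)
    case base
    show ?case by (simp add: vc_def co_zero)
  next
    case (step l x y)
    then obtain s where s: "s \<in> S" "x = \<alpha> s" by blast
    have "vc (co (l *\<^sub>R x + y)) = l *\<^sub>R vc (co x) + vc (co y)"
      by (simp add: vc_def co_add co_scale scaleR_left_distrib sum.distrib scaleR_sum_right)
    also have "vc (co x) = vc (coord s)" using s by (intro vc_cong) (simp add: co_\<alpha>)
    finally show ?case using step s vc_coord by simp
  qed
  define B where "B x y = (\<Sum>s\<in>S. \<Sum>t\<in>S. co x s * a s t * co y t)" for x y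
  have B_\<alpha>: "B v (\<alpha> s) = colin a S s (co v)" if "s \<in> S" for v s
    unfolding B_def colin_def using that sum_coord[OF finS that] by (simp add: co_\<alpha> mult.commute[of _ "coord _ _"])
  define D :: "(real_inf, real_inf) root_datum" where
    "D = \<lparr>space_V = V, space_Vd = V, pairing = B, simple = \<alpha> ` S, cosimple = \<alpha> ` S, iota = (\<lambda>x. x)\<rparr>"
  have D: "space_V D = V" "space_Vd D = V" "pairing D = B" "simple D = \<alpha> ` S" "cosimple D = \<alpha> ` S" "iota D x = x" for x
    by (simp_all add: D_def)
  define \<phi> where "\<phi> w = (\<lambda>v\<in>V. vc (rho w (co v)))" for w
  have pos: "positively_independent (\<alpha> ` S)"
    unfolding positively_independent_def
  proof (rule notI, elim exE conjE)
    fix F and c :: "real_inf \<Rightarrow> real" assume F: "finite F" "F \<noteq> {}" "F \<subseteq> \<alpha> ` S" "\<forall>x\<in>F. c x > 0" "(\<Sum>x\<in>F. c x *\<^sub>R x) = 0"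
    obtain s where s: "s \<in> S" "\<alpha> s \<in> F" using F(2,3) by blast
    have "co x s = (if x = \<alpha> s then 1 else 0)" if x: "x \<in> F" for x
    proof -
      obtain r where r: "r \<in> S" "x = \<alpha> r" using x F(3) by blast
      have "x = \<alpha> s \<longleftrightarrow> s = r" using r s \<alpha>_inj by (auto simp: inj_on_def)
      then show ?thesis using co_\<alpha>[OF r(1) s(1)] r by (simp add: coord_def)
    qed
    then have "co (\<Sum>x\<in>F. c x *\<^sub>R x) s = (\<Sum>x\<in>F. if x = \<alpha> s then c x else 0)"
      unfolding co_sum co_scale by (intro sum.cong) auto
    also have "\<dots> = c (\<alpha> s)" using F(1) s by simp
    finally show False using F(4,5) s by (auto simp: co_zero)
  qed
  have "bij_betw (iota D) (\<alpha> ` S) (\<alpha> ` S)" by (simp add: D_def bij_betw_def inj_on_def)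
  moreover have "bilinear_between V V B"
    unfolding bilinear_between_def B_def
    by (simp add: co_add co_scale algebra_simps sum.distrib sum_distrib_left)
  moreover have Bst: "B (\<alpha> s) (\<alpha> t) = a s t" if "s \<in> S" "t \<in> S" for s t
    unfolding B_\<alpha>[OF that(2)] colin_def using sum_coord[OF finS that(1), of "\<lambda>u. a u t"] that by (simp add: co_\<alpha>)
  moreover have "B x x = 2" if "x \<in> \<alpha> ` S" for x using that Bst a_diag by auto
  moreover have "B x y \<le> 0 \<and> (B x y = 0 \<longleftrightarrow> B y x = 0) \<and>
      B x y * B y x \<in> {4 * (cos (pi / real m))\<^sup>2 | m::nat. m \<ge> 2} \<union> {4..}"
    if xy: "x \<in> \<alpha> ` S" "y \<in> \<alpha> ` S" "x \<noteq> y" for x y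
  proof (intro conjI)
    obtain s t where s: "s \<in> S" "x = \<alpha> s" and t: "t \<in> S" "y = \<alpha> t" "s \<noteq> t" using xy by blast
    show "B x y \<le> 0" "B x y = 0 \<longleftrightarrow> B y x = 0" using Bst s t a_nonpos a_zero by auto
    show "B x y * B y x \<in> {4 * (cos (pi / real m))\<^sup>2 | m::nat. m \<ge> 2} \<union> {4..}"
    proof (cases "ord (s \<otimes> t) = 0")
      case True
      then show ?thesis using a_infinite[OF s(1) t(1,3)] Bst s t by simp
    next
      case False
      then have "ord (s \<otimes> t) \<ge> 2" using ord_S_S[OF s(1) t(1,3)] by linarith
      then show ?thesis using a_finite[OF s(1) t(1,3) False] Bst s t by auto
    qed
  qed
  ultimately have rd: "realized_root_datum D"
    unfolding realized_root_datum_def D V_def[symmetric] using pos by blast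
  have \<phi>_V: "\<phi> w v \<in> V" if "v \<in> V" for w v using that vc_V by (simp add: \<phi>_def)
  have \<phi>_mult: "\<phi> (x \<otimes> y) v = \<phi> x (\<phi> y v)" if "x \<in> carrier W" "y \<in> carrier W" "v \<in> V" for x y v
  proof -
    have "vc (rho x (co (vc (rho y (co v))))) = vc (rho x (rho y (co v)))"
      by (intro vc_cong rho_cong_S that co_vc)
    then show ?thesis using that vc_V by (simp add: \<phi>_def rho_mult)
  qed
  have \<phi>_one: "\<phi> \<one> v = v" if "v \<in> V" for v using that vc_co by (simp add: \<phi>_def rho_one)
  have \<phi>_Bij: "\<phi> w \<in> Bij V" if w: "w \<in> carrier W" for w
  proof -
    have "\<phi> (inv w) (\<phi> w v) = v" "\<phi> w (\<phi> (inv w) v) = v" if "v \<in> V" for v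
      using \<phi>_mult[of "inv w" w v] \<phi>_mult[of w "inv w" v] \<phi>_one that w by auto
    then have "bij_betw (\<phi> w) V V"
      using \<phi>_V by (intro bij_betw_byWitness[where f'="\<phi> (inv w)"]) auto
    then show ?thesis by (simp add: Bij_def \<phi>_def)
  qed
  have refl: "\<phi> s = simple_refl D (\<alpha> s)" if s: "s \<in> S" for s
  proof
    fix v
    have "vc (gen a S s (co v)) = vc (co v) - colin a S s (co v) *\<^sub>R vc (coord s)"
      by (simp add: vc_def gen_def scaleR_left_diff_distrib sum_subtractf scaleR_sum_right)
    then show "\<phi> s v = simple_refl D (\<alpha> s) v"
      using s by (simp add: \<phi>_def simple_refl_def D rho_S B_\<alpha> vc_co vc_coord)
  qed
  have hom: "\<phi> \<in> hom W (BijGroup V)"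
  proof (rule homI)
    fix x y assume xy: "x \<in> carrier W" "y \<in> carrier W"
    show "\<phi> x \<in> carrier (BijGroup V)" using \<phi>_Bij xy by (simp add: BijGroup_def)
    have "\<phi> (x \<otimes> y) = compose V (\<phi> x) (\<phi> y)"
    proof
      fix v show "\<phi> (x \<otimes> y) v = compose V (\<phi> x) (\<phi> y) v"
        using \<phi>_mult[OF xy] by (cases "v \<in> V") (auto simp: compose_def \<phi>_def)
    qed
    then show "\<phi> (x \<otimes> y) = \<phi> x \<otimes>\<^bsub>BijGroup V\<^esub> \<phi> y" using \<phi>_Bij xy by (simp add: BijGroup_def)
  qed
  interpret gh: group_hom W "BijGroup V" \<phi>
    by (intro group_hom.intro group_hom_axioms.intro is_group group_BijGroup hom)
  have image_S: "\<phi> ` S = simple_refl D ` simple D" using refl by (auto simp: D)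
  have "generate (BijGroup V) (\<phi> ` S) = \<phi> ` generate W S"
    using gh.generate_img[of S] S_carrier by blast
  also have "generate W S = carrier W" using cox by (simp add: coxeter_system_def)
  finally have car: "carrier (datum_group D) = \<phi> ` carrier W"
    unfolding datum_group_def image_S[symmetric] by (simp add: D)
  have inj: "inj_on \<phi> (carrier W)"
  proof (rule inj_onI)
    fix x y assume xy: "x \<in> carrier W" "y \<in> carrier W" "\<phi> x = \<phi> y"
    have eq: "rho x (coord s) r = rho y (coord s) r" if "s \<in> S" for s r
    proof (cases "r \<in> S")
      case True
      have *: "co (\<phi> w (\<alpha> s)) r = rho w (coord s) r" if "w \<in> carrier W" for w
      proof -
        have "co (\<phi> w (\<alpha> s)) r = rho w (co (\<alpha> s)) r" using \<alpha>_V[OF \<open>s \<in> S\<close>] co_vc[OF True] by (simp add: \<phi>_def)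
        also have "\<dots> = rho w (coord s) r" by (rule rho_cong_S[OF that _ True]) (rule co_\<alpha>[OF \<open>s \<in> S\<close>])
        finally show ?thesis .
      qed
      show ?thesis using *[OF xy(1)] *[OF xy(2)] xy(3) by simp
    next
      case False
      then show ?thesis using rho_outside xy by metis
    qed
    have "inv y \<otimes> x = \<one>"
    proof (rule rho_faithful)
      fix s r assume "s \<in> S"
      then have "rho x (coord s) = rho y (coord s)" using eq by blast
      then show "rho (inv y \<otimes> x) (coord s) r = coord s r" using xy by (simp add: rho_mult rho_inv)
    qed (use xy in simp)
    then show "x = y" using xy by (metis inv_closed inv_equality inv_inv)
  qed
  have "\<phi> \<in> iso W (datum_group D)"
    unfolding iso_def
  proof (intro CollectI conjI)
    show "bij_betw \<phi> (carrier W) (carrier (datum_group D))" using inj car by (simp add: bij_betw_def)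
    show "\<phi> \<in> hom W (datum_group D)"
    proof (rule homI)
      fix x y assume xy: "x \<in> carrier W" "y \<in> carrier W"
      then show "\<phi> x \<in> carrier (datum_group D)" using car by blast
      show "\<phi> (x \<otimes> y) = \<phi> x \<otimes>\<^bsub>datum_group D\<^esub> \<phi> y"
        using hom_mult[OF hom xy] by (simp add: datum_group_def D)
    qed
  qed
  then have rdo: "realized_datum_of W S D \<phi>"
    using rd image_S by (simp add: realized_datum_of_def coxeter_iso_def)
  interpret r: realized W S D \<phi> by unfold_locales (rule rdo)
  have al: "r.al s = \<alpha> s" if "s \<in> S" for s using r.al_refl[of s "\<alpha> s"] that refl by (simp add: D)
  have "r.mat s t = a s t" if "s \<in> S" "t \<in> S" for s t
    using that sum_coord[OF finS that(1), of "\<lambda>u. a u t"]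
    by (simp add: r.mat_def al D B_\<alpha> colin_def co_\<alpha>)
  then show ?thesis using rdo by blast
qed

end

lemma rescaled_if_eq: "(\<And>s t. s \<in> S \<Longrightarrow> t \<in> S \<Longrightarrow> a s t = b s t) \<Longrightarrow> rescaled S a b"
  unfolding rescaled_def by (intro exI[of _ "\<lambda>_. 1"]) auto

lemma (in realized) closure_op_eq:
  assumes "definite_kernel S mat" shows "closure_op W S D \<phi> = coxeter_matrix.Cl W S mat"
proof -
  interpret independent_realized W S D \<phi> by unfold_locales (rule assms)
  show ?thesis by (rule closure_op_eq_Cl)
qed

section \<open>The operators arising from a cycle\<close>

context coxeter_cycle
begin

text \<open>1, 2 and 1 / 2 represent the three signs of q - 1. The types of the spaces are arbitrary
  here, so no choice of types yields a further operator.\<close>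

lemma closure_op_cases:
  fixes D :: "('v::real_vector, 'd::real_vector) root_datum"
  assumes "realized_datum_of W S D \<phi>"
  shows "closure_op W S D \<phi> \<in> (\<lambda>q. coxeter_matrix.Cl W S (cycm N \<sigma> q)) ` {1, 2, 1 / 2}"
proof -
  interpret r: realized W S D \<phi> by unfold_locales (rule assms)
  have m: "coxeter_matrix W S r.mat" by (rule r.coxeter_matrix_axioms)
  obtain q where q: "q > 0" "rescaled S r.mat (cycm N \<sigma> q)" using rescaled_cycm[OF m] by blast
  have "\<exists>q'\<in>{1, 2, 1 / 2}. q' > 0 \<and> sgn (q - 1) = sgn (q' - 1)"
  proof (cases q "1::real" rule: linorder_cases)
    case less
    then show ?thesis by (intro bexI[of _ "1 / 2"]) auto
  next
    case equal
    then show ?thesis by (intro bexI[of _ 1]) auto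
  next
    case greater
    then show ?thesis by (intro bexI[of _ 2]) auto
  qed
  then obtain q' where q': "q' \<in> {1, 2, 1 / 2}" "q' > 0" "sgn (q - 1) = sgn (q' - 1)" by blast
  have "closure_op W S D \<phi> = coxeter_matrix.Cl W S (cycm N \<sigma> q')"
    using r.closure_op_eq[OF definite_kernel[OF m]] Cl_eq_if_sgn[OF m q(2,1) q'(2,3)] by simp
  then show ?thesis using q'(1) by blast
qed

lemma closure_ops_real_inf:
  "closure_ops TYPE(real_inf) TYPE(real_inf) W S = (\<lambda>q. coxeter_matrix.Cl W S (cycm N \<sigma> q)) ` {1, 2, 1 / 2}"
proof
  show "closure_ops TYPE(real_inf) TYPE(real_inf) W S \<subseteq> (\<lambda>q. coxeter_matrix.Cl W S (cycm N \<sigma> q)) ` {1, 2, 1 / 2}"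
    unfolding closure_ops_def using closure_op_cases by blast
  show "(\<lambda>q. coxeter_matrix.Cl W S (cycm N \<sigma> q)) ` {1, 2, 1 / 2} \<subseteq> closure_ops TYPE(real_inf) TYPE(real_inf) W S"
  proof (rule image_subsetI)
    fix q :: real assume "q \<in> {1, 2, 1 / 2}"
    then have q: "q > 0" by auto
    interpret c: cyclic W S "cycm N \<sigma> q" N \<sigma> q by (rule cycm_cyclic[OF q])
    obtain D :: "(real_inf, real_inf) root_datum" and \<phi> where D: "realized_datum_of W S D \<phi>"
      "\<forall>s\<in>S. \<forall>t\<in>S. realized.mat D \<phi> s t = cycm N \<sigma> q s t" using c.realization_exists by blast
    interpret r: realized W S D \<phi> by unfold_locales (rule D)
    have m: "coxeter_matrix W S r.mat" by (rule r.coxeter_matrix_axioms)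
    have "rescaled S r.mat (cycm N \<sigma> q)" using D(2) by (intro rescaled_if_eq) blast
    then have "coxeter_matrix.Cl W S (cycm N \<sigma> q) = closure_op W S D \<phi>"
      using r.closure_op_eq[OF definite_kernel[OF m]] Cl_rescaled[OF m c.coxeter_matrix_axioms] by simp
    then show "coxeter_matrix.Cl W S (cycm N \<sigma> q) \<in> closure_ops TYPE(real_inf) TYPE(real_inf) W S"
      unfolding closure_ops_def using D(1) by blast
  qed
qed

lemma card_closure_ops:
  assumes "N \<ge> 4" shows "card (closure_ops TYPE(real_inf) TYPE(real_inf) W S) = 3"
proof -
  have "inj_on (\<lambda>q. coxeter_matrix.Cl W S (cycm N \<sigma> q)) {1, 2, 1 / 2 :: real}"
  proof (rule inj_onI, rule ccontr)
    fix q q' :: real assume q: "q \<in> {1, 2, 1 / 2}" "q' \<in> {1, 2, 1 / 2}" "q \<noteq> q'"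
      and eq: "coxeter_matrix.Cl W S (cycm N \<sigma> q) = coxeter_matrix.Cl W S (cycm N \<sigma> q')"
    have "q > 0" "q' > 0" "sgn (q - 1) \<noteq> sgn (q' - 1)" using q by auto
    then show False using cyclic_Cl_distinct[OF cycm_cyclic cycm_cyclic assms] eq by blast
  qed
  then show ?thesis unfolding closure_ops_real_inf by (simp add: card_image)
qed

end

text \<open>A set of operators can collect data over one pair of types only. They are therefore
  counted over the countable-dimensional space, and the inclusion states that data over any other
  types give none beyond these.\<close>

theorem theorem4p14:
  fixes W :: "('g, 'b) monoid_scheme" and S :: "'g set"
  assumes "coxeter_system W S" and "finite S"
  shows
    "(finite (carrier W) \<or>
        irreducible_affine_weyl_group TYPE('e::euclidean_space) W S \<and>
        \<not> (\<exists>n\<ge>3. type_A_tilde n W S)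
      \<longrightarrow>
        (\<forall>(D1 :: ('v1::real_vector, 'd1::real_vector) root_datum) \<phi>1
          (D2 :: ('v2::real_vector, 'd2::real_vector) root_datum) \<phi>2.
            realized_datum_of W S D1 \<phi>1 \<and> realized_datum_of W S D2 \<phi>2 \<longrightarrow>
            closure_op W S D1 \<phi>1 = closure_op W S D2 \<phi>2))
     \<and>
     ((\<exists>n\<ge>3. type_A_tilde n W S) \<longrightarrow>
        card (closure_ops TYPE(real_inf) TYPE(real_inf) W S) = 3 \<and>
        closure_ops TYPE('v1) TYPE('d1) W S \<subseteq> closure_ops TYPE(real_inf) TYPE(real_inf) W S)"
proof (intro conjI impI allI)
  interpret coxeter W S using assms by unfold_locales
  {
    fix D1 :: "('v1, 'd1) root_datum" and \<phi>1 and D2 :: "('v2, 'd2) root_datum" and \<phi>2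
    assume c: "finite (carrier W) \<or> irreducible_affine_weyl_group TYPE('e::euclidean_space) W S \<and>
        \<not> (\<exists>n\<ge>3. type_A_tilde n W S)"
      and D: "realized_datum_of W S D1 \<phi>1 \<and> realized_datum_of W S D2 \<phi>2"
    interpret r1: realized W S D1 \<phi>1 using D by unfold_locales blast
    interpret r2: realized W S D2 \<phi>2 using D by unfold_locales blast
    have m: "coxeter_matrix W S r1.mat" "coxeter_matrix W S r2.mat"
      by (rule r1.coxeter_matrix_axioms r2.coxeter_matrix_axioms)+
    have "definite_kernel S r1.mat \<and> definite_kernel S r2.mat \<and>
        coxeter_matrix.Cl W S r1.mat = coxeter_matrix.Cl W S r2.mat"
      using c
    proof
      assume fin: "finite (carrier W)"
      show ?thesis
        using r1.finite_definite_kernel[OF fin] r2.finite_definite_kernel[OF fin]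
          Cl_rescaled[OF m finite_rescaled[OF m fin]] by blast
    next
      assume "irreducible_affine_weyl_group TYPE('e::euclidean_space) W S \<and> \<not> (\<exists>n\<ge>3. type_A_tilde n W S)"
      then show ?thesis using affine_unique m by blast
    qed
    then show "closure_op W S D1 \<phi>1 = closure_op W S D2 \<phi>2"
      using r1.closure_op_eq r2.closure_op_eq by simp
  }
  assume "\<exists>n\<ge>3. type_A_tilde n W S"
  then obtain n where n: "n \<ge> 3" "type_A_tilde n W S" by blast
  then obtain \<sigma> where "coxeter_cycle W S (n + 1) \<sigma>" using type_A_tilde_cycle by blast
  then interpret coxeter_cycle W S "n + 1" \<sigma> .
  show "card (closure_ops TYPE(real_inf) TYPE(real_inf) W S) = 3" using card_closure_ops n by simp
  show "closure_ops TYPE('v1) TYPE('d1) W S \<subseteq> closure_ops TYPE(real_inf) TYPE(real_inf) W S"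
    unfolding closure_ops_real_inf unfolding closure_ops_def using closure_op_cases by blast
qed

end
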